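(* Let $F$ be an arbitrary field. There exists a finitely generated associative (not necessarily unital) $F$-algebra $T$ such that $T$ is not linear sofic, $T$ is Jacobson radical, and the unital hull $T^1$ of $T$ is (thus) a stably finite algebra that is not linear sofic.
   Context: Algebras are associative but not necessarily commutative, and here not necessarily unital. For a matrix $P\in M_n(F)$, $\mathrm{rk}(P)$ denotes its rank. Linear soficity: let $\mathcal{U}$ be a non-principal ultrafilter on $\mathbb{N}$ and $(n_k)_k$ a sequence of natural numbers tending to infinity. Define the asymptotic rank function $\rho_{\mathcal U}\colon \prod_k M_{n_k}(F)\to[0,1]$ by $\rho_{\mathcal U}((A_k)_k)=\lim_{k\to\mathcal U}\frac{1}{n_k}\mathrm{rk}(A_k)$ (limit along the ultrafilter). The set $\mathrm{Ker}(\rho_{\mathcal U})=\{(A_k)_k:\rho_{\mathcal U}((A_k)_k)=0\}$ is a two-sided ideal, and the quotient algebra $\prod_{k\to\mathcal U}M_{n_k}(F)/\mathrm{Ker}(\rho_{\mathcal U}):=\left(\prod_k M_{n_k}(F)\right)/\mathrm{Ker}(\rho_{\mathcal U})$ is called the metric ultraproduct. A countably generated $F$-algebra $A$ is linear sofic if, for some such $\mathcal U$ and $(n_k)_k$, there exists an injective $F$-algebra homomorphism (not required to preserve units) $\Phi\colon A\to\prod_{k\to\mathcal U}M_{n_k}(F)/\mathrm{Ker}(\rho_{\mathcal U})$. A unital ring $R$ is directly finite if $xy=1$ implies $yx=1$ for all $x,y\in R$; it is stably finite if $M_n(R)$ is directly finite for every $n\in\mathbb{N}$. An algebra is Jacobson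 radical if it equals its own Jacobson radical, equivalently every element $f$ is quasi-invertible: there is $g$ in the algebra with $fg=gf=f+g$. The unital hull of an $F$-algebra $R$ is the vector space $R^1:=F\oplus R$ with multiplication $(\alpha+r)(\alpha'+r'):=\alpha\alpha'+\alpha r'+\alpha' r+rr'$. *)

theory Defs
  imports "Jordan_Normal_Form.DL_Rank" "HOL-Algebra.QuotRing"
begin

section \<open>Associative algebras, not necessarily unital\<close>

text \<open>
  Algebras are carried by the record type \<^typ>\<open>('f, 'a) module\<close>. The field \<^const>\<open>one\<close> of that
  record is ignored unless a ring is explicitly required to be unital.
\<close>

locale nonunital_algebra = Module.module +
  assumes mult_closed: "\<lbrakk>x \<in> carrier M; y \<in> carrier M\<rbrakk> \<Longrightarrow> x \<otimes>\<^bsub>M\<^esub> y \<in> carrier M"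
    and mult_assoc: "\<lbrakk>x \<in> carrier M; y \<in> carrier M; z \<in> carrier M\<rbrakk> \<Longrightarrow>
      (x \<otimes>\<^bsub>M\<^esub> y) \<otimes>\<^bsub>M\<^esub> z = x \<otimes>\<^bsub>M\<^esub> (y \<otimes>\<^bsub>M\<^esub> z)"
    and distrib_right: "\<lbrakk>x \<in> carrier M; y \<in> carrier M; z \<in> carrier M\<rbrakk> \<Longrightarrow>
      (x \<oplus>\<^bsub>M\<^esub> y) \<otimes>\<^bsub>M\<^esub> z = x \<otimes>\<^bsub>M\<^esub> z \<oplus>\<^bsub>M\<^esub> y \<otimes>\<^bsub>M\<^esub> z"
    and distrib_left: "\<lbrakk>x \<in> carrier M; y \<in> carrier M; z \<in> carrier M\<rbrakk> \<Longrightarrow>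
      z \<otimes>\<^bsub>M\<^esub> (x \<oplus>\<^bsub>M\<^esub> y) = z \<otimes>\<^bsub>M\<^esub> x \<oplus>\<^bsub>M\<^esub> z \<otimes>\<^bsub>M\<^esub> y"
    and smult_mult_left: "\<lbrakk>a \<in> carrier R; x \<in> carrier M; y \<in> carrier M\<rbrakk> \<Longrightarrow>
      (a \<odot>\<^bsub>M\<^esub> x) \<otimes>\<^bsub>M\<^esub> y = a \<odot>\<^bsub>M\<^esub> (x \<otimes>\<^bsub>M\<^esub> y)"
    and smult_mult_right: "\<lbrakk>a \<in> carrier R; x \<in> carrier M; y \<in> carrier M\<rbrakk> \<Longrightarrow>
      x \<otimes>\<^bsub>M\<^esub> (a \<odot>\<^bsub>M\<^esub> y) = a \<odot>\<^bsub>M\<^esub> (x \<otimes>\<^bsub>M\<^esub> y)"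

definition subalgebra :: "'a set \<Rightarrow> ('f, 'r) ring_scheme \<Rightarrow> ('f, 'a, 'm) module_scheme \<Rightarrow> bool"
  where "subalgebra B R A \<longleftrightarrow>
    Module.submodule B R A \<and> (\<forall>x\<in>B. \<forall>y\<in>B. x \<otimes>\<^bsub>A\<^esub> y \<in> B)"

definition algebra_generated ::
    "('f, 'r) ring_scheme \<Rightarrow> ('f, 'a, 'm) module_scheme \<Rightarrow> 'a set \<Rightarrow> 'a set"
  where "algebra_generated R A S = \<Inter>{B. subalgebra B R A \<and> S \<subseteq> B}"

definition finitely_generated_algebra ::
    "('f, 'r) ring_scheme \<Rightarrow> ('f, 'a, 'm) module_scheme \<Rightarrow> bool"
  where "finitely_generated_algebra R A \<longleftrightarrow>
    (\<exists>S. finite S \<and> S \<subseteq> carrier A \<and> algebra_generated R A S = carrier A)"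

text \<open>
  Up to isomorphism, every finitely generated algebra over the field \<^typ>\<open>'f::field\<close> is a quotient
  of a free algebra, whose elements are finitely supported functions of type
  \<^typ>\<open>nat list \<Rightarrow> 'f\<close>. Its carrier can therefore be taken to consist of cosets, of type
  \<^typ>\<open>(nat list \<Rightarrow> 'f) set\<close>, so asking for the existence of such an algebra over that carrier type
  is no restriction.
\<close>

definition algebra_hom ::
    "('f, 'r) ring_scheme \<Rightarrow> ('f, 'a, 'm) module_scheme \<Rightarrow> ('f, 'b, 'n) module_scheme \<Rightarrow> ('a \<Rightarrow> 'b) set"
  where "algebra_hom R A B = {h \<in> LinearCombinations.module_hom R A B.
    \<forall>x\<in>carrier A. \<forall>y\<in>carrier A. h (x \<otimes>\<^bsub>A\<^esub> y) = h x \<otimes>\<^bsub>B\<^esub> h y}"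

section \<open>Jacobson radical algebras\<close>

definition algebra_ideal :: "'a set \<Rightarrow> ('f, 'r) ring_scheme \<Rightarrow> ('f, 'a, 'm) module_scheme \<Rightarrow> bool"
  where "algebra_ideal I R A \<longleftrightarrow> Module.submodule I R A \<and>
    (\<forall>x\<in>I. \<forall>a\<in>carrier A. a \<otimes>\<^bsub>A\<^esub> x \<in> I \<and> x \<otimes>\<^bsub>A\<^esub> a \<in> I)"

definition quasi_invertible :: "('a, 'm) ring_scheme \<Rightarrow> 'a \<Rightarrow> bool"
  where "quasi_invertible A f \<longleftrightarrow>
    (\<exists>g\<in>carrier A. f \<otimes>\<^bsub>A\<^esub> g = f \<oplus>\<^bsub>A\<^esub> g \<and> g \<otimes>\<^bsub>A\<^esub> f = f \<oplus>\<^bsub>A\<^esub> g)"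

text \<open>
  The Jacobson radical of a possibly non-unital algebra is its largest ideal consisting of
  quasi-invertible elements.
\<close>

definition jacobson_radical ::
    "('f, 'r) ring_scheme \<Rightarrow> ('f, 'a, 'm) module_scheme \<Rightarrow> 'a set"
  where "jacobson_radical R A =
    \<Union>{I. algebra_ideal I R A \<and> (\<forall>f\<in>I. quasi_invertible A f)}"

definition jacobson_radical_algebra ::
    "('f, 'r) ring_scheme \<Rightarrow> ('f, 'a, 'm) module_scheme \<Rightarrow> bool"
  where "jacobson_radical_algebra R A \<longleftrightarrow> jacobson_radical R A = carrier A"

lemma (in nonunital_algebra) algebra_ideal_carrier: "algebra_ideal (carrier M) R M"
proof -
  have "Module.submodule (carrier M) R M"
    by (rule carrier_is_submodule)
  then show ?thesis by (simp add: algebra_ideal_def mult_closed)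
qed

lemma (in nonunital_algebra) jacobson_radical_algebra_iff:
  "jacobson_radical_algebra R M \<longleftrightarrow> (\<forall>f\<in>carrier M. quasi_invertible M f)"
proof
  assume "jacobson_radical_algebra R M"
  then show "\<forall>f\<in>carrier M. quasi_invertible M f"
    unfolding jacobson_radical_algebra_def jacobson_radical_def by blast
next
  assume "\<forall>f\<in>carrier M. quasi_invertible M f"
  moreover have "I \<subseteq> carrier M" if "algebra_ideal I R M" for I
    using that submoduleE(1) unfolding algebra_ideal_def by blast
  ultimately show "jacobson_radical_algebra R M"
    unfolding jacobson_radical_algebra_def jacobson_radical_def
    using algebra_ideal_carrier by blast
qed

section \<open>The unital hull\<close>

definition unital_hull :: "('f::field, 'a, 'm) module_scheme \<Rightarrow> ('f, 'f \<times> 'a) module"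
  where "unital_hull A = \<lparr>
    carrier = UNIV \<times> carrier A,
    mult = (\<lambda>(\<alpha>, r) (\<beta>, s). (\<alpha> * \<beta>, \<alpha> \<odot>\<^bsub>A\<^esub> s \<oplus>\<^bsub>A\<^esub> \<beta> \<odot>\<^bsub>A\<^esub> r \<oplus>\<^bsub>A\<^esub> r \<otimes>\<^bsub>A\<^esub> s)),
    one = (1, \<zero>\<^bsub>A\<^esub>),
    zero = (0, \<zero>\<^bsub>A\<^esub>),
    add = (\<lambda>(\<alpha>, r) (\<beta>, s). (\<alpha> + \<beta>, r \<oplus>\<^bsub>A\<^esub> s)),
    smult = (\<lambda>\<gamma> (\<alpha>, r). (\<gamma> * \<alpha>, \<gamma> \<odot>\<^bsub>A\<^esub> r))\<rparr>"

lemma unital_hull_simps [simp]: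
  "carrier (unital_hull A) = UNIV \<times> carrier A"
  "(\<alpha>, r) \<otimes>\<^bsub>unital_hull A\<^esub> (\<beta>, s) = (\<alpha> * \<beta>, \<alpha> \<odot>\<^bsub>A\<^esub> s \<oplus>\<^bsub>A\<^esub> \<beta> \<odot>\<^bsub>A\<^esub> r \<oplus>\<^bsub>A\<^esub> r \<otimes>\<^bsub>A\<^esub> s)"
  "\<one>\<^bsub>unital_hull A\<^esub> = (1, \<zero>\<^bsub>A\<^esub>)"
  "\<zero>\<^bsub>unital_hull A\<^esub> = (0, \<zero>\<^bsub>A\<^esub>)"
  "(\<alpha>, r) \<oplus>\<^bsub>unital_hull A\<^esub> (\<beta>, s) = (\<alpha> + \<beta>, r \<oplus>\<^bsub>A\<^esub> s)"
  "\<gamma> \<odot>\<^bsub>unital_hull A\<^esub> (\<alpha>, r) = (\<gamma> * \<alpha>, \<gamma> \<odot>\<^bsub>A\<^esub> r)"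
  by (simp_all add: unital_hull_def)

lemma
  fixes A :: "('f::field, 'a, 'm) module_scheme"
  assumes "nonunital_algebra class_ring A"
  shows ring_unital_hull: "ring (unital_hull A)"
    and nonunital_algebra_unital_hull: "nonunital_algebra class_ring (unital_hull A)"
proof -
  interpret A: nonunital_algebra "class_ring :: 'f ring" A by fact
  note [simp] = A.mult_closed
  have smult [simp]: "c \<odot>\<^bsub>A\<^esub> x \<in> carrier A" if "x \<in> carrier A" for c x
    using A.smult_closed[of c x] that by simp
  have l [simp]: "(c + d) \<odot>\<^bsub>A\<^esub> x = c \<odot>\<^bsub>A\<^esub> x \<oplus>\<^bsub>A\<^esub> d \<odot>\<^bsub>A\<^esub> x" if "x \<in> carrier A" for c d x
    using A.smult_l_distr[of c d x] that by simp
  have r [simp]: "c \<odot>\<^bsub>A\<^esub> (x \<oplus>\<^bsub>A\<^esub> y) = c \<odot>\<^bsub>A\<^esub> x \<oplus>\<^bsub>A\<^esub> c \<odot>\<^bsub>A\<^esub> y"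
    if "x \<in> carrier A" "y \<in> carrier A" for c x y
    using A.smult_r_distr[of c x y] that by simp
  have a [simp]: "(c * d) \<odot>\<^bsub>A\<^esub> x = c \<odot>\<^bsub>A\<^esub> (d \<odot>\<^bsub>A\<^esub> x)" if "x \<in> carrier A" for c d x
    using A.smult_assoc1[of c d x] that by simp
  have c: "c \<odot>\<^bsub>A\<^esub> (d \<odot>\<^bsub>A\<^esub> x) = d \<odot>\<^bsub>A\<^esub> (c \<odot>\<^bsub>A\<^esub> x)" if "x \<in> carrier A" for c d x
    using a[OF that, of c d] a[OF that, of d c] by (simp add: mult.commute del: a)
  have one [simp]: "(1::'f) \<odot>\<^bsub>A\<^esub> x = x" if "x \<in> carrier A" for x
    using A.smult_one[of x] that by simp
  have zero [simp]: "(0::'f) \<odot>\<^bsub>A\<^esub> x = \<zero>\<^bsub>A\<^esub>" if "x \<in> carrier A" for x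
    using A.smult_l_null[of x] that by simp
  have zero' [simp]: "c \<odot>\<^bsub>A\<^esub> \<zero>\<^bsub>A\<^esub> = \<zero>\<^bsub>A\<^esub>" for c
    using A.smult_r_null[of c] by simp
  have ml [simp]: "(c \<odot>\<^bsub>A\<^esub> x) \<otimes>\<^bsub>A\<^esub> y = c \<odot>\<^bsub>A\<^esub> (x \<otimes>\<^bsub>A\<^esub> y)"
    and mr [simp]: "x \<otimes>\<^bsub>A\<^esub> (c \<odot>\<^bsub>A\<^esub> y) = c \<odot>\<^bsub>A\<^esub> (x \<otimes>\<^bsub>A\<^esub> y)"
    if "x \<in> carrier A" "y \<in> carrier A" for c x y
    using A.smult_mult_left[of c x y] A.smult_mult_right[of c x y] that by simp_all
  have z [simp]: "\<zero>\<^bsub>A\<^esub> \<otimes>\<^bsub>A\<^esub> x = \<zero>\<^bsub>A\<^esub>" "x \<otimes>\<^bsub>A\<^esub> \<zero>\<^bsub>A\<^esub> = \<zero>\<^bsub>A\<^esub>" if "x \<in> carrier A" for x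
    using ml[of "\<zero>\<^bsub>A\<^esub>" x 0] mr[of x "\<zero>\<^bsub>A\<^esub>" 0] that by simp_all
  have neg: "\<exists>y\<in>carrier A. y \<oplus>\<^bsub>A\<^esub> x = \<zero>\<^bsub>A\<^esub>" if "x \<in> carrier A" for x
    using that by (intro bexI[of _ "\<ominus>\<^bsub>A\<^esub> x"]) (simp_all add: A.M.l_neg)
  have grp: "abelian_group (unital_hull A)"
  proof (rule abelian_groupI)
    fix x assume "x \<in> carrier (unital_hull A)"
    then obtain \<alpha> r where x: "x = (\<alpha>, r)" "r \<in> carrier A" by auto
    with neg[of r] obtain y where "y \<in> carrier A" "y \<oplus>\<^bsub>A\<^esub> r = \<zero>\<^bsub>A\<^esub>" by blast
    with x show "\<exists>y\<in>carrier (unital_hull A). y \<oplus>\<^bsub>unital_hull A\<^esub> x = \<zero>\<^bsub>unital_hull A\<^esub>"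
      by (intro bexI[of _ "(- \<alpha>, y)"]) auto
  qed (auto simp: A.M.a_ac algebra_simps)
  show "ring (unital_hull A)"
  proof (rule ringI[OF grp])
    show "Group.monoid (unital_hull A)"
      by (rule monoidI)
        (auto simp: A.distrib_left A.distrib_right A.mult_assoc c A.M.a_ac algebra_simps)
  qed (auto simp: A.distrib_left A.distrib_right A.M.a_ac algebra_simps)
  then interpret H: ring "unital_hull A" .
  show "nonunital_algebra class_ring (unital_hull A)"
  proof (intro nonunital_algebra.intro Module.moduleI nonunital_algebra_axioms.intro grp
      class_cring.cring_axioms)
    fix x y z
    assume xyz: "x \<in> carrier (unital_hull A)" "y \<in> carrier (unital_hull A)"
      "z \<in> carrier (unital_hull A)"
    show "x \<otimes>\<^bsub>unital_hull A\<^esub> y \<otimes>\<^bsub>unital_hull A\<^esub> z = x \<otimes>\<^bsub>unital_hull A\<^esub> (y \<otimes>\<^bsub>unital_hull A\<^esub> z)"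
      using xyz by (rule H.m_assoc)
    show "(x \<oplus>\<^bsub>unital_hull A\<^esub> y) \<otimes>\<^bsub>unital_hull A\<^esub> z =
        x \<otimes>\<^bsub>unital_hull A\<^esub> z \<oplus>\<^bsub>unital_hull A\<^esub> y \<otimes>\<^bsub>unital_hull A\<^esub> z"
      using xyz by (rule H.l_distr)
    show "z \<otimes>\<^bsub>unital_hull A\<^esub> (x \<oplus>\<^bsub>unital_hull A\<^esub> y) =
        z \<otimes>\<^bsub>unital_hull A\<^esub> x \<oplus>\<^bsub>unital_hull A\<^esub> z \<otimes>\<^bsub>unital_hull A\<^esub> y"
      using xyz by (rule H.r_distr)
  qed (auto simp: c A.M.a_ac algebra_simps)
qed

section \<open>Stable finiteness\<close>

definition directly_finite :: "('a, 'm) ring_scheme \<Rightarrow> bool"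
  where "directly_finite R \<longleftrightarrow>
    (\<forall>x\<in>carrier R. \<forall>y\<in>carrier R. x \<otimes>\<^bsub>R\<^esub> y = \<one>\<^bsub>R\<^esub> \<longrightarrow> y \<otimes>\<^bsub>R\<^esub> x = \<one>\<^bsub>R\<^esub>)"

definition matrix_ring :: "nat \<Rightarrow> ('a, 'm) ring_scheme \<Rightarrow> 'a mat ring"
  where "matrix_ring n R = \<lparr>
    carrier = {A \<in> carrier_mat n n. elements_mat A \<subseteq> carrier R},
    mult = (\<lambda>A B. mat n n (\<lambda>(i, j). \<Oplus>\<^bsub>R\<^esub>k\<in>{..<n}. A $$ (i, k) \<otimes>\<^bsub>R\<^esub> B $$ (k, j))),
    one = mat n n (\<lambda>(i, j). if i = j then \<one>\<^bsub>R\<^esub> else \<zero>\<^bsub>R\<^esub>),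
    zero = mat n n (\<lambda>(i, j). \<zero>\<^bsub>R\<^esub>),
    add = (\<lambda>A B. mat n n (\<lambda>(i, j). A $$ (i, j) \<oplus>\<^bsub>R\<^esub> B $$ (i, j)))\<rparr>"

definition stably_finite :: "('a, 'm) ring_scheme \<Rightarrow> bool"
  where "stably_finite R \<longleftrightarrow> (\<forall>n. directly_finite (matrix_ring n R))"

section \<open>Metric ultraproducts and linear soficity\<close>

definition ultrafilter :: "'a filter \<Rightarrow> bool"
  where "ultrafilter U \<longleftrightarrow> U \<noteq> bot \<and> (\<forall>P. eventually P U \<or> eventually (\<lambda>x. \<not> P x) U)"

definition nonprincipal :: "'a filter \<Rightarrow> bool"
  where "nonprincipal U \<longleftrightarrow> (\<forall>a. U \<noteq> principal {a})"

definition matrix_product :: "(nat \<Rightarrow> nat) \<Rightarrow> ('f::field, nat \<Rightarrow> 'f mat) module"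
  where "matrix_product n = \<lparr>
    carrier = {A. \<forall>k. A k \<in> carrier_mat (n k) (n k)},
    mult = (\<lambda>A B k. A k * B k),
    one = (\<lambda>k. 1\<^sub>m (n k)),
    zero = (\<lambda>k. 0\<^sub>m (n k) (n k)),
    add = (\<lambda>A B k. A k + B k),
    smult = (\<lambda>c A k. c \<cdot>\<^sub>m A k)\<rparr>"

definition asymptotic_rank :: "nat filter \<Rightarrow> (nat \<Rightarrow> nat) \<Rightarrow> (nat \<Rightarrow> 'f::field mat) \<Rightarrow> real"
  where "asymptotic_rank U n A = Lim U (\<lambda>k. real (vec_space.rank (n k) (A k)) / real (n k))"

definition asymptotic_rank_kernel :: "nat filter \<Rightarrow> (nat \<Rightarrow> nat) \<Rightarrow> (nat \<Rightarrow> 'f::field mat) set"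
  where "asymptotic_rank_kernel U n =
    {A \<in> carrier (matrix_product n). asymptotic_rank U n A = 0}"

text \<open>\<^const>\<open>FactRing\<close> forgets the scalar multiplication, which is put back here.\<close>

definition quotient_algebra :: "('f, 'a, 'm) module_scheme \<Rightarrow> 'a set \<Rightarrow> ('f, 'a set) module"
  where "quotient_algebra A I =
    ring.extend (A Quot I) (module.fields (\<lambda>c X. \<Union>x\<in>X. I +>\<^bsub>A\<^esub> (c \<odot>\<^bsub>A\<^esub> x)))"

lemma quotient_algebra_simps:
  "carrier (quotient_algebra A I) = a_rcosets\<^bsub>A\<^esub> I"
  "X \<oplus>\<^bsub>quotient_algebra A I\<^esub> Y = X <+>\<^bsub>A\<^esub> Y"
  "X \<otimes>\<^bsub>quotient_algebra A I\<^esub> Y = rcoset_mult A I X Y"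
  "\<zero>\<^bsub>quotient_algebra A I\<^esub> = I"
  "\<one>\<^bsub>quotient_algebra A I\<^esub> = I +>\<^bsub>A\<^esub> \<one>\<^bsub>A\<^esub>"
  "c \<odot>\<^bsub>quotient_algebra A I\<^esub> X = (\<Union>x\<in>X. I +>\<^bsub>A\<^esub> (c \<odot>\<^bsub>A\<^esub> x))"
  by (simp_all add: quotient_algebra_def FactRing_def ring.defs module.defs)

definition metric_ultraproduct ::
    "nat filter \<Rightarrow> (nat \<Rightarrow> nat) \<Rightarrow> ('f::field, (nat \<Rightarrow> 'f mat) set) module"
  where "metric_ultraproduct U n =
    quotient_algebra (matrix_product n) (asymptotic_rank_kernel U n)"

text \<open>
  Linear soficity is considered for countably generated algebras only. The sizes \<^term>\<open>n k\<close>
  are positive because of the factor \<open>1 / n k\<close> in the asymptotic rank.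
\<close>

definition linear_sofic :: "('f::field, 'a, 'm) module_scheme \<Rightarrow> bool"
  where "linear_sofic A \<longleftrightarrow>
    (\<exists>(U :: nat filter) (n :: nat \<Rightarrow> nat). ultrafilter U \<and> nonprincipal U \<and>
      (\<forall>k. n k > 0) \<and> filterlim n at_top sequentially \<and>
      (\<exists>\<Phi>. \<Phi> \<in> algebra_hom class_ring A (metric_ultraproduct U n) \<and> inj_on \<Phi> (carrier A)))"

end

theory Submission
  imports Defs "HOL-Library.Poly_Mapping" "HOL-Library.Cardinality"
begin

text \<open>
  An element \<open>a\<close> of an algebra is invisible to ranks if there are elements \<open>x\<^sub>i\<close>, \<open>b\<close>, \<open>y\<^sub>j\<close>, for \<open>i\<close> and
  \<open>j\<close> ranging over the natural numbers, with \<open>x\<^sub>i b y\<^sub>j = \<delta>\<^sub>i\<^sub>j a\<close>: in every metric ultraproduct the relations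
  force \<open>n \<cdot> \<rho>(a) \<le> \<rho>(b) \<le> 1\<close> for the asymptotic rank \<open>\<rho>\<close> and all \<open>n\<close>, so \<open>a\<close> is mapped to zero. An algebra
  with such relations and \<open>a \<noteq> 0\<close> is not linear sofic, and neither is any algebra containing it, such as
  its unital hull. This is \<open>not_linear_sofic_if_diagonal_relations\<close>.

  The relations are compatible with the algebra being nil. Let \<open>N\<close> be a finitely generated nil algebra of
  infinite dimension and adjoin one more generator \<open>m\<close>. Since \<open>N\<close> contains infinitely many linearly
  independent elements \<open>w\<^sub>i\<close>, a bilinear form \<open>\<beta>\<close> with \<open>\<beta>(w\<^sub>i, w\<^sub>j) = \<delta>\<^sub>i\<^sub>j\<close> can be prescribed, and one can
  require \<open>m u m v m = \<beta>(u, v) a\<close> while all products with more than three factors \<open>m\<close> vanish and \<open>a\<close>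
  is annihilated by all generators. Then \<open>x\<^sub>i = m w\<^sub>i\<close>, \<open>b = m\<close> and \<open>y\<^sub>j = w\<^sub>j m\<close> satisfy the relations. The
  result is nil, because the ideal generated by \<open>m\<close> is nilpotent and the quotient by it is nil. Technically,
  the algebra is the quotient of a free algebra by the largest ideal in the kernel of one linear functional,
  which encodes \<open>\<beta>\<close>; that \<open>a \<noteq> 0\<close> is then a single evaluation. This is
  \<open>nil_quotient_with_diagonal_relations\<close>.

  The nil algebra \<open>N\<close> comes from the theorem of Golod and Shafarevich: a free algebra on three letters
  modulo homogeneous relations is infinite-dimensional if the relations are sparse enough. Over an
  arbitrary field one cannot impose a relation for each element. Instead, the coefficients of the powers
  of a generic element are taken as relations; there are only polynomially many of them in terms of the
  exponent, whereas their degree is at least the exponent. All that is used of \<open>N\<close> is a functional that is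
  nonzero in each degree and vanishes on the ideal of relations (\<open>nil_functional\<close>).

  A nil algebra is Jacobson radical by the geometric series. Finally, the unital hull of any radical algebra
  is stably finite (\<open>stably_finite_unital_hull\<close>): one-sided inverses become two-sided modulo the radical,
  and an idempotent matrix over the radical vanishes by Nakayama's lemma.
\<close>

section \<open>Ranks of matrices and linear systems\<close>

lemma homogeneous_system_nontrivial_solution:
  fixes M :: "'e \<Rightarrow> 'u \<Rightarrow> 'f::field"
  assumes "finite E" "finite X" "card E < card X"
  shows "\<exists>c. (\<exists>u\<in>X. c u \<noteq> 0) \<and> (\<forall>e\<in>E. (\<Sum>u\<in>X. M e u * c u) = 0)"
  using assms
proof (induction E arbitrary: M X rule: finite_induct)
  case empty
  then obtain u where "u \<in> X" by fastforce
  then show ?case by (intro exI[of _ "\<lambda>_. 1"]) auto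
next
  case (insert e E)
  show ?case
  proof (cases "\<forall>u\<in>X. M e u = 0")
    case True
    obtain c where c: "\<exists>u\<in>X. c u \<noteq> 0" "\<forall>e\<in>E. (\<Sum>u\<in>X. M e u * c u) = 0"
      using insert.IH[of X M] insert.prems insert.hyps by auto
    have "(\<Sum>u\<in>X. M e u * c u) = 0" using True by (intro sum.neutral) auto
    with c show ?thesis by auto
  next
    case False
    then obtain p where p: "p \<in> X" "M e p \<noteq> 0" by auto
    define Y where "Y = X - {p}"
    have X: "X = insert p Y" "p \<notin> Y" "finite Y" using p insert.prems by (auto simp: Y_def)
    \<comment> \<open>Equation e is used to eliminate the unknown p from the other equations.\<close>
    define M' where "M' e' u = M e' u - M e' p * M e u / M e p" for e' u
    obtain c where c: "\<exists>u\<in>Y. c u \<noteq> 0" "\<forall>e\<in>E. (\<Sum>u\<in>Y. M' e u * c u) = 0"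
      using insert.IH[of Y M'] insert.prems insert.hyps X by auto
    define t where "t = - (\<Sum>u\<in>Y. M e u * c u) / M e p"
    define d where "d u = (if u = p then t else c u)" for u
    have d: "(\<Sum>u\<in>X. M e' u * d u) = M e' p * t + (\<Sum>u\<in>Y. M e' u * c u)" for e'
    proof -
      have "(\<Sum>u\<in>Y. M e' u * d u) = (\<Sum>u\<in>Y. M e' u * c u)"
        using X by (intro sum.cong) (auto simp: d_def)
      then show ?thesis using X by (simp add: d_def)
    qed
    have "(\<Sum>u\<in>X. M e u * d u) = 0" unfolding d using p by (simp add: t_def)
    moreover have "(\<Sum>u\<in>X. M e' u * d u) = 0" if "e' \<in> E" for e'
    proof -
      have "(\<Sum>u\<in>Y. M' e' u * c u)
          = (\<Sum>u\<in>Y. M e' u * c u) - M e' p / M e p * (\<Sum>u\<in>Y. M e u * c u)"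
        unfolding sum_distrib_left sum_subtractf[symmetric]
        by (intro sum.cong) (auto simp: M'_def algebra_simps)
      with that c show ?thesis unfolding d by (simp add: t_def)
    qed
    moreover have "\<exists>u\<in>X. d u \<noteq> 0" using c X by (auto simp: d_def)
    ultimately show ?thesis by (intro exI[of _ d]) auto
  qed
qed

text \<open>
  Choosing a basis among the columns turns statements about the rank into statements about finite
  sums: every column is a combination of the columns in \<open>J\<close>, and these have no relation.
\<close>

lemma column_basis:
  fixes A :: "'f::field mat"
  assumes A: "A \<in> carrier_mat n n"
  obtains J q where "J \<subseteq> {..<n}" "card J = vec_space.rank n A"
    "\<forall>i<n. \<forall>l<n. A $$ (i, l) = (\<Sum>s\<in>J. A $$ (i, s) * q s l)"
    "\<forall>c. (\<forall>i<n. (\<Sum>s\<in>J. A $$ (i, s) * c s) = 0) \<longrightarrow> (\<forall>s\<in>J. c s = 0)"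
proof -
  interpret vec_space "TYPE('f)" n .
  have colsc: "set (cols A) \<subseteq> carrier_vec n" using A cols_dim by blast
  obtain S where S: "maximal S (\<lambda>T. T \<subseteq> set (cols A) \<and> lin_indpt T)"
    using maximal_exists_superset[of "set (cols A)" "\<lambda>T. T \<subseteq> set (cols A) \<and> lin_indpt T" "{}"]
    by (auto simp: lin_dep_def)
  have Ssub: "S \<subseteq> set (cols A)" and Sind: "lin_indpt S" using S by (auto simp: maximal_def)
  have Sc: "S \<subseteq> carrier_vec n" using Ssub colsc by blast
  have finS: "finite S" using Ssub finite_subset by blast
  have rk: "rank A = card S" using rank_card_indpt[OF A S] .
  have spanS: "v \<in> span S" if v: "v \<in> set (cols A)" for v
  proof (rule ccontr)
    assume nv: "v \<notin> span S"
    have vc: "v \<in> carrier_vec n" using v colsc by blast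
    have "v \<notin> S" using nv Sc in_own_span[of S] by auto
    have "lin_indpt (insert v S)"
      using lin_dep_iff_in_span[OF _ Sind, of v] Sc vc \<open>v \<notin> S\<close> nv by auto
    then have "insert v S = S" using S Ssub v unfolding maximal_def by blast
    with \<open>v \<notin> S\<close> show False by blast
  qed
  have "\<forall>v\<in>S. \<exists>j<n. col A j = v"
    using Ssub A unfolding cols_def by fastforce
  then obtain f where f: "\<And>v. v \<in> S \<Longrightarrow> f v < n" "\<And>v. v \<in> S \<Longrightarrow> col A (f v) = v" by metis
  have inj: "inj_on f S" using f(2) by (metis inj_onI)
  have sumJ: "(\<Sum>s\<in>f ` S. h s) = (\<Sum>v\<in>S. h (f v))" for h :: "nat \<Rightarrow> 'f"
    using sum.reindex[OF inj] by simp
  have entry: "A $$ (i, f v) = v $ i" if "v \<in> S" "i < n" for i v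
    using f[OF that(1)] that A by (metis carrier_matD(1) carrier_matD(2) index_col)
  have lc: "lincomb c S $ i = (\<Sum>v\<in>S. c v * v $ i)" if "i < n" for c i
    using lincomb_index[OF that Sc] .
  have "\<forall>l. \<exists>c. l < n \<longrightarrow> col A l = lincomb c S"
  proof
    fix l
    show "\<exists>c. l < n \<longrightarrow> col A l = lincomb c S"
    proof (cases "l < n")
      case True
      then have "col A l \<in> span S" using A by (intro spanS) (auto simp: cols_def)
      then show ?thesis using finite_in_span[OF finS Sc, of "col A l"] by (metis (no_types))
    qed auto
  qed
  then obtain c where c: "\<And>l. l < n \<Longrightarrow> col A l = lincomb (c l) S" by metis
  define q where "q s l = c l (col A s)" for s l
  show thesis
  proof
    show "f ` S \<subseteq> {..<n}" using f by auto
    show "card (f ` S) = rank A" using rk card_image[OF inj] by simp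
    have "A $$ (i, l) = (\<Sum>s\<in>f ` S. A $$ (i, s) * q s l)" if "i < n" "l < n" for i l
    proof -
      have "A $$ (i, l) = col A l $ i" using that A by auto
      also have "\<dots> = (\<Sum>v\<in>S. c l v * v $ i)" using c that lc by simp
      also have "\<dots> = (\<Sum>s\<in>f ` S. A $$ (i, s) * q s l)"
        unfolding sumJ using entry f that by (intro sum.cong) (auto simp: q_def)
      finally show ?thesis .
    qed
    then show "\<forall>i<n. \<forall>l<n. A $$ (i, l) = (\<Sum>s\<in>f ` S. A $$ (i, s) * q s l)" by blast
    have "d s = 0" if d: "\<And>i. i < n \<Longrightarrow> (\<Sum>s\<in>f ` S. A $$ (i, s) * d s) = 0" and s: "s \<in> f ` S"
      for d s
    proof -
      have "lincomb (d \<circ> f) S = 0\<^sub>v n"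
      proof (rule eq_vecI)
        fix i assume "i < dim_vec (0\<^sub>v n :: 'f vec)"
        then have i: "i < n" by simp
        have "lincomb (d \<circ> f) S $ i = (\<Sum>s\<in>f ` S. A $$ (i, s) * d s)"
          unfolding lc[OF i] sumJ using entry i by (intro sum.cong) (auto simp: mult.commute)
        then show "lincomb (d \<circ> f) S $ i = 0\<^sub>v n $ i" using d i by simp
      qed (use lincomb_dim[OF finS Sc] in simp)
      moreover obtain v where "v \<in> S" "s = f v" using s by auto
      ultimately show "d s = 0"
        using not_lindepD[OF Sind finS subset_refl, of "d \<circ> f"] by auto
    qed
    then show "\<forall>d. (\<forall>i<n. (\<Sum>s\<in>f ` S. A $$ (i, s) * d s) = 0) \<longrightarrow> (\<forall>s\<in>f ` S. d s = 0)"
      by blast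
  qed
qed

text \<open>
  A matrix has rank at most \<open>r\<close> iff its kernel is cut out by \<open>r\<close> linear equations. This lemma and the
  next one are the two directions. Read in this way, an inequality between ranks amounts to counting
  equations and unknowns. A dependence among the columns of a column basis would solve too few
  equations in too many unknowns.
\<close>

lemma rank_le_card_equations:
  fixes A :: "'f::field mat"
  assumes A: "A \<in> carrier_mat n n" and "finite E"
    and ker: "\<And>v i. (\<And>e. e \<in> E \<Longrightarrow> (\<Sum>l<n. Q e l * v l) = 0) \<Longrightarrow> i < n \<Longrightarrow>
      (\<Sum>l<n. A $$ (i, l) * v l) = 0"
  shows "vec_space.rank n A \<le> card E"
proof (rule ccontr)
  assume less: "\<not> ?thesis"
  obtain J q where J: "J \<subseteq> {..<n}" "card J = vec_space.rank n A"
    "\<forall>i<n. \<forall>l<n. A $$ (i, l) = (\<Sum>s\<in>J. A $$ (i, s) * q s l)"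
    "\<forall>c. (\<forall>i<n. (\<Sum>s\<in>J. A $$ (i, s) * c s) = 0) \<longrightarrow> (\<forall>s\<in>J. c s = 0)"
    by (rule column_basis[OF A], rule that)
  have "finite J" using J finite_subset by blast
  obtain c where c: "\<exists>u\<in>J. c u \<noteq> 0" "\<forall>e\<in>E. (\<Sum>u\<in>J. Q e u * c u) = 0"
    using homogeneous_system_nontrivial_solution[OF \<open>finite E\<close> \<open>finite J\<close>, of Q] less J by auto
  define v where "v l = (if l \<in> J then c l else 0)" for l
  have v: "(\<Sum>l<n. h l * v l) = (\<Sum>l\<in>J. h l * c l)" for h
    by (rule sum.mono_neutral_cong_right) (use J in \<open>auto simp: v_def\<close>)
  have "(\<Sum>l\<in>J. A $$ (i, l) * c l) = 0" if "i < n" for i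
    using ker[of v i] c(2) that unfolding v by blast
  with J(4) c(1) show False by blast
qed

lemma rank_equations:
  fixes A :: "'f::field mat"
  assumes A: "A \<in> carrier_mat n n"
  obtains J :: "nat set" and Q where "finite J" "card J = vec_space.rank n A"
    "\<forall>v. (\<forall>e\<in>J. (\<Sum>l<n. Q e l * v l) = 0) \<longrightarrow> (\<forall>i<n. (\<Sum>l<n. A $$ (i, l) * v l) = 0)"
proof -
  obtain J Q where J: "J \<subseteq> {..<n}" "card J = vec_space.rank n A"
    "\<forall>i<n. \<forall>l<n. A $$ (i, l) = (\<Sum>s\<in>J. A $$ (i, s) * Q s l)"
    "\<forall>c. (\<forall>i<n. (\<Sum>s\<in>J. A $$ (i, s) * c s) = 0) \<longrightarrow> (\<forall>s\<in>J. c s = 0)"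
    by (rule column_basis[OF A], rule that)
  have "(\<Sum>l<n. A $$ (i, l) * v l) = 0"
    if "\<And>e. e \<in> J \<Longrightarrow> (\<Sum>l<n. Q e l * v l) = 0" "i < n" for v i
  proof -
    have "(\<Sum>l<n. A $$ (i, l) * v l) = (\<Sum>l<n. (\<Sum>s\<in>J. A $$ (i, s) * Q s l) * v l)"
      using J(3) that(2) by (intro sum.cong) auto
    also have "\<dots> = (\<Sum>l<n. \<Sum>s\<in>J. A $$ (i, s) * (Q s l * v l))"
      by (simp add: sum_distrib_right mult.assoc)
    also have "\<dots> = (\<Sum>s\<in>J. A $$ (i, s) * (\<Sum>l<n. Q s l * v l))"
      by (subst sum.swap) (simp add: sum_distrib_left)
    also have "\<dots> = 0" using that(1) by simp
    finally show ?thesis .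
  qed
  with J finite_subset[OF J(1)] show thesis by (intro that[of J Q]) auto
qed

lemma rank_minus_le:
  fixes A B :: "'f::field mat"
  assumes A: "A \<in> carrier_mat n n" and B: "B \<in> carrier_mat n n"
  shows "vec_space.rank n (A - B) \<le> vec_space.rank n A + vec_space.rank n B"
proof -
  obtain J :: "nat set" and P where J: "finite J" "card J = vec_space.rank n A"
    "\<forall>v. (\<forall>e\<in>J. (\<Sum>l<n. P e l * v l) = 0) \<longrightarrow> (\<forall>i<n. (\<Sum>l<n. A $$ (i, l) * v l) = 0)"
    by (rule rank_equations[OF A], rule that)
  obtain L :: "nat set" and Q where L: "finite L" "card L = vec_space.rank n B"
    "\<forall>v. (\<forall>e\<in>L. (\<Sum>l<n. Q e l * v l) = 0) \<longrightarrow> (\<forall>i<n. (\<Sum>l<n. B $$ (i, l) * v l) = 0)"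
    by (rule rank_equations[OF B], rule that)
  have "vec_space.rank n (A - B) \<le> card (J <+> L)"
  proof (rule rank_le_card_equations[where Q = "case_sum P Q"])
    fix v i assume e: "\<And>e. e \<in> J <+> L \<Longrightarrow> (\<Sum>l<n. case_sum P Q e l * v l) = 0" and i: "i < n"
    have "(\<Sum>l<n. A $$ (i, l) * v l) = 0" using J(3) i e[OF InlI] by simp
    moreover have "(\<Sum>l<n. B $$ (i, l) * v l) = 0" using L(3) i e[OF InrI] by simp
    moreover have "(\<Sum>l<n. (A - B) $$ (i, l) * v l)
        = (\<Sum>l<n. A $$ (i, l) * v l) - (\<Sum>l<n. B $$ (i, l) * v l)"
      unfolding sum_subtractf[symmetric] using A B i
      by (intro sum.cong) (auto simp: algebra_simps)
    ultimately show "(\<Sum>l<n. (A - B) $$ (i, l) * v l) = 0" by simp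
  qed (use A B J L in auto)
  then show ?thesis using J L by (simp add: card_Plus)
qed

lemma rank_le_size: "A \<in> carrier_mat n n \<Longrightarrow> vec_space.rank n (A :: 'f::field mat) \<le> n"
  by (rule vec_space.rank_le_nc)

lemma mat_mult_entry_sum:
  fixes A :: "'f::field mat"
  assumes "A \<in> carrier_mat n n" "B \<in> carrier_mat n n" "i < n"
  shows "(\<Sum>l<n. (A * B) $$ (i, l) * v l) = (\<Sum>s<n. A $$ (i, s) * (\<Sum>l<n. B $$ (s, l) * v l))"
proof -
  have "(\<Sum>l<n. (A * B) $$ (i, l) * v l) = (\<Sum>l<n. (\<Sum>s<n. A $$ (i, s) * B $$ (s, l)) * v l)"
    using assms by (intro sum.cong) (auto simp: scalar_prod_def atLeast0LessThan)
  also have "\<dots> = (\<Sum>s<n. A $$ (i, s) * (\<Sum>l<n. B $$ (s, l) * v l))"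
    by (simp add: sum_distrib_right sum_distrib_left mult.assoc) (rule sum.swap)
  finally show ?thesis .
qed

text \<open>
  If the relations \<open>A\<^sub>i B C\<^sub>j = \<delta>\<^sub>i\<^sub>j D\<close> hold up to errors \<open>K\<^sub>i\<^sub>j\<close>, then \<open>B\<close> contains \<open>m\<close>
  independent copies of \<open>D\<close>, up to the ranks of the errors. Indeed, consider \<open>m\<close> vectors \<open>z\<^sub>j\<close> supported
  on a column basis of \<open>D\<close>; these are \<open>m \<cdot> rank D\<close> unknowns. Impose \<open>B (\<Sum>\<^sub>j C\<^sub>j z\<^sub>j) = 0\<close>, which takes
  \<open>rank B\<close> equations, and \<open>K\<^sub>i\<^sub>j z\<^sub>j = 0\<close>, which takes \<open>rank K\<^sub>i\<^sub>j\<close> equations for each pair. If the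
  inequality failed, there would be a nonzero solution; but every solution satisfies
  \<open>D z\<^sub>i = \<Sum>\<^sub>j A\<^sub>i B C\<^sub>j z\<^sub>j = 0\<close> and hence vanishes.
\<close>

lemma rank_of_approximate_diagonal_relations:
  fixes A C :: "nat \<Rightarrow> 'f::field mat"
  assumes A: "\<And>i. A i \<in> carrier_mat n n" and B: "B \<in> carrier_mat n n"
    and C: "\<And>i. C i \<in> carrier_mat n n" and D: "D \<in> carrier_mat n n"
  defines "K \<equiv> \<lambda>i j. A i * (B * C j) - (if i = j then D else 0\<^sub>m n n)"
  shows "m * vec_space.rank n D
    \<le> vec_space.rank n B + (\<Sum>i<m. \<Sum>j<m. vec_space.rank n (K i j))"
proof (rule ccontr)
  assume less: "\<not> ?thesis"
  have K: "K i j \<in> carrier_mat n n" for i j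
    unfolding K_def using A B C D by (auto intro: minus_carrier_mat)
  obtain J q where J: "J \<subseteq> {..<n}" "card J = vec_space.rank n D"
    "\<forall>i<n. \<forall>l<n. D $$ (i, l) = (\<Sum>s\<in>J. D $$ (i, s) * q s l)"
    "\<forall>c. (\<forall>i<n. (\<Sum>s\<in>J. D $$ (i, s) * c s) = 0) \<longrightarrow> (\<forall>s\<in>J. c s = 0)"
    by (rule column_basis[OF D], rule that)
  have finJ: "finite J" using J finite_subset by blast
  obtain L :: "nat set" and P where L: "finite L" "card L = vec_space.rank n B"
    "\<forall>v. (\<forall>e\<in>L. (\<Sum>l<n. P e l * v l) = 0) \<longrightarrow> (\<forall>i<n. (\<Sum>l<n. B $$ (i, l) * v l) = 0)"
    by (rule rank_equations[OF B], rule that)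
  define eqs where "eqs i j L Q \<longleftrightarrow> finite (L :: nat set) \<and> card L = vec_space.rank n (K i j) \<and>
    (\<forall>v. (\<forall>e\<in>L. (\<Sum>l<n. Q e l * v l) = 0) \<longrightarrow> (\<forall>r<n. (\<Sum>l<n. K i j $$ (r, l) * v l) = 0))"
    for i j L Q
  have ex: "\<exists>L Q. eqs i j L Q" for i j
  proof -
    obtain L :: "nat set" and Q where "finite L" "card L = vec_space.rank n (K i j)"
      "\<forall>v. (\<forall>e\<in>L. (\<Sum>l<n. Q e l * v l) = 0) \<longrightarrow> (\<forall>r<n. (\<Sum>l<n. K i j $$ (r, l) * v l) = 0)"
      by (rule rank_equations[OF K], rule that)
    then have "eqs i j L Q" unfolding eqs_def by blast
    then show ?thesis by blast
  qed
  define R where "R i j = (SOME L. \<exists>Q. eqs i j L Q)" for i j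
  define Q where "Q i j = (SOME Q. eqs i j (R i j) Q)" for i j
  have eqs: "eqs i j (R i j) (Q i j)" for i j
    unfolding R_def Q_def by (rule someI_ex[OF someI_ex[OF ex]])
  have R: "finite (R i j)" "card (R i j) = vec_space.rank n (K i j)" for i j
    using eqs[of i j] unfolding eqs_def by blast+
  have Q: "(\<Sum>l<n. K i j $$ (r, l) * v l) = 0"
    if "\<forall>e\<in>R i j. (\<Sum>l<n. Q i j e l * v l) = 0" "r < n" for i j v r
    using eqs[of i j, unfolded eqs_def, THEN conjunct2, THEN conjunct2, THEN spec, of v] that by simp
  \<comment> \<open>X indexes the unknowns and E the equations.\<close>
  define X where "X = {..<m} \<times> J"
  define E where "E = L <+> (SIGMA i:{..<m}. SIGMA j:{..<m}. R i j)"
  define M where "M = case_sum (\<lambda>e (j, s). \<Sum>l<n. P e l * C j $$ (l, s))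
    (\<lambda>(i, j', e) (j, s). if j = j' then Q i j e s else 0)"
  have fin: "finite X" "finite E" unfolding X_def E_def using finJ L R by auto
  have "card E < card X"
  proof -
    have "card E = card L + (\<Sum>i<m. \<Sum>j<m. card (R i j))"
      unfolding E_def using L R by (subst card_Plus) (auto simp: card_SigmaI)
    then show ?thesis using less L R J by (simp add: X_def card_cartesian_product)
  qed
  then obtain c where c: "\<exists>u\<in>X. c u \<noteq> 0" "\<forall>e\<in>E. (\<Sum>u\<in>X. M e u * c u) = 0"
    using homogeneous_system_nontrivial_solution[OF fin(2,1), of M] by blast
  define z where "z j l = (if l \<in> J then c (j, l) else 0)" for j l
  have z: "(\<Sum>l<n. h l * z j l) = (\<Sum>l\<in>J. h l * c (j, l))" for h j
    by (rule sum.mono_neutral_cong_right) (use J in \<open>auto simp: z_def\<close>)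
  define w where "w l = (\<Sum>j<m. \<Sum>s<n. C j $$ (l, s) * z j s)" for l
  have "(\<Sum>l<n. P e l * w l) = 0" if "e \<in> L" for e
  proof -
    from that have "0 = (\<Sum>u\<in>X. M (Inl e) u * c u)" using c by (auto simp: E_def)
    also have "\<dots> = (\<Sum>j<m. \<Sum>s\<in>J. (\<Sum>l<n. P e l * C j $$ (l, s)) * c (j, s))"
      unfolding X_def sum.cartesian_product by (intro sum.cong) (auto simp: M_def)
    also have "\<dots> = (\<Sum>j<m. \<Sum>s<n. (\<Sum>l<n. P e l * C j $$ (l, s)) * z j s)"
      by (simp add: z)
    also have "\<dots> = (\<Sum>j<m. \<Sum>l<n. P e l * (\<Sum>s<n. C j $$ (l, s) * z j s))"
      by (simp add: sum_distrib_right sum_distrib_left mult.assoc) (intro sum.cong refl sum.swap)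
    also have "\<dots> = (\<Sum>l<n. P e l * w l)"
      unfolding w_def sum_distrib_left by (rule sum.swap)
    finally show ?thesis by simp
  qed
  then have Bw: "(\<Sum>l<n. B $$ (r, l) * w l) = 0" if "r < n" for r
    using L(3)[THEN spec, of w] that by simp
  have Kz: "(\<Sum>l<n. K i j $$ (r, l) * z j l) = 0" if "i < m" "j < m" "r < n" for i j r
  proof (rule Q[OF _ that(3)], rule ballI)
    fix e assume "e \<in> R i j"
    then have "0 = (\<Sum>u\<in>X. M (Inr (i, j, e)) u * c u)" using c that by (auto simp: E_def)
    also have "\<dots> = (\<Sum>j'<m. \<Sum>s\<in>J. if j' = j then Q i j e s * c (j, s) else 0)"
      unfolding X_def sum.cartesian_product by (intro sum.cong) (auto simp: M_def)
    also have "\<dots> = (\<Sum>j'<m. if j' = j then (\<Sum>s\<in>J. Q i j e s * c (j, s)) else 0)"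
      by (intro sum.cong) auto
    also have "\<dots> = (\<Sum>s<n. Q i j e s * z j s)"
      using that by (simp add: z)
    finally show "(\<Sum>l<n. Q i j e l * z j l) = 0" by simp
  qed
  have Dz: "(\<Sum>l<n. D $$ (r, l) * z i l) = 0" if i: "i < m" and r: "r < n" for i r
  proof -
    have e: "(\<Sum>l<n. (A i * (B * C j)) $$ (r, l) * z j l)
        = (if i = j then (\<Sum>l<n. D $$ (r, l) * z j l) else 0)" if j: "j < m" for j
    proof -
      have "(\<Sum>l<n. K i j $$ (r, l) * z j l) = (\<Sum>l<n. (A i * (B * C j)) $$ (r, l) * z j l)
          - (if i = j then (\<Sum>l<n. D $$ (r, l) * z j l) else 0)"
        using A[of i] B C[of j] D r unfolding K_def
        by (auto simp: sum_subtractf[symmetric] left_diff_distrib simp del: index_mult_mat(1)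
          intro!: sum.cong)
      then show ?thesis using Kz[OF i j r] by simp
    qed
    have "(\<Sum>l<n. D $$ (r, l) * z i l)
        = (\<Sum>j<m. if i = j then (\<Sum>l<n. D $$ (r, l) * z j l) else 0)" using i by simp
    also have "\<dots> = (\<Sum>j<m. \<Sum>l<n. (A i * (B * C j)) $$ (r, l) * z j l)"
      using e by (intro sum.cong) auto
    also have "\<dots> = (\<Sum>j<m. \<Sum>t<n. A i $$ (r, t) * (\<Sum>l<n. (B * C j) $$ (t, l) * z j l))"
      by (intro sum.cong refl mat_mult_entry_sum A mult_carrier_mat[OF B C] r)
    also have "\<dots> = (\<Sum>t<n. A i $$ (r, t) * (\<Sum>j<m. \<Sum>l<n. (B * C j) $$ (t, l) * z j l))"
      unfolding sum_distrib_left by (rule sum.swap)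
    also have "\<dots> = (\<Sum>t<n. A i $$ (r, t) * 0)"
    proof (intro sum.cong refl arg_cong2[of _ _ _ _ "(*)"])
      fix t assume "t \<in> {..<n}"
      then have t: "t < n" by simp
      have "(\<Sum>j<m. \<Sum>l<n. (B * C j) $$ (t, l) * z j l)
          = (\<Sum>j<m. \<Sum>s<n. B $$ (t, s) * (\<Sum>l<n. C j $$ (s, l) * z j l))"
        by (intro sum.cong refl mat_mult_entry_sum B C t)
      also have "\<dots> = (\<Sum>s<n. B $$ (t, s) * w s)"
        unfolding w_def sum_distrib_left by (rule sum.swap)
      finally show "(\<Sum>j<m. \<Sum>l<n. (B * C j) $$ (t, l) * z j l) = 0" using Bw t by simp
    qed
    finally show ?thesis by simp
  qed
  obtain i s where "i < m" "s \<in> J" "c (i, s) \<noteq> 0" using c(1) by (auto simp: X_def)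
  moreover have "c (i, s) = 0" if "i < m" "s \<in> J" for i s
    using J(4)[THEN spec, of "\<lambda>s. c (i, s)"] Dz[OF that(1)] that(2) unfolding z by simp
  ultimately show False by blast
qed

section \<open>An obstruction to linear soficity\<close>

text \<open>
  The limit is the infimum of the bounds that hold along \<open>U\<close>. Convergence makes the asymptotic rank, a
  value of \<^const>\<open>Lim\<close>, an actual limit.
\<close>

lemma ultrafilter_bounded_converges:
  fixes f :: "'a \<Rightarrow> real"
  assumes U: "ultrafilter U" and f: "\<And>k. 0 \<le> f k" "\<And>k. f k \<le> 1"
  shows "\<exists>l. (f \<longlongrightarrow> l) U"
proof -
  define S where "S = {c. eventually (\<lambda>k. f k \<le> c) U}"
  have 1: "1 \<in> S" using f by (simp add: S_def)
  have nb: "U \<noteq> bot" using U by (simp add: ultrafilter_def)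
  have 0: "0 \<le> c" if c: "c \<in> S" for c
  proof -
    have "\<exists>k. f k \<le> c" using eventually_happens[of _ U] c nb unfolding S_def by auto
    then show ?thesis using f order_trans by blast
  qed
  have bdd: "bdd_below S" using 0 by (auto simp: bdd_below_def)
  have "(f \<longlongrightarrow> Inf S) U"
  proof (rule order_tendstoI)
    fix a assume "a < Inf S"
    then have "a \<notin> S" using cInf_lower[OF _ bdd, of a] by auto
    then have "eventually (\<lambda>k. \<not> f k \<le> a) U" using U by (auto simp: S_def ultrafilter_def)
    then show "eventually (\<lambda>k. a < f k) U" by (simp add: not_le)
  next
    fix a assume "Inf S < a"
    then obtain c where c: "c \<in> S" "c < a" using 1 cInf_lessD[of S a] by auto
    then have "eventually (\<lambda>k. f k \<le> c) U" by (simp add: S_def)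
    then show "eventually (\<lambda>k. f k < a) U" by (rule eventually_mono) (use c in auto)
  qed
  then show ?thesis by blast
qed

context
  fixes U :: "nat filter" and n :: "nat \<Rightarrow> nat"
  assumes U: "ultrafilter U" and n: "\<forall>k. n k > 0"
begin

abbreviation relrank :: "(nat \<Rightarrow> 'f::field mat) \<Rightarrow> nat \<Rightarrow> real"
  where "relrank A k \<equiv> real (vec_space.rank (n k) (A k)) / real (n k)"

lemma relrank_le_1:
  assumes "A \<in> carrier (matrix_product n)"
  shows "relrank A k \<le> 1"
  using rank_le_size[of "A k" "n k"] assms n[THEN spec, of k] by (simp add: matrix_product_def)

lemma relrank_tendsto_asymptotic_rank:
  fixes A :: "nat \<Rightarrow> 'f::field mat"
  assumes "A \<in> carrier (matrix_product n)"
  shows "(relrank A \<longlongrightarrow> asymptotic_rank U n A) U"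
proof -
  obtain l where l: "(relrank A \<longlongrightarrow> l) U"
    using ultrafilter_bounded_converges[OF U, of "relrank A"] relrank_le_1[OF assms] by auto
  moreover have "asymptotic_rank U n A = l"
    unfolding asymptotic_rank_def using U l by (intro tendsto_Lim) (auto simp: ultrafilter_def)
  ultimately show ?thesis by simp
qed

lemma in_kernel_iff:
  fixes A :: "nat \<Rightarrow> 'f::field mat"
  shows "A \<in> asymptotic_rank_kernel U n \<longleftrightarrow>
    A \<in> carrier (matrix_product n) \<and> (relrank A \<longlongrightarrow> 0) U"
proof -
  have "U \<noteq> bot" using U by (simp add: ultrafilter_def)
  then show ?thesis
    using relrank_tendsto_asymptotic_rank[of A] tendsto_unique[of U "relrank A"]
    unfolding asymptotic_rank_kernel_def by fastforce
qed

lemma kernel_diff: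
  fixes A B :: "nat \<Rightarrow> 'f::field mat"
  assumes "A \<in> asymptotic_rank_kernel U n" "B \<in> asymptotic_rank_kernel U n"
  shows "(\<lambda>k. A k - B k) \<in> asymptotic_rank_kernel U n"
proof -
  have A: "A k \<in> carrier_mat (n k) (n k)" "B k \<in> carrier_mat (n k) (n k)" for k
    using assms by (auto simp: in_kernel_iff matrix_product_def)
  have "((\<lambda>k. relrank A k + relrank B k) \<longlongrightarrow> 0) U"
    using tendsto_add[of "relrank A" 0 U "relrank B" 0] assms by (simp add: in_kernel_iff)
  then have "(relrank (\<lambda>k. A k - B k) \<longlongrightarrow> 0) U"
  proof (rule tendsto_sandwich[rotated 3, of _ _ _ "\<lambda>_. 0"])
    show "\<forall>\<^sub>F k in U. relrank (\<lambda>k. A k - B k) k \<le> relrank A k + relrank B k"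
    proof (rule always_eventually, rule allI)
      fix k
      have "real (vec_space.rank (n k) (A k - B k))
          \<le> real (vec_space.rank (n k) (A k)) + real (vec_space.rank (n k) (B k))"
        using rank_minus_le[OF A, of k] by linarith
      then show "relrank (\<lambda>k. A k - B k) k \<le> relrank A k + relrank B k"
        by (simp add: divide_right_mono flip: add_divide_distrib)
    qed
  qed auto
  moreover have "(\<lambda>k. A k - B k) \<in> carrier (matrix_product n)"
    using A by (simp add: matrix_product_def minus_carrier_mat)
  ultimately show ?thesis by (simp add: in_kernel_iff)
qed

lemma zero_in_kernel: "(\<lambda>k. 0\<^sub>m (n k) (n k) :: 'f::field mat) \<in> asymptotic_rank_kernel U n"
  by (simp add: in_kernel_iff matrix_product_def vec_space.rank_0I)

text \<open>
  The metric ultraproduct is treated through representatives: two representatives of one element differ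
  by a sequence of asymptotic rank zero.
\<close>

lemma ultraproduct_coset_diff:
  fixes A B :: "nat \<Rightarrow> 'f::field mat"
  assumes X: "X \<in> carrier (metric_ultraproduct U n)" and A: "A \<in> X" and B: "B \<in> X"
  shows "(\<lambda>k. A k - B k) \<in> asymptotic_rank_kernel U n"
proof -
  obtain E :: "nat \<Rightarrow> 'f mat" where E: "E \<in> carrier (matrix_product n)"
    "X = asymptotic_rank_kernel U n +>\<^bsub>matrix_product n\<^esub> E"
    using X unfolding metric_ultraproduct_def quotient_algebra_simps A_RCOSETS_def' by auto
  obtain h where h: "h \<in> asymptotic_rank_kernel U n" "A = (\<lambda>k. h k + E k)"
    using A unfolding E a_r_coset_def' by (auto simp: matrix_product_def)
  obtain h' where h': "h' \<in> asymptotic_rank_kernel U n" "B = (\<lambda>k. h' k + E k)"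
    using B unfolding E a_r_coset_def' by (auto simp: matrix_product_def)
  have "(h k + E k) - (h' k + E k) = h k - h' k" for k
  proof -
    have "h k \<in> carrier_mat (n k) (n k)" "h' k \<in> carrier_mat (n k) (n k)"
      "E k \<in> carrier_mat (n k) (n k)"
      using h(1) h'(1) E(1) by (auto simp: in_kernel_iff matrix_product_def)
    then show ?thesis by (intro eq_matI) auto
  qed
  then show ?thesis using kernel_diff[OF h(1) h'(1)] h h' by simp
qed

lemma ultraproduct_coset_meets_kernel:
  fixes A :: "nat \<Rightarrow> 'f::field mat"
  assumes X: "X \<in> carrier (metric_ultraproduct U n)" and A: "A \<in> X"
    and A0: "A \<in> asymptotic_rank_kernel U n"
  shows "X = asymptotic_rank_kernel U n"
proof
  let ?I = "asymptotic_rank_kernel U n :: (nat \<Rightarrow> 'f mat) set"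
  have c: "B k \<in> carrier_mat (n k) (n k)" if "B \<in> ?I" for B :: "nat \<Rightarrow> 'f mat" and k
    using that by (auto simp: in_kernel_iff matrix_product_def)
  obtain E :: "nat \<Rightarrow> 'f mat" where E: "E \<in> carrier (matrix_product n)"
    "X = ?I +>\<^bsub>matrix_product n\<^esub> E"
    using X unfolding metric_ultraproduct_def quotient_algebra_simps A_RCOSETS_def' by auto
  obtain h where h: "h \<in> ?I" "A = (\<lambda>k. h k + E k)"
    using A unfolding E a_r_coset_def' by (auto simp: matrix_product_def)
  have Ec: "E k \<in> carrier_mat (n k) (n k)" for k using E by (simp add: matrix_product_def)
  have "A k - h k = E k" for k
    using c[OF h(1), of k] Ec[of k] unfolding h(2) by (intro eq_matI) auto
  then have EI: "E \<in> ?I" using kernel_diff[OF A0 h(1)] by simp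
  have neg: "(\<lambda>k. 0\<^sub>m (n k) (n k) - E k) \<in> ?I" using kernel_diff[OF zero_in_kernel EI] .
  show "X \<subseteq> ?I"
  proof
    fix B assume "B \<in> X"
    then obtain h' where h': "h' \<in> ?I" "B = (\<lambda>k. h' k + E k)"
      unfolding E a_r_coset_def' by (auto simp: matrix_product_def)
    have "h' k + E k = h' k - (0\<^sub>m (n k) (n k) - E k)" for k
      using c[OF h'(1), of k] Ec[of k] by (intro eq_matI) auto
    then have "B = (\<lambda>k. h' k - (0\<^sub>m (n k) (n k) - E k))" unfolding h'(2) by blast
    then show "B \<in> ?I" using kernel_diff[OF h'(1) neg] by simp
  qed
  show "?I \<subseteq> X"
  proof
    fix B assume B: "B \<in> ?I"
    have "B k = (B k - E k) + E k" for k
      using c[OF B, of k] Ec[of k] by (intro eq_matI) auto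
    then have "B = (\<lambda>k. (B k - E k) + E k)" by blast
    then show "B \<in> X" using kernel_diff[OF B EI]
      unfolding E a_r_coset_def' by (auto simp: matrix_product_def)
  qed
qed

end

text \<open>
  An element \<open>a\<close> of which infinitely many independent copies are obtained from a single element \<open>b\<close> is
  killed by every homomorphism to a metric ultraproduct: representatives satisfy the relations up to
  asymptotic rank zero, so for every \<open>m\<close> the asymptotic rank of the image of \<open>a\<close> is at most \<open>1 / m\<close>.
\<close>

theorem not_linear_sofic_if_diagonal_relations:
  fixes T :: "('f::field, 'a, 'm) module_scheme"
  assumes T: "nonunital_algebra class_ring T"
    and x: "\<And>i::nat. x i \<in> carrier T" and y: "\<And>i::nat. y i \<in> carrier T" and b: "b \<in> carrier T"
    and xby: "\<And>i j. x i \<otimes>\<^bsub>T\<^esub> (b \<otimes>\<^bsub>T\<^esub> y j) = (if i = j then a else \<zero>\<^bsub>T\<^esub>)"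
    and a: "a \<noteq> \<zero>\<^bsub>T\<^esub>"
  shows "\<not> linear_sofic T"
proof
  assume "linear_sofic T"
  then obtain U n \<Phi> where U: "ultrafilter U" and n: "\<forall>k. n k > (0::nat)"
    and \<Phi>: "\<Phi> \<in> algebra_hom class_ring T (metric_ultraproduct U n)" and inj: "inj_on \<Phi> (carrier T)"
    unfolding linear_sofic_def by auto
  interpret T: nonunital_algebra class_ring T by (rule T)
  let ?I = "asymptotic_rank_kernel U n :: (nat \<Rightarrow> 'f mat) set"
  let ?P = "matrix_product n :: ('f, nat \<Rightarrow> 'f mat) module"
  note ker = in_kernel_iff[OF U n]
  have aT: "a \<in> carrier T" using xby[of 0 0] T.mult_closed[OF x T.mult_closed[OF b y], of 0 0] by simp
  have car: "\<Phi> t \<in> carrier (metric_ultraproduct U n)" if "t \<in> carrier T" for t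
    using \<Phi> that by (auto simp: algebra_hom_def LinearCombinations.module_hom_def)
  have coset: "\<exists>E\<in>carrier ?P. \<Phi> t = ?I +>\<^bsub>?P\<^esub> E" if "t \<in> carrier T" for t
    using car[OF that] unfolding metric_ultraproduct_def quotient_algebra_simps A_RCOSETS_def'
    by auto
  have mat: "A k \<in> carrier_mat (n k) (n k)" if "t \<in> carrier T" "A \<in> \<Phi> t" for t A k
    using coset[OF that(1)] that(2) unfolding a_r_coset_def'
    by (auto simp: matrix_product_def ker)
  have ne: "\<exists>A. A \<in> \<Phi> t" if "t \<in> carrier T" for t
    using coset[OF that] zero_in_kernel[OF U n] unfolding a_r_coset_def' by auto
  have add: "(\<lambda>k. A k + B k) \<in> \<Phi> (s \<oplus>\<^bsub>T\<^esub> t)"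
    if "s \<in> carrier T" "t \<in> carrier T" "A \<in> \<Phi> s" "B \<in> \<Phi> t" for s t A B
  proof -
    have "\<Phi> (s \<oplus>\<^bsub>T\<^esub> t) = \<Phi> s <+>\<^bsub>?P\<^esub> \<Phi> t"
      using \<Phi> that(1,2) by (simp add: algebra_hom_def LinearCombinations.module_hom_def
        metric_ultraproduct_def quotient_algebra_simps)
    then show ?thesis using that(3,4) unfolding set_add_def' by (auto simp: matrix_product_def)
  qed
  have mult: "(\<lambda>k. A k * B k) \<in> \<Phi> (s \<otimes>\<^bsub>T\<^esub> t)"
    if "s \<in> carrier T" "t \<in> carrier T" "A \<in> \<Phi> s" "B \<in> \<Phi> t" for s t A B
  proof -
    have "\<Phi> (s \<otimes>\<^bsub>T\<^esub> t) = rcoset_mult ?P ?I (\<Phi> s) (\<Phi> t)"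
      using \<Phi> that(1,2) by (simp add: algebra_hom_def LinearCombinations.module_hom_def
        metric_ultraproduct_def quotient_algebra_simps)
    moreover have "(\<lambda>k. A k * B k) \<in> ?I +>\<^bsub>?P\<^esub> (A \<otimes>\<^bsub>?P\<^esub> B)"
    proof -
      have "A k * B k = 0\<^sub>m (n k) (n k) + A k * B k" for k
        by (rule left_add_zero_mat[symmetric],
          rule mult_carrier_mat[OF mat[OF that(1,3)] mat[OF that(2,4)]])
      then have "(\<lambda>k. A k * B k) = (\<lambda>k. 0\<^sub>m (n k) (n k)) \<oplus>\<^bsub>?P\<^esub> (A \<otimes>\<^bsub>?P\<^esub> B)"
        by (simp add: matrix_product_def)
      then show ?thesis using zero_in_kernel[OF U n] unfolding a_r_coset_def' by blast
    qed
    ultimately show ?thesis using that(3,4) unfolding rcoset_mult_def by blast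
  qed
  \<comment> \<open>Additivity suffices: from A and A + A in the image of 0 one gets A in the kernel.\<close>
  have zero: "\<Phi> \<zero>\<^bsub>T\<^esub> = ?I"
  proof -
    obtain A where A: "A \<in> \<Phi> \<zero>\<^bsub>T\<^esub>" using ne by blast
    then have AA: "(\<lambda>k. A k + A k) \<in> \<Phi> \<zero>\<^bsub>T\<^esub>" using add[of "\<zero>\<^bsub>T\<^esub>" "\<zero>\<^bsub>T\<^esub>" A A] by simp
    have "(\<lambda>k. (A k + A k) - A k) \<in> ?I"
      by (rule ultraproduct_coset_diff[OF U n car[OF T.M.zero_closed] AA A])
    moreover have "(A k + A k) - A k = A k" for k
      using mat[OF _ A, of k] by (intro eq_matI) auto
    ultimately show ?thesis using ultraproduct_coset_meets_kernel[OF U n car A] by simp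
  qed
  obtain X where X: "\<And>i. X i \<in> \<Phi> (x i)" using ne[OF x] by metis
  obtain Y where Y: "\<And>i. Y i \<in> \<Phi> (y i)" using ne[OF y] by metis
  obtain B where B: "B \<in> \<Phi> b" using ne[OF b] by metis
  obtain D where D: "D \<in> \<Phi> a" using ne[OF aT] by metis
  define K where "K i j k = X i k * (B k * Y j k) - (if i = j then D k else 0\<^sub>m (n k) (n k))"
    for i j k
  have "K i j \<in> ?I" for i j
  proof -
    have XBY: "(\<lambda>k. X i k * (B k * Y j k)) \<in> \<Phi> (if i = j then a else \<zero>\<^bsub>T\<^esub>)"
      using mult[OF x T.mult_closed[OF b y] X mult[OF b y B Y], of i j] by (simp only: xby)
    show ?thesis
    proof (cases "i = j")
      case True
      then show ?thesis
        using ultraproduct_coset_diff[OF U n car[OF aT] _ D, of "\<lambda>k. X i k * (B k * Y j k)"] XBY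
        by (simp add: K_def[abs_def])
    next
      case False
      then show ?thesis
        using ultraproduct_coset_diff[OF U n car[of "\<zero>\<^bsub>T\<^esub>"], of "\<lambda>k. X i k * (B k * Y j k)"
          "\<lambda>k. 0\<^sub>m (n k) (n k)"] XBY zero zero_in_kernel[OF U n]
        by (simp add: K_def[abs_def])
    qed
  qed
  then have K: "((\<lambda>k. real (vec_space.rank (n k) (K i j k)) / real (n k)) \<longlongrightarrow> 0) U" for i j
    by (simp add: ker)
  have DP: "D \<in> carrier (matrix_product n)" using mat[OF aT D] by (simp add: matrix_product_def)
  define \<rho> where "\<rho> = asymptotic_rank U n D"
  have \<rho>: "((\<lambda>k. real (vec_space.rank (n k) (D k)) / real (n k)) \<longlongrightarrow> \<rho>) U"
    using relrank_tendsto_asymptotic_rank[OF U n DP] by (simp add: \<rho>_def)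
  have le: "real m * \<rho> \<le> 1" for m
  proof -
    have "((\<lambda>k. 1 + (\<Sum>i<m. \<Sum>j<m. real (vec_space.rank (n k) (K i j k)) / real (n k)))
        \<longlongrightarrow> 1 + (\<Sum>i<m. \<Sum>j<m. 0)) U"
      by (intro tendsto_intros K)
    moreover have "((\<lambda>k. real m * (real (vec_space.rank (n k) (D k)) / real (n k)))
        \<longlongrightarrow> real m * \<rho>) U"
      by (intro tendsto_intros \<rho>)
    moreover have "real m * (real (vec_space.rank (n k) (D k)) / real (n k))
        \<le> 1 + (\<Sum>i<m. \<Sum>j<m. real (vec_space.rank (n k) (K i j k)) / real (n k))" for k
    proof -
      have "m * vec_space.rank (n k) (D k) \<le> vec_space.rank (n k) (B k)
          + (\<Sum>i<m. \<Sum>j<m. vec_space.rank (n k) (K i j k))"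
        unfolding K_def
        by (rule rank_of_approximate_diagonal_relations)
          (use mat[OF x X] mat[OF b B] mat[OF y Y] mat[OF aT D] in auto)
      also have "\<dots> \<le> n k + (\<Sum>i<m. \<Sum>j<m. vec_space.rank (n k) (K i j k))"
        using rank_le_size[OF mat[OF b B]] by simp
      finally have "real (m * vec_space.rank (n k) (D k))
          \<le> real (n k + (\<Sum>i<m. \<Sum>j<m. vec_space.rank (n k) (K i j k)))"
        by (rule of_nat_mono)
      then have "real (m * vec_space.rank (n k) (D k)) / real (n k)
          \<le> real (n k + (\<Sum>i<m. \<Sum>j<m. vec_space.rank (n k) (K i j k))) / real (n k)"
        by (rule divide_right_mono) simp
      then show ?thesis using n[THEN spec, of k] by (simp add: add_divide_distrib sum_divide_distrib)
    qed
    ultimately have "real m * \<rho> \<le> 1 + (\<Sum>i<m. \<Sum>j<m. 0)"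
      using U by (intro tendsto_le[of U]) (auto simp: ultrafilter_def)
    then show ?thesis by simp
  qed
  have "\<rho> \<le> 0"
  proof (rule ccontr)
    assume "\<not> \<rho> \<le> 0"
    then have "\<rho> > 0" by simp
    then obtain m :: nat where "1 < real m * \<rho>" using reals_Archimedean3 by blast
    with le[of m] show False by simp
  qed
  moreover have "\<rho> \<ge> 0"
    by (rule tendsto_lowerbound[OF \<rho>]) (use U in \<open>auto simp: ultrafilter_def\<close>)
  ultimately have "D \<in> ?I" using \<rho> DP by (simp add: ker)
  then have "\<Phi> a = ?I" using ultraproduct_coset_meets_kernel[OF U n car[OF aT] D] by simp
  with zero inj aT have "a = \<zero>\<^bsub>T\<^esub>" by (auto simp: inj_on_def)
  with a show False by contradiction
qed

section \<open>Stable finiteness of unital hulls of radical algebras\<close>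

context ring
begin

lemma finsum_swap:
  assumes "finite A" "finite B" "\<And>i j. i \<in> A \<Longrightarrow> j \<in> B \<Longrightarrow> f i j \<in> carrier R"
  shows "(\<Oplus>i\<in>A. \<Oplus>j\<in>B. f i j) = (\<Oplus>j\<in>B. \<Oplus>i\<in>A. f i j)"
  using assms(1,3)
proof (induction A rule: finite_induct)
  case empty
  then show ?case by simp
next
  case (insert a A)
  have f: "f i \<in> B \<rightarrow> carrier R" if "i \<in> insert a A" for i using insert.prems that by auto
  have "(\<Oplus>i\<in>insert a A. \<Oplus>j\<in>B. f i j) = (\<Oplus>j\<in>B. f a j) \<oplus> (\<Oplus>j\<in>B. \<Oplus>i\<in>A. f i j)"
    using insert f by (subst finsum_insert) (auto intro!: finsum_closed)
  also have "\<dots> = (\<Oplus>j\<in>B. f a j \<oplus> (\<Oplus>i\<in>A. f i j))"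
    using insert.prems by (intro finsum_addf[symmetric]) (auto intro!: finsum_closed)
  also have "\<dots> = (\<Oplus>j\<in>B. \<Oplus>i\<in>insert a A. f i j)"
    using insert by (intro finsum_cong') (auto intro!: finsum_closed)
  finally show ?case .
qed

text \<open>
  Associativity of the product of a row, a matrix and a column.
\<close>

lemma finsum_mult_assoc:
  assumes "finite A" "finite B" "\<And>k. k \<in> A \<Longrightarrow> x k \<in> carrier R"
    "\<And>k j. k \<in> A \<Longrightarrow> j \<in> B \<Longrightarrow> y k j \<in> carrier R" "\<And>j. j \<in> B \<Longrightarrow> z j \<in> carrier R"
  shows "(\<Oplus>j\<in>B. (\<Oplus>k\<in>A. x k \<otimes> y k j) \<otimes> z j) = (\<Oplus>k\<in>A. x k \<otimes> (\<Oplus>j\<in>B. y k j \<otimes> z j))"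
proof -
  have "(\<Oplus>j\<in>B. (\<Oplus>k\<in>A. x k \<otimes> y k j) \<otimes> z j) = (\<Oplus>j\<in>B. \<Oplus>k\<in>A. x k \<otimes> y k j \<otimes> z j)"
    using assms by (intro finsum_cong' finsum_ldistr) auto
  also have "\<dots> = (\<Oplus>k\<in>A. \<Oplus>j\<in>B. x k \<otimes> y k j \<otimes> z j)"
    using assms by (intro finsum_swap) auto
  also have "\<dots> = (\<Oplus>k\<in>A. x k \<otimes> (\<Oplus>j\<in>B. y k j \<otimes> z j))"
  proof (rule finsum_cong')
    fix k assume k: "k \<in> A"
    have "(\<Oplus>j\<in>B. x k \<otimes> y k j \<otimes> z j) = (\<Oplus>j\<in>B. x k \<otimes> (y k j \<otimes> z j))"
      using assms k by (intro finsum_cong') (auto simp: m_assoc)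
    also have "\<dots> = x k \<otimes> (\<Oplus>j\<in>B. y k j \<otimes> z j)"
      using assms k by (intro finsum_rdistr[symmetric]) auto
    finally show "(\<Oplus>j\<in>B. x k \<otimes> y k j \<otimes> z j) = x k \<otimes> (\<Oplus>j\<in>B. y k j \<otimes> z j)" .
  qed (use assms in \<open>auto intro!: finsum_closed\<close>)
  finally show ?thesis .
qed

text \<open>
  A form of Nakayama's lemma: a finite system \<open>x = N x\<close> with coefficients in an ideal \<open>K\<close> of
  quasi-invertible elements has only the trivial solution. Since \<open>1 - N s s\<close> has a left inverse, the
  equation with index \<open>s\<close> expresses \<open>x s\<close> through the other unknowns. Substituting it gives a smaller
  system whose coefficients again lie in \<open>K\<close>.
\<close>

lemma linear_system_over_radical_trivial:
  assumes K: "K \<subseteq> carrier R" "\<And>s t. s \<in> K \<Longrightarrow> t \<in> K \<Longrightarrow> s \<oplus> t \<in> K"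
      "\<And>r t. r \<in> carrier R \<Longrightarrow> t \<in> K \<Longrightarrow> r \<otimes> t \<in> K"
      "\<And>r t. r \<in> carrier R \<Longrightarrow> t \<in> K \<Longrightarrow> t \<otimes> r \<in> K"
    and inv: "\<And>t. t \<in> K \<Longrightarrow> \<exists>u\<in>carrier R. u \<otimes> (\<one> \<ominus> t) = \<one>"
    and "finite S" and x: "\<And>i. i \<in> S \<Longrightarrow> x i \<in> carrier R"
    and N: "\<And>i j. i \<in> S \<Longrightarrow> j \<in> S \<Longrightarrow> N i j \<in> K"
    and eq: "\<And>i. i \<in> S \<Longrightarrow> x i = (\<Oplus>j\<in>S. N i j \<otimes> x j)"
  shows "i \<in> S \<Longrightarrow> x i = \<zero>"
  using \<open>finite S\<close> x N eq
proof (induction S arbitrary: N i rule: finite_induct)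
  case empty
  then show ?case by blast
next
  case (insert s S)
  have xc: "x j \<in> carrier R" if "j \<in> insert s S" for j using insert.prems(2) that .
  have NK: "N i j \<in> K" if "i \<in> insert s S" "j \<in> insert s S" for i j using insert.prems(3) that .
  have Nc: "N i j \<in> carrier R" if "i \<in> insert s S" "j \<in> insert s S" for i j
    using NK[OF that] K(1) by blast
  obtain u where u: "u \<in> carrier R" "u \<otimes> (\<one> \<ominus> N s s) = \<one>" using inv[OF NK[OF insertI1 insertI1]] by blast
  have split: "x i = N i s \<otimes> x s \<oplus> (\<Oplus>j\<in>S. N i j \<otimes> x j)" if "i \<in> insert s S" for i
    by (subst insert.prems(4)[OF that], rule finsum_insert)
      (use insert.hyps Nc xc that in auto)
  let ?r = "\<lambda>i. \<Oplus>j\<in>S. N i j \<otimes> x j"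
  have r: "?r i \<in> carrier R" if "i \<in> insert s S" for i
    using Nc xc that by (auto intro!: finsum_closed)
  have "(\<one> \<ominus> N s s) \<otimes> x s = x s \<ominus> N s s \<otimes> x s"
    using Nc[of s s] xc[of s] by (simp add: a_minus_def l_distr l_minus)
  also have "\<dots> = ?r s"
  proof -
    have c: "N s s \<otimes> x s \<in> carrier R" using Nc[of s s] xc[of s] by simp
    have "x s \<ominus> N s s \<otimes> x s = (N s s \<otimes> x s \<oplus> ?r s) \<ominus> N s s \<otimes> x s"
      using split[of s] by simp
    also have "\<dots> = ?r s"
      using c r[of s] by (simp add: a_minus_def a_comm[of "N s s \<otimes> x s"] a_assoc r_neg)
    finally show ?thesis .
  qed
  finally have "u \<otimes> ((\<one> \<ominus> N s s) \<otimes> x s) = u \<otimes> ?r s" by simp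
  then have "x s = u \<otimes> ?r s"
    using u xc[of s] Nc[of s s] by (simp add: m_assoc[symmetric])
  also have "\<dots> = (\<Oplus>j\<in>S. u \<otimes> (N s j \<otimes> x j))"
    using insert.hyps u Nc xc by (intro finsum_rdistr) auto
  also have "\<dots> = (\<Oplus>j\<in>S. (u \<otimes> N s j) \<otimes> x j)"
    using u Nc xc by (intro finsum_cong') (auto simp: m_assoc)
  finally have xs: "x s = (\<Oplus>j\<in>S. (u \<otimes> N s j) \<otimes> x j)" .
  define N' where "N' i j = N i s \<otimes> (u \<otimes> N s j) \<oplus> N i j" for i j
  have N': "N' i j \<in> K" if "i \<in> S" "j \<in> S" for i j
    unfolding N'_def using that u by (intro K(2) K(3) NK Nc) auto
  have eq': "x i = (\<Oplus>j\<in>S. N' i j \<otimes> x j)" if i: "i \<in> S" for i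
  proof -
    have "N i s \<otimes> x s = (\<Oplus>j\<in>S. N i s \<otimes> ((u \<otimes> N s j) \<otimes> x j))"
      unfolding xs using insert.hyps u Nc xc i by (intro finsum_rdistr) auto
    then have "x i = (\<Oplus>j\<in>S. N i s \<otimes> ((u \<otimes> N s j) \<otimes> x j)) \<oplus> ?r i" using split[of i] i by simp
    also have "\<dots> = (\<Oplus>j\<in>S. N i s \<otimes> ((u \<otimes> N s j) \<otimes> x j) \<oplus> N i j \<otimes> x j)"
      using u Nc xc i by (intro finsum_addf[symmetric]) auto
    also have "\<dots> = (\<Oplus>j\<in>S. N' i j \<otimes> x j)"
      using u Nc xc i by (intro finsum_cong') (auto simp: N'_def l_distr m_assoc)
    finally show ?thesis .
  qed
  have S0: "x j = \<zero>" if "j \<in> S" for j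
    using insert.IH[OF that, of N'] xc N' eq' by blast
  have "x s = \<zero>" unfolding xs using S0 u Nc by (intro add.finprod_one_eqI) auto
  with S0 insert.prems(1) show ?case by auto
qed

text \<open>
  If \<open>x y = 1\<close>, then \<open>e = 1 - y x\<close> is an idempotent matrix. Its entries lie in \<open>K\<close> by assumption, and
  each of its columns \<open>v\<close> satisfies \<open>v = e v\<close>, so the preceding lemma gives \<open>e = 0\<close>.
\<close>

lemma one_sided_inverse_modulo_radical:
  assumes K: "K \<subseteq> carrier R" "\<And>s t. s \<in> K \<Longrightarrow> t \<in> K \<Longrightarrow> s \<oplus> t \<in> K"
      "\<And>r t. r \<in> carrier R \<Longrightarrow> t \<in> K \<Longrightarrow> r \<otimes> t \<in> K"
      "\<And>r t. r \<in> carrier R \<Longrightarrow> t \<in> K \<Longrightarrow> t \<otimes> r \<in> K"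
    and inv: "\<And>t. t \<in> K \<Longrightarrow> \<exists>u\<in>carrier R. u \<otimes> (\<one> \<ominus> t) = \<one>"
    and S: "finite S"
    and x: "\<And>i j. i \<in> S \<Longrightarrow> j \<in> S \<Longrightarrow> x i j \<in> carrier R"
    and y: "\<And>i j. i \<in> S \<Longrightarrow> j \<in> S \<Longrightarrow> y i j \<in> carrier R"
    and xy: "\<And>i j. i \<in> S \<Longrightarrow> j \<in> S \<Longrightarrow>
      (\<Oplus>k\<in>S. x i k \<otimes> y k j) = (if i = j then \<one> else \<zero>)"
    and yx: "\<And>i j. i \<in> S \<Longrightarrow> j \<in> S \<Longrightarrow>
      (if i = j then \<one> else \<zero>) \<ominus> (\<Oplus>k\<in>S. y i k \<otimes> x k j) \<in> K"
    and ij: "i \<in> S" "j \<in> S"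
  shows "(\<Oplus>k\<in>S. y i k \<otimes> x k j) = (if i = j then \<one> else \<zero>)"
proof -
  define \<delta> where "\<delta> i j = (if i = j then \<one> else \<zero>)" for i j :: 'c
  define f where "f i j = (\<Oplus>k\<in>S. y i k \<otimes> x k j)" for i j
  define e where "e i j = \<delta> i j \<ominus> f i j" for i j
  have \<delta>c [simp]: "\<delta> i j \<in> carrier R" for i j by (simp add: \<delta>_def)
  have fc [simp]: "f i j \<in> carrier R" if "i \<in> S" "j \<in> S" for i j
    unfolding f_def using x y that by (auto intro!: finsum_closed)
  have ec [simp]: "e i j \<in> carrier R" if "i \<in> S" "j \<in> S" for i j
    unfolding e_def using that by simp
  have ef: "e i j \<oplus> f i j = \<delta> i j" if "i \<in> S" "j \<in> S" for i j
    unfolding e_def using that by (simp add: a_minus_def a_assoc l_neg)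
  have \<delta>l: "(\<Oplus>l\<in>S. \<delta> i l \<otimes> h l) = h i" if "i \<in> S" "\<And>l. l \<in> S \<Longrightarrow> h l \<in> carrier R" for i h
  proof -
    have "(\<Oplus>l\<in>S. \<delta> i l \<otimes> h l) = (\<Oplus>l\<in>S. if i = l then h l else \<zero>)"
      using that by (intro finsum_cong') (auto simp: \<delta>_def)
    also have "\<dots> = h i" using that S by (intro add.finprod_singleton) auto
    finally show ?thesis .
  qed
  have \<delta>r: "(\<Oplus>l\<in>S. h l \<otimes> \<delta> l i) = h i" if "i \<in> S" "\<And>l. l \<in> S \<Longrightarrow> h l \<in> carrier R" for i h
  proof -
    have "(\<Oplus>l\<in>S. h l \<otimes> \<delta> l i) = (\<Oplus>l\<in>S. if i = l then h l else \<zero>)"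
      using that by (intro finsum_cong') (auto simp: \<delta>_def)
    also have "\<dots> = h i" using that S by (intro add.finprod_singleton) auto
    finally show ?thesis .
  qed
  have ey: "(\<Oplus>l\<in>S. e i l \<otimes> y l k) = \<zero>" if "i \<in> S" "k \<in> S" for i k
  proof -
    have c: "(\<Oplus>l\<in>S. e i l \<otimes> y l k) \<in> carrier R" using y that by (auto intro!: finsum_closed)
    have "(\<Oplus>l\<in>S. f i l \<otimes> y l k) = (\<Oplus>m\<in>S. y i m \<otimes> (\<Oplus>l\<in>S. x m l \<otimes> y l k))"
      unfolding f_def using x y that S by (intro finsum_mult_assoc) auto
    also have "\<dots> = (\<Oplus>m\<in>S. y i m \<otimes> \<delta> m k)"
      using xy y that by (intro finsum_cong') (auto simp: \<delta>_def)
    also have "\<dots> = y i k" using y that by (intro \<delta>r) auto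
    finally have f: "(\<Oplus>l\<in>S. f i l \<otimes> y l k) = y i k" .
    have "(\<Oplus>l\<in>S. e i l \<otimes> y l k) \<oplus> (\<Oplus>l\<in>S. f i l \<otimes> y l k)
        = (\<Oplus>l\<in>S. e i l \<otimes> y l k \<oplus> f i l \<otimes> y l k)"
      using y that by (intro finsum_addf[symmetric]) auto
    also have "\<dots> = (\<Oplus>l\<in>S. \<delta> i l \<otimes> y l k)"
      using y that ef by (intro finsum_cong') (auto simp: l_distr[symmetric])
    also have "\<dots> = y i k" using y that by (intro \<delta>l) auto
    finally show ?thesis using c y that unfolding f by simp
  qed
  have eff: "(\<Oplus>l\<in>S. e i l \<otimes> f l j) = \<zero>" if "i \<in> S" "j \<in> S" for i j
  proof -
    have "(\<Oplus>l\<in>S. e i l \<otimes> f l j) = (\<Oplus>k\<in>S. (\<Oplus>l\<in>S. e i l \<otimes> y l k) \<otimes> x k j)"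
      unfolding f_def using x y that S by (intro finsum_mult_assoc[symmetric]) auto
    also have "\<dots> = \<zero>" using ey x that by (intro add.finprod_one_eqI) auto
    finally show ?thesis .
  qed
  have ee: "e i j = (\<Oplus>l\<in>S. e i l \<otimes> e l j)" if "i \<in> S" "j \<in> S" for i j
  proof -
    have c: "(\<Oplus>l\<in>S. e i l \<otimes> e l j) \<in> carrier R" using that by (auto intro!: finsum_closed)
    have "(\<Oplus>l\<in>S. e i l \<otimes> e l j) \<oplus> (\<Oplus>l\<in>S. e i l \<otimes> f l j)
        = (\<Oplus>l\<in>S. e i l \<otimes> e l j \<oplus> e i l \<otimes> f l j)"
      using that by (intro finsum_addf[symmetric]) auto
    also have "\<dots> = (\<Oplus>l\<in>S. e i l \<otimes> \<delta> l j)"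
      using that ef by (intro finsum_cong') (auto simp: r_distr[symmetric])
    also have "\<dots> = e i j" using that by (intro \<delta>r) auto
    finally show ?thesis using c eff[OF that] by simp
  qed
  have "e i j = \<zero>"
  proof (rule linear_system_over_radical_trivial[where K = K and S = S and N = e
      and x = "\<lambda>i. e i j" and i = i])
    show "e l j = (\<Oplus>m\<in>S. e l m \<otimes> e m j)" if "l \<in> S" for l using ee[OF that ij(2)] .
    show "e l m \<in> K" if "l \<in> S" "m \<in> S" for l m
      using yx[OF that] unfolding e_def \<delta>_def f_def .
    show "e l j \<in> carrier R" if "l \<in> S" for l using ec[OF that ij(2)] .
  qed (fact K inv S ij)+
  then show ?thesis using ef[OF ij] ij unfolding f_def[symmetric] \<delta>_def[symmetric] by simp
qed

end

text \<open>
  Modulo the radical algebra \<open>A\<close> the unital hull becomes the base field, and over a field a one-sided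
  inverse of a square matrix is two-sided. So if \<open>X Y = 1\<close>, then the entries of \<open>1 - Y X\<close> lie in
  \<open>A\<close>, where the preceding lemma applies: \<open>1 - t\<close> is invertible in the hull for every \<open>t\<close> in \<open>A\<close>.
\<close>

theorem stably_finite_unital_hull:
  fixes A :: "('f::field, 'a, 'm) module_scheme"
  assumes A: "nonunital_algebra class_ring A" and J: "jacobson_radical_algebra class_ring A"
  shows "stably_finite (unital_hull A)"
  unfolding stably_finite_def directly_finite_def
proof (intro allI ballI impI)
  fix n X Y
  let ?H = "unital_hull A"
  assume X: "X \<in> carrier (matrix_ring n ?H)" and Y: "Y \<in> carrier (matrix_ring n ?H)"
    and XY: "X \<otimes>\<^bsub>matrix_ring n ?H\<^esub> Y = \<one>\<^bsub>matrix_ring n ?H\<^esub>"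
  interpret A: nonunital_algebra class_ring A by (rule A)
  interpret H: ring ?H by (rule ring_unital_hull[OF A])
  have entry: "M $$ (i, j) \<in> carrier ?H"
    if "M \<in> carrier (matrix_ring n ?H)" "i \<in> {..<n}" "j \<in> {..<n}" for M i j
    using that elements_matI[of M n n i j] by (auto simp: matrix_ring_def)
  have xy: "(\<Oplus>\<^bsub>?H\<^esub>k\<in>{..<n}. X $$ (i, k) \<otimes>\<^bsub>?H\<^esub> Y $$ (k, j)) = (if i = j then \<one>\<^bsub>?H\<^esub> else \<zero>\<^bsub>?H\<^esub>)"
    if "i \<in> {..<n}" "j \<in> {..<n}" for i j
    using arg_cong[OF XY, of "\<lambda>M. M $$ (i, j)"] that by (simp add: matrix_ring_def)
  have fst_mult: "fst (a \<otimes>\<^bsub>?H\<^esub> b) = fst a * fst b" for a b by (cases a; cases b) simp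
  have fst_add: "fst (a \<oplus>\<^bsub>?H\<^esub> b) = fst a + fst b" for a b by (cases a; cases b) simp
  have fst_sum: "fst (\<Oplus>\<^bsub>?H\<^esub>k\<in>S. f k) = (\<Sum>k\<in>S. fst (f k))"
    if "finite S" "\<And>k. k \<in> S \<Longrightarrow> f k \<in> carrier ?H" for f and S :: "nat set"
    using that
  proof (induction S rule: finite_induct)
    case (insert s S)
    then show ?case by (subst H.finsum_insert) (auto simp: fst_add simp del: unital_hull_simps(1))
  qed simp
  have fst_minus: "fst (a \<ominus>\<^bsub>?H\<^esub> b) = fst a - fst b" if "a \<in> carrier ?H" "b \<in> carrier ?H" for a b
  proof -
    have "fst (a \<ominus>\<^bsub>?H\<^esub> b) + fst b = fst ((a \<ominus>\<^bsub>?H\<^esub> b) \<oplus>\<^bsub>?H\<^esub> b)" by (simp add: fst_add)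
    also have "(a \<ominus>\<^bsub>?H\<^esub> b) \<oplus>\<^bsub>?H\<^esub> b = a"
      using that by (simp add: H.minus_eq H.a_assoc H.l_neg del: unital_hull_simps)
    finally show ?thesis by (simp add: algebra_simps)
  qed
  define X0 where "X0 = mat n n (\<lambda>ij. fst (X $$ ij))"
  define Y0 where "Y0 = mat n n (\<lambda>ij. fst (Y $$ ij))"
  have "X0 * Y0 = 1\<^sub>m n"
  proof (rule eq_matI)
    fix i j assume "i < dim_row (1\<^sub>m n :: 'f mat)" "j < dim_col (1\<^sub>m n :: 'f mat)"
    then have ij: "i \<in> {..<n}" "j \<in> {..<n}" by auto
    have "(X0 * Y0) $$ (i, j) = (\<Sum>k<n. fst (X $$ (i, k)) * fst (Y $$ (k, j)))"
      using ij by (auto simp: X0_def Y0_def scalar_prod_def atLeast0LessThan intro!: sum.cong)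
    also have "\<dots> = fst (\<Oplus>\<^bsub>?H\<^esub>k\<in>{..<n}. X $$ (i, k) \<otimes>\<^bsub>?H\<^esub> Y $$ (k, j))"
      using entry[OF X] entry[OF Y] ij
      by (subst fst_sum) (auto simp: fst_mult simp del: unital_hull_simps)
    also have "\<dots> = 1\<^sub>m n $$ (i, j)" using xy[OF ij] ij by simp
    finally show "(X0 * Y0) $$ (i, j) = 1\<^sub>m n $$ (i, j)" .
  qed (auto simp: X0_def Y0_def)
  then have Y0X0: "Y0 * X0 = 1\<^sub>m n"
    by (intro mat_mult_left_right_inverse[of X0 n Y0]) (auto simp: X0_def Y0_def)
  have yx0: "fst (\<Oplus>\<^bsub>?H\<^esub>k\<in>{..<n}. Y $$ (i, k) \<otimes>\<^bsub>?H\<^esub> X $$ (k, j)) = (if i = j then 1 else 0)"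
    if ij: "i \<in> {..<n}" "j \<in> {..<n}" for i j
  proof -
    have "fst (\<Oplus>\<^bsub>?H\<^esub>k\<in>{..<n}. Y $$ (i, k) \<otimes>\<^bsub>?H\<^esub> X $$ (k, j))
        = (\<Sum>k<n. fst (Y $$ (i, k)) * fst (X $$ (k, j)))"
      using entry[OF X] entry[OF Y] ij
      by (subst fst_sum) (auto simp: fst_mult simp del: unital_hull_simps)
    also have "\<dots> = (Y0 * X0) $$ (i, j)"
      using ij by (auto simp: X0_def Y0_def scalar_prod_def atLeast0LessThan intro!: sum.cong)
    finally show ?thesis using Y0X0 ij by simp
  qed
  define K where "K = {(0 :: 'f, t) | t. t \<in> carrier A}"
  have smult0: "0 \<odot>\<^bsub>A\<^esub> t = \<zero>\<^bsub>A\<^esub>" if "t \<in> carrier A" for t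
    using A.smult_l_null[of t] that by simp
  have inv: "\<exists>u\<in>carrier ?H. u \<otimes>\<^bsub>?H\<^esub> (\<one>\<^bsub>?H\<^esub> \<ominus>\<^bsub>?H\<^esub> t) = \<one>\<^bsub>?H\<^esub>" if tK: "t \<in> K" for t
  proof -
    obtain f where f: "t = (0, f)" "f \<in> carrier A" using tK by (auto simp: K_def)
    obtain g where g: "g \<in> carrier A" "g \<otimes>\<^bsub>A\<^esub> f = f \<oplus>\<^bsub>A\<^esub> g"
      using J f(2) unfolding A.jacobson_radical_algebra_iff quasi_invertible_def by blast
    let ?g = "(0 :: 'f, g)"
    have c: "t \<in> carrier ?H" "?g \<in> carrier ?H" using f g by auto
    have gt: "?g \<otimes>\<^bsub>?H\<^esub> t = t \<oplus>\<^bsub>?H\<^esub> ?g"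
      using f g by (simp add: smult0 A.mult_closed)
    \<comment> \<open>If g is a quasi-inverse of f, then 1 - g is an inverse of 1 - f.\<close>
    have "(\<one>\<^bsub>?H\<^esub> \<ominus>\<^bsub>?H\<^esub> ?g) \<otimes>\<^bsub>?H\<^esub> (\<one>\<^bsub>?H\<^esub> \<ominus>\<^bsub>?H\<^esub> t)
        = \<one>\<^bsub>?H\<^esub> \<ominus>\<^bsub>?H\<^esub> t \<ominus>\<^bsub>?H\<^esub> ?g \<oplus>\<^bsub>?H\<^esub> ?g \<otimes>\<^bsub>?H\<^esub> t"
      using c by (simp del: unital_hull_simps add: H.minus_eq H.l_distr H.r_distr H.l_minus H.r_minus
        H.a_assoc H.minus_add H.a_ac)
    also have "\<dots> = \<one>\<^bsub>?H\<^esub>"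
      unfolding gt using c
      by (simp del: unital_hull_simps add: H.minus_eq H.a_ac H.r_neg H.r_neg1 H.r_neg2)
    finally show ?thesis using c by (intro bexI[of _ "\<one>\<^bsub>?H\<^esub> \<ominus>\<^bsub>?H\<^esub> ?g"]) (auto simp del: unital_hull_simps)
  qed
  have inK: "a \<in> K \<longleftrightarrow> a \<in> carrier ?H \<and> fst a = 0" for a by (cases a) (auto simp: K_def)
  have yx: "(\<Oplus>\<^bsub>?H\<^esub>k\<in>{..<n}. Y $$ (i, k) \<otimes>\<^bsub>?H\<^esub> X $$ (k, j)) = (if i = j then \<one>\<^bsub>?H\<^esub> else \<zero>\<^bsub>?H\<^esub>)"
    if ij: "i \<in> {..<n}" "j \<in> {..<n}" for i j
  proof (rule H.one_sided_inverse_modulo_radical[where K = K and S = "{..<n}"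
      and x = "\<lambda>i j. X $$ (i, j)" and y = "\<lambda>i j. Y $$ (i, j)"])
    fix i j assume ij: "i \<in> {..<n}" "j \<in> {..<n}"
    have "(\<Oplus>\<^bsub>?H\<^esub>k\<in>{..<n}. Y $$ (i, k) \<otimes>\<^bsub>?H\<^esub> X $$ (k, j)) \<in> carrier ?H"
      using entry[OF X] entry[OF Y] ij
      by (auto intro!: H.finsum_closed H.m_closed simp del: unital_hull_simps)
    moreover have "(if i = j then \<one>\<^bsub>?H\<^esub> else \<zero>\<^bsub>?H\<^esub>) \<in> carrier ?H"
      using H.one_closed H.zero_closed by presburger
    ultimately show "(if i = j then \<one>\<^bsub>?H\<^esub> else \<zero>\<^bsub>?H\<^esub>) \<ominus>\<^bsub>?H\<^esub> (\<Oplus>\<^bsub>?H\<^esub>k\<in>{..<n}. Y $$ (i, k) \<otimes>\<^bsub>?H\<^esub> X $$ (k, j)) \<in> K"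
      using yx0[OF ij] H.minus_closed unfolding inK
      by (subst fst_minus) (auto simp del: unital_hull_simps(1,2,5,6))
  next
    show "s \<oplus>\<^bsub>?H\<^esub> t \<in> K" if "s \<in> K" "t \<in> K" for s t
      using that unfolding inK by (auto simp: fst_add simp del: unital_hull_simps)
    show "r \<otimes>\<^bsub>?H\<^esub> t \<in> K" "t \<otimes>\<^bsub>?H\<^esub> r \<in> K" if "r \<in> carrier ?H" "t \<in> K" for r t
      using that unfolding inK by (auto simp: fst_mult simp del: unital_hull_simps)
  qed (use that xy entry[OF X] entry[OF Y] inv inK in auto)
  show "Y \<otimes>\<^bsub>matrix_ring n ?H\<^esub> X = \<one>\<^bsub>matrix_ring n ?H\<^esub>"
    unfolding matrix_ring_def using yx by (auto intro!: eq_matI)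
qed

section \<open>Free algebras\<close>

text \<open>
  Words form a monoid under concatenation. With this instance, the convolution product of finitely
  supported functions on words is the multiplication of the free algebra.
\<close>

instantiation list :: (type) monoid_add
begin
definition zero_list :: "'a list" where "zero_list = []"
definition plus_list :: "'a list \<Rightarrow> 'a list \<Rightarrow> 'a list" where "plus_list = (@)"
instance by standard (simp_all add: zero_list_def plus_list_def)
end

type_synonym ('x, 'f) free_algebra = "'x list \<Rightarrow>\<^sub>0 'f"

abbreviation coef :: "('x, 'f::zero) free_algebra \<Rightarrow> 'x list \<Rightarrow> 'f"
  where "coef \<equiv> Poly_Mapping.lookup"

abbreviation supp :: "('x, 'f::zero) free_algebra \<Rightarrow> 'x list set"
  where "supp \<equiv> Poly_Mapping.keys"

abbreviation word :: "'x list \<Rightarrow> ('x, 'f::field) free_algebra"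
  where "word w \<equiv> Poly_Mapping.single w 1"

text \<open>
  Scaling is multiplication by a constant, so its compatibility with products reduces to associativity and
  to the centrality of constants.
\<close>

definition scl :: "'f::field \<Rightarrow> ('x, 'f) free_algebra \<Rightarrow> ('x, 'f) free_algebra"
  where "scl c p = Poly_Mapping.single [] c * p"

lemma lookup_scl [simp]: "coef (scl c p) w = c * coef p w"
proof -
  have "scl c p = Poly_Mapping.map ((*) c) p"
    unfolding scl_def mult_map_scale_conv_mult zero_list_def ..
  then show ?thesis by (simp add: Poly_Mapping.map.rep_eq when_def)
qed

lemma single_mult_single: "Poly_Mapping.single v c * Poly_Mapping.single w d
    = Poly_Mapping.single (v @ w) (c * d :: 'f::field)"
  by (simp add: mult_single plus_list_def)

lemma word_Nil: "word [] = 1"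
  by (simp add: zero_list_def[symmetric])

lemma word_append: "word (v @ w) = word v * word w"
  by (simp add: single_mult_single)

lemma scl_single: "scl c (Poly_Mapping.single w d) = Poly_Mapping.single w (c * d)"
  by (simp add: scl_def single_mult_single)

lemma free_algebra_expansion:
  assumes "finite A" "supp p \<subseteq> A"
  shows "p = (\<Sum>w\<in>A. Poly_Mapping.single w (coef p w))"
proof (rule poly_mapping_eqI)
  fix v
  have "coef (\<Sum>w\<in>A. Poly_Mapping.single w (coef p w)) v
      = (\<Sum>w\<in>A. if w = v then coef p w else 0)"
    by (simp add: lookup_sum lookup_single when_def)
  also have "\<dots> = coef p v" using assms by (auto simp: in_keys_iff)
  finally show "coef p v = coef (\<Sum>w\<in>A. Poly_Mapping.single w (coef p w)) v" by simp
qed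

lemma free_algebra_expansion_word: "p = (\<Sum>w\<in>supp p. scl (coef p w) (word w))"
  using free_algebra_expansion[of "supp p" p] by (simp add: scl_single)

lemma free_algebra_induct [case_names single add]:
  fixes p :: "('x, 'f::field) free_algebra"
  assumes single: "\<And>w c. P (Poly_Mapping.single w c)" and add: "\<And>p q. P p \<Longrightarrow> P q \<Longrightarrow> P (p + q)"
  shows "P p"
proof -
  have "P (\<Sum>w\<in>A. Poly_Mapping.single w (coef p w))" if "finite A" for A
    using that
  proof (induction A rule: finite_induct)
    case empty
    then show ?case using single[of "[]" 0] by simp
  next
    case (insert w A)
    then show ?case by (simp add: add single)
  qed
  from this[of "supp p"] show ?thesis
    using free_algebra_expansion[of "supp p" p, symmetric] by simp
qed

lemma scalar_central: "Poly_Mapping.single [] c * p = p * Poly_Mapping.single [] (c :: 'f::field)"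
  by (induction p rule: free_algebra_induct)
    (simp_all add: single_mult_single mult.commute algebra_simps)

lemma mult_scl_left: "scl c p * q = scl c (p * q)"
  by (simp add: scl_def mult.assoc)

lemma mult_scl_right: "p * scl c q = scl c (p * q)"
proof -
  have "p * scl c q = (p * Poly_Mapping.single [] c) * q" by (simp add: scl_def mult.assoc)
  then show ?thesis by (simp add: scl_def mult.assoc flip: scalar_central)
qed

interpretation free: vector_space "scl :: 'f::field \<Rightarrow> ('x, 'f) free_algebra \<Rightarrow> _"
  by unfold_locales (auto intro!: poly_mapping_eqI simp: lookup_add algebra_simps)

definition linear_extension :: "('x list \<Rightarrow> 'f) \<Rightarrow> ('x, 'f::field) free_algebra \<Rightarrow> 'f"
  where "linear_extension f p = (\<Sum>w\<in>supp p. coef p w * f w)"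

lemma linear_extension_eq_sum:
  assumes "finite A" "supp p \<subseteq> A"
  shows "linear_extension f p = (\<Sum>w\<in>A. coef p w * f w)"
  unfolding linear_extension_def using assms by (intro sum.mono_neutral_left) (auto simp: in_keys_iff)

lemma linear_extension_add: "linear_extension f (p + q) = linear_extension f p + linear_extension f q"
proof -
  have *: "finite (supp p \<union> supp q)" by simp
  show ?thesis
    using keys_add[of p q]
    by (simp add: linear_extension_eq_sum[OF *] lookup_add distrib_right sum.distrib)
qed

lemma linear_extension_scl: "linear_extension f (scl c p) = c * linear_extension f p"
proof -
  have "supp (scl c p) \<subseteq> supp p" by (auto simp: in_keys_iff)
  then show ?thesis
    by (subst linear_extension_eq_sum[of "supp p"]) (auto simp: linear_extension_def sum_distrib_left mult.assoc)
qed

lemma linear_extension_single [simp]: "linear_extension f (Poly_Mapping.single w c) = c * f w"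
  by (subst linear_extension_eq_sum[of "{w}"]) auto

lemma linear_extension_zero [simp]: "linear_extension f 0 = 0"
  by (simp add: linear_extension_def)

lemma linear_extension_uminus: "linear_extension f (- p) = - linear_extension f p"
  using linear_extension_add[of f p "- p"] by (simp add: eq_neg_iff_add_eq_0 add.commute)

lemma linear_extension_diff: "linear_extension f (p - q) = linear_extension f p - linear_extension f q"
  using linear_extension_add[of f p "- q"] by (simp add: linear_extension_uminus)

lemma linear_extension_sum: "linear_extension f (\<Sum>i\<in>A. p i) = (\<Sum>i\<in>A. linear_extension f (p i))"
  by (induction A rule: infinite_finite_induct) (auto simp: linear_extension_add)

lemma linear_extension_zero_on_span:
  assumes "p \<in> free.span S" "\<And>s. s \<in> S \<Longrightarrow> linear_extension f s = 0"
  shows "linear_extension f p = 0"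
proof -
  have "free.span S \<subseteq> {p. linear_extension f p = 0}"
    by (rule free.span_minimal) (use assms(2) in \<open>auto simp: free.subspace_def linear_extension_add linear_extension_scl\<close>)
  with assms show ?thesis by blast
qed

lemma span_mult:
  assumes p: "p \<in> free.span S" and st: "\<And>s. s \<in> S \<Longrightarrow> a * s * b \<in> free.span T"
  shows "a * p * b \<in> free.span T"
proof -
  have "free.span S \<subseteq> {p. a * p * b \<in> free.span T}"
  proof (rule free.span_minimal)
    show "free.subspace {p. a * p * b \<in> free.span T}"
      by (auto simp: free.subspace_def distrib_left distrib_right mult_scl_left mult_scl_right
        free.span_zero free.span_add free.span_scale)
  qed (use st in auto)
  with p show ?thesis by blast
qed

lemma in_span_words: "finite A \<Longrightarrow> supp p \<subseteq> A \<Longrightarrow> p \<in> free.span (word ` A)"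
  by (subst free_algebra_expansion_word[of p])
    (auto intro!: free.span_sum free.span_scale intro: free.span_base)

lemma independent_words:
  assumes "finite A"
  shows "free.independent (word ` A :: ('x, 'f::field) free_algebra set)"
proof (rule free.independent_if_scalars_zero)
  fix u :: "('x, 'f) free_algebra \<Rightarrow> 'f" and v :: "('x, 'f) free_algebra"
  assume 0: "(\<Sum>v\<in>word ` A. scl (u v) v) = 0" and "v \<in> word ` A"
  then obtain w where w: "w \<in> A" "v = word w" by auto
  have inj: "inj_on (word :: 'x list \<Rightarrow> ('x, 'f) free_algebra) A"
    by (rule inj_onI) (metis keys_single one_neq_zero singleton_inject)
  have "0 = coef (\<Sum>x\<in>A. scl (u (word x)) (word x)) w"
    using 0 sum.reindex[OF inj, of "\<lambda>v. scl (u v) v"] by simp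
  also have "\<dots> = (\<Sum>x\<in>A. if x = w then u (word x) else 0)"
    by (auto simp: lookup_sum lookup_single when_def intro!: sum.cong)
  also have "\<dots> = u v" using w assms by simp
  finally show "u v = 0" by simp
qed (use assms in auto)

definition homogeneous :: "nat \<Rightarrow> ('x, 'f::field) free_algebra set"
  where "homogeneous n = {p. \<forall>w\<in>supp p. length w = n}"

lemma homogeneous_mult:
  "p \<in> homogeneous m \<Longrightarrow> q \<in> homogeneous n \<Longrightarrow> p * q \<in> homogeneous (m + n)"
  using keys_mult[of p q] by (fastforce simp: homogeneous_def plus_list_def)

lemma word_homogeneous: "word w \<in> homogeneous (length w)"
  by (simp add: homogeneous_def)

lemma subspace_homogeneous: "free.subspace (homogeneous n)"
  unfolding free.subspace_def homogeneous_def
  by (auto simp: in_keys_iff lookup_add)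

section \<open>The theorem of Golod and Shafarevich\<close>

context
  fixes Rel :: "nat \<Rightarrow> ('x::finite, 'f::field) free_algebra set"
  assumes Rel_homogeneous: "\<And>i. Rel i \<subseteq> homogeneous i"
    and Rel_finite: "\<And>i. finite (Rel i)"
    and Rel_0: "Rel 0 = {}"
begin

definition relators :: "nat \<Rightarrow> ('x, 'f) free_algebra set"
  where "relators n = {word s * r * word t | s r t i. r \<in> Rel i \<and> length s + i + length t = n}"

text \<open>
  The component of degree \<open>n\<close> of the two-sided ideal generated by all relations, where \<open>Rel i\<close> consists
  of relations that are homogeneous of degree \<open>i\<close>.
\<close>

definition rel_ideal :: "nat \<Rightarrow> ('x, 'f) free_algebra set"
  where "rel_ideal n = free.span (relators n)"

lemma rel_ideal_homogeneous: "rel_ideal n \<subseteq> homogeneous n"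
  unfolding rel_ideal_def
proof (rule free.span_minimal[OF _ subspace_homogeneous], rule subsetI)
  fix p assume "p \<in> relators n"
  then obtain s r t i where p: "p = word s * r * word t" "r \<in> Rel i" "length s + i + length t = n"
    by (auto simp: relators_def)
  have "p \<in> homogeneous (length s + i + length t)"
    unfolding p(1) using p(2) Rel_homogeneous by (intro homogeneous_mult word_homogeneous) auto
  then show "p \<in> homogeneous n" using p(3) by simp
qed

lemma rel_ideal_mult_words:
  assumes "p \<in> rel_ideal n"
  shows "word a * p * word b \<in> rel_ideal (length a + n + length b)"
  using assms unfolding rel_ideal_def
proof (rule span_mult)
  fix q assume "q \<in> relators n"
  then obtain s r t i where q: "q = word s * r * word t" "r \<in> Rel i" "length s + i + length t = n"
    by (auto simp: relators_def)
  have "word a * q * word b = word (a @ s) * r * word (t @ b)"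
    by (simp add: q(1) word_append mult.assoc)
  then have "word a * q * word b \<in> relators (length a + n + length b)"
    unfolding relators_def using q(2,3) by fastforce
  then show "word a * q * word b \<in> free.span (relators (length a + n + length b))"
    by (rule free.span_base)
qed

text \<open>
  The set \<open>S\<close> complements a basis \<open>B\<close> of the ideal in degree \<open>n\<close>, so \<open>card S\<close> is the dimension of
  the quotient algebra in that degree.
\<close>

lemma rel_ideal_basis_and_complement:
  obtains B S where "free.independent B" "B \<subseteq> rel_ideal n" "rel_ideal n \<subseteq> free.span B"
    "finite B" "finite S" "homogeneous n \<subseteq> free.span (B \<union> S)" "card B + card S \<le> CARD('x) ^ n"
proof -
  let ?W = "{w :: 'x list. set w \<subseteq> UNIV \<and> length w = n}"
  have W: "finite ?W" "card ?W = CARD('x) ^ n"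
    using finite_lists_length_eq[of "UNIV :: 'x set" n] card_lists_length_eq[of "UNIV :: 'x set" n]
    by auto
  have spanW: "homogeneous n \<subseteq> free.span (word ` ?W :: ('x, 'f) free_algebra set)"
    using W by (auto intro!: in_span_words simp: homogeneous_def)
  obtain B where B: "B \<subseteq> rel_ideal n" "free.independent B" "rel_ideal n \<subseteq> free.span B"
    by (rule free.maximal_independent_subset)
  have BH: "B \<subseteq> homogeneous n" using B(1) rel_ideal_homogeneous by (rule subset_trans)
  obtain C where C: "B \<subseteq> C" "C \<subseteq> homogeneous n" "free.independent C" "homogeneous n \<subseteq> free.span C"
    by (rule free.maximal_independent_subset_extend[OF BH B(2)])
  have "finite C \<and> card C \<le> card (word ` ?W :: ('x, 'f) free_algebra set)"
    using C(2,3) spanW W(1) by (intro free.independent_span_bound) auto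
  then have finC: "finite C" and "card C \<le> CARD('x) ^ n"
    using card_image_le[OF W(1), of "word :: 'x list \<Rightarrow> ('x, 'f) free_algebra"] W(2) by auto
  moreover have "finite B" using finC C(1) finite_subset by blast
  moreover have "card B + card (C - B) = card C"
    using C(1) finC by (metis card_Diff_subset card_mono finite_subset le_add_diff_inverse)
  moreover have "B \<union> (C - B) = C" using C(1) by blast
  ultimately show thesis using B C that[of B "C - B"] by auto
qed

text \<open>
  A generator \<open>s r t\<close> of degree \<open>n + 1\<close> either has a last letter in \<open>t\<close>, and then it is an ideal element of
  degree \<open>n\<close> times this letter, or it is \<open>s r\<close>. In the latter case \<open>s\<close> is only relevant modulo the
  ideal: for \<open>b\<close> in the ideal, \<open>b r\<close> is a sum of ideal elements of degree \<open>n\<close> times letters, as \<open>r\<close> has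
  positive degree. So it suffices to let \<open>s\<close> range over a complement of the ideal.
\<close>

lemma rel_ideal_Suc_span:
  assumes B: "\<And>n. B n \<subseteq> rel_ideal n" "\<And>n. rel_ideal n \<subseteq> free.span (B n)"
    and S: "\<And>n. homogeneous n \<subseteq> free.span (B n \<union> S n)"
  defines "Z n \<equiv> (\<Union>x. (\<lambda>b. b * word [x]) ` B n)
    \<union> (\<Union>i\<in>{1..Suc n}. (\<lambda>(s, r). s * r) ` (S (Suc n - i) \<times> Rel i))"
  shows "rel_ideal (Suc n) \<subseteq> free.span (Z n)"
proof -
  have A: "p * word [x] \<in> free.span (Z n)" if "p \<in> rel_ideal n" for p x
  proof -
    have "1 * p * word [x] \<in> free.span (Z n)"
    proof (rule span_mult[where S = "B n"])
      show "p \<in> free.span (B n)" using that B by blast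
      show "1 * b * word [x] \<in> free.span (Z n)" if "b \<in> B n" for b
        using that by (intro free.span_base) (auto simp: Z_def)
    qed
    then show ?thesis by simp
  qed
  have *: "word s * r \<in> free.span (Z n)" if r: "r \<in> Rel i" and i: "length s + i = Suc n" for s r i
  proof -
    have i0: "i \<noteq> 0" using r Rel_0 by (cases "i = 0") auto
    have "1 * word s * r \<in> free.span (Z n)"
    proof (rule span_mult[where S = "B (length s) \<union> S (length s)"])
      show "word s \<in> free.span (B (length s) \<union> S (length s))" using S word_homogeneous by blast
      fix b assume "b \<in> B (length s) \<union> S (length s)"
      then show "1 * b * r \<in> free.span (Z n)"
      proof
        assume b: "b \<in> B (length s)"
        have "b * scl (coef r w) (word w) \<in> free.span (Z n)" if w: "w \<in> supp r" for w
        proof -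
          have lw: "length w = i" using w r Rel_homogeneous by (auto simp: homogeneous_def)
          then obtain v x where v: "w = v @ [x]" using i0 by (cases w rule: rev_cases) auto
          have "word [] * b * word v \<in> rel_ideal (length ([] :: 'x list) + length s + length v)"
            using b B by (intro rel_ideal_mult_words) auto
          moreover have "length s + length v = n" using i lw v by simp
          ultimately have "b * word v \<in> rel_ideal n" by (simp add: word_Nil)
          then have "b * word v * word [x] \<in> free.span (Z n)" by (rule A)
          then show ?thesis
            by (simp add: mult_scl_right free.span_scale v word_append mult.assoc)
        qed
        then have "(\<Sum>w\<in>supp r. b * scl (coef r w) (word w)) \<in> free.span (Z n)"
          by (intro free.span_sum)
        then show "1 * b * r \<in> free.span (Z n)"
          using free_algebra_expansion_word[of r] by (simp flip: sum_distrib_left)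
      next
        assume b: "b \<in> S (length s)"
        have "i \<in> {1..Suc n}" "Suc n - i = length s" using i i0 by auto
        then have "b * r \<in> Z n" unfolding Z_def using b r by force
        then show "1 * b * r \<in> free.span (Z n)" by (simp add: free.span_base)
      qed
    qed
    then show ?thesis by simp
  qed
  have "relators (Suc n) \<subseteq> free.span (Z n)"
  proof
    fix p assume "p \<in> relators (Suc n)"
    then obtain s r t i where p: "p = word s * r * word t" "r \<in> Rel i"
      "length s + i + length t = Suc n"
      by (auto simp: relators_def)
    show "p \<in> free.span (Z n)"
    proof (cases t rule: rev_cases)
      case Nil
      then show ?thesis using p *[of r i s] by (simp add: word_Nil)
    next
      case (snoc t' x)
      have "word s * r * word t' \<in> relators n"
        unfolding relators_def using p snoc by fastforce
      then have "word s * r * word t' \<in> rel_ideal n"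
        unfolding rel_ideal_def by (rule free.span_base)
      from A[OF this, of x] show ?thesis by (simp add: p(1) snoc word_append mult.assoc)
    qed
  qed
  then show ?thesis
    unfolding rel_ideal_def[of "Suc n"] by (rule free.span_minimal) (rule free.subspace_span)
qed

text \<open>
  Counting the spanning set of the preceding lemma. If \<open>S n\<close> is a complement of the ideal, then with \<open>a\<^sub>n\<close> for the dimension of the quotient in
  degree \<open>n\<close>, \<open>d\<close> for the number of letters and \<open>r\<^sub>i\<close> for the number of relations of degree \<open>i\<close>, this
  is the Golod--Shafarevich inequality \<open>a\<^sub>n\<^sub>+\<^sub>1 \<ge> d a\<^sub>n - \<Sum>\<^sub>i r\<^sub>i a\<^sub>n\<^sub>+\<^sub>1\<^sub>-\<^sub>i\<close>.
\<close>

lemma golod_shafarevich_inequality: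
  assumes ind: "\<And>n. free.independent (B n)"
    and B: "\<And>n. B n \<subseteq> rel_ideal n" "\<And>n. rel_ideal n \<subseteq> free.span (B n)"
    and S: "\<And>n. homogeneous n \<subseteq> free.span (B n \<union> S n)"
    and fin: "\<And>n. finite (B n)" "\<And>n. finite (S n)"
  shows "card (B (Suc n)) \<le> CARD('x) * card (B n) + (\<Sum>i=1..Suc n. card (S (Suc n - i)) * card (Rel i))"
proof -
  let ?Z1 = "\<Union>x. (\<lambda>b. b * word [x]) ` B n"
  let ?Z2 = "\<Union>i\<in>{1..Suc n}. (\<lambda>(s, r). s * r) ` (S (Suc n - i) \<times> Rel i)"
  have finZ: "finite (?Z1 \<union> ?Z2)" using fin Rel_finite by auto
  have "card (B (Suc n)) \<le> card (?Z1 \<union> ?Z2)"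
    using free.independent_span_bound[OF finZ ind[of "Suc n"]] rel_ideal_Suc_span[OF B S, of n] B(1)[of "Suc n"]
    by blast
  also have "\<dots> \<le> card ?Z1 + card ?Z2" by (rule card_Un_le)
  also have "card ?Z1 \<le> (\<Sum>x\<in>(UNIV :: 'x set). card ((\<lambda>b. b * word [x]) ` B n))"
    by (rule card_UN_le) simp
  also have "\<dots> \<le> (\<Sum>x\<in>(UNIV :: 'x set). card (B n))"
    by (intro sum_mono card_image_le fin)
  also have "\<dots> = CARD('x) * card (B n)" by simp
  also have "card ?Z2 \<le> (\<Sum>i=1..Suc n. card ((\<lambda>(s, r). s * r) ` (S (Suc n - i) \<times> Rel i)))"
    by (rule card_UN_le) simp
  also have "\<dots> \<le> (\<Sum>i=1..Suc n. card (S (Suc n - i)) * card (Rel i))"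
    by (intro sum_mono order_trans[OF card_image_le])
      (auto simp: card_cartesian_product fin Rel_finite)
  finally show ?thesis by simp
qed

text \<open>
  The dimensions at least double from each degree to the next. As long as this holds, the dimension in
  degree \<open>n + 1 - i\<close> is at most \<open>2 / 2^i\<close> times the one in degree \<open>n\<close>, so the hypothesis on the relations
  bounds the sum in the Golod--Shafarevich inequality by \<open>a\<^sub>n\<close>, and at least \<open>(3 - 1) a\<^sub>n\<close> remains.
\<close>

theorem golod_shafarevich:
  assumes d: "CARD('x) \<ge> 3"
    and few: "\<And>n. (\<Sum>i=1..n. real (card (Rel i)) / 2 ^ i) \<le> 1 / 2"
  shows "\<exists>w. length w = n \<and> word w \<notin> rel_ideal n"
proof -
  let ?d = "CARD('x)"
  have "\<exists>B S. free.independent B \<and> B \<subseteq> rel_ideal n \<and> rel_ideal n \<subseteq> free.span B \<and> finite B \<and>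
    finite S \<and> homogeneous n \<subseteq> free.span (B \<union> S) \<and> card B + card S \<le> ?d ^ n" for n
    by (rule rel_ideal_basis_and_complement[of n]) blast
  then obtain B S where B: "\<And>n. free.independent (B n)" "\<And>n. B n \<subseteq> rel_ideal n"
    "\<And>n. rel_ideal n \<subseteq> free.span (B n)" "\<And>n. finite (B n)" "\<And>n. finite (S n)"
    "\<And>n. homogeneous n \<subseteq> free.span (B n \<union> S n)" "\<And>n. card (B n) + card (S n) \<le> ?d ^ n"
    by metis
  define a where "a n = real (?d ^ n) - real (card (B n))" for n
  have S_le: "real (card (S n)) \<le> a n" for n
    using B(7)[of n] unfolding a_def by linarith
  have a_nonneg: "0 \<le> a n" for n using S_le[of n] by linarith
  have step: "real ?d * a n \<le> a (Suc n) + (\<Sum>i=1..Suc n. a (Suc n - i) * card (Rel i))" for n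
  proof -
    have "card (B (Suc n)) \<le> ?d * card (B n) + (\<Sum>i=1..Suc n. card (S (Suc n - i)) * card (Rel i))"
      by (rule golod_shafarevich_inequality) (use B in auto)
    then have "real (card (B (Suc n)))
        \<le> real (?d * card (B n) + (\<Sum>i=1..Suc n. card (S (Suc n - i)) * card (Rel i)))"
      by (rule of_nat_mono)
    also have "\<dots> \<le> real ?d * card (B n) + (\<Sum>i=1..Suc n. a (Suc n - i) * card (Rel i))"
      unfolding of_nat_add of_nat_mult of_nat_sum
      by (intro add_left_mono sum_mono mult_right_mono S_le) simp
    finally show ?thesis by (simp add: a_def algebra_simps)
  qed
  have grow: "2 * a n \<le> a (Suc n)" for n
  proof (induction n rule: less_induct)
    case (less n)
    have pow: "2 ^ k * a (n - k) \<le> a n" if "k \<le> n" for k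
      using that
    proof (induction k)
      case (Suc k)
      have "2 * a (n - Suc k) \<le> a (Suc (n - Suc k))" using less[of "n - Suc k"] Suc.prems by simp
      also have "Suc (n - Suc k) = n - k" using Suc.prems by simp
      finally have "2 ^ k * (2 * a (n - Suc k)) \<le> 2 ^ k * a (n - k)"
        by (intro mult_left_mono) auto
      also have "\<dots> \<le> a n" using Suc by simp
      finally show ?case by (simp add: ac_simps)
    qed simp
    have "(\<Sum>i=1..Suc n. a (Suc n - i) * card (Rel i))
        \<le> (\<Sum>i=1..Suc n. 2 * a n * (real (card (Rel i)) / 2 ^ i))"
    proof (rule sum_mono)
      fix i assume "i \<in> {1..Suc n}"
      then obtain k where k: "i = Suc k" "k \<le> n" by (cases i) auto
      have "a (n - k) \<le> a n / 2 ^ k" using pow[OF k(2)] by (simp add: field_simps)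
      then have "a (n - k) * card (Rel i) \<le> a n / 2 ^ k * card (Rel i)"
        by (intro mult_right_mono) auto
      then show "a (Suc n - i) * card (Rel i) \<le> 2 * a n * (real (card (Rel i)) / 2 ^ i)"
        using k by simp
    qed
    also have "\<dots> = 2 * a n * (\<Sum>i=1..Suc n. real (card (Rel i)) / 2 ^ i)"
      by (simp only: sum_distrib_left)
    also have "\<dots> \<le> 2 * a n * (1 / 2)"
      using few[of "Suc n"] a_nonneg[of n] by (intro mult_left_mono) auto
    finally have "real ?d * a n \<le> a (Suc n) + a n" using step[of n] by simp
    moreover have "3 * a n \<le> real ?d * a n" using d a_nonneg[of n] by (intro mult_right_mono) auto
    ultimately show ?case by simp
  qed
  have "rel_ideal 0 \<subseteq> {0}"
    unfolding rel_ideal_def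
    by (rule free.span_minimal) (auto simp: relators_def Rel_0 free.subspace_def)
  then have "B 0 \<subseteq> {0}" using B(2)[of 0] by blast
  moreover have "0 \<notin> B 0" using B(1)[of 0] free.dependent_zero by blast
  ultimately have "B 0 = {}" by blast
  then have a0: "a 0 = 1" by (simp add: a_def)
  have pos: "a n > 0" for n
  proof (induction n)
    case (Suc n)
    then show ?case using grow[of n] by linarith
  qed (simp add: a0)
  show ?thesis
  proof (rule ccontr)
    assume neg: "\<not> ?thesis"
    let ?W = "{w :: 'x list. set w \<subseteq> UNIV \<and> length w = n}"
    have W: "finite ?W" "card ?W = ?d ^ n"
      using finite_lists_length_eq[of "UNIV :: 'x set" n] card_lists_length_eq[of "UNIV :: 'x set" n]
      by auto
    have inj: "inj_on (word :: 'x list \<Rightarrow> ('x, 'f) free_algebra) ?W"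
      by (rule inj_onI) (metis keys_single one_neq_zero singleton_inject)
    have "word ` ?W \<subseteq> free.span (B n)" using neg B(3)[of n] by blast
    then have "card (word ` ?W :: ('x, 'f) free_algebra set) \<le> card (B n)"
      using free.independent_span_bound[OF B(4) independent_words[OF W(1)]] by blast
    then have "?d ^ n \<le> card (B n)" using card_image[OF inj] W by simp
    with pos[of n] show False by (simp add: a_def)
  qed
qed

text \<open>
  In each degree a linear functional separates a surviving word from the ideal. These functionals have
  disjoint supports, so a single function on words records all of them.
\<close>

lemma functional_vanishing_on_rel_ideal:
  assumes d: "CARD('x) \<ge> 3"
    and few: "\<And>n. (\<Sum>i=1..n. real (card (Rel i)) / 2 ^ i) \<le> 1 / 2"
  shows "\<exists>\<phi>. (\<forall>n. \<exists>w. length w = n \<and> \<phi> w = 1) \<and> (\<forall>n. \<forall>p\<in>rel_ideal n. linear_extension \<phi> p = 0)"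
proof -
  interpret vector_space "(*) :: 'f \<Rightarrow> 'f \<Rightarrow> 'f"
    by unfold_locales (simp_all add: algebra_simps)
  interpret pair: vector_space_pair "scl :: 'f \<Rightarrow> ('x, 'f) free_algebra \<Rightarrow> _" "(*) :: 'f \<Rightarrow> 'f \<Rightarrow> 'f"
    by unfold_locales
  have "\<exists>g w. Vector_Spaces.linear scl (*) g \<and> length w = n \<and> g (word w) = 1 \<and> (\<forall>p\<in>rel_ideal n. g p = 0)"
    for n
  proof -
    obtain w where w: "length w = n" "word w \<notin> rel_ideal n"
      using golod_shafarevich[OF d few] by blast
    obtain B where B: "B \<subseteq> rel_ideal n" "free.independent B" "rel_ideal n \<subseteq> free.span B"
      by (rule free.maximal_independent_subset)
    have spanB: "free.span B = rel_ideal n"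
      using B free.span_minimal[of B "rel_ideal n"] free.subspace_span
      unfolding rel_ideal_def by blast
    have "free.independent (insert (word w) B)"
      using w spanB B(2) by (intro free.independent_insertI) auto
    then obtain g where g: "Vector_Spaces.linear scl (*) g"
      "\<forall>x\<in>insert (word w) B. g x = (if x = word w then 1 else 0)"
      using pair.linear_independent_extend[of "insert (word w) B" "\<lambda>x. if x = word w then 1 else 0"]
      by blast
    interpret g: Vector_Spaces.linear scl "(*)" g by (rule g(1))
    have "word w \<notin> B" using w B by blast
    then have "\<forall>b\<in>B. g b = 0" using g(2) by auto
    moreover have "free.subspace {p. g p = 0}"
      by (auto simp: free.subspace_def g.add g.scale)
    ultimately have "free.span B \<subseteq> {p. g p = 0}" by (intro free.span_minimal) auto
    then show ?thesis using g w spanB by (intro exI[of _ g] exI[of _ w]) auto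
  qed
  then obtain g w where g: "\<And>n. Vector_Spaces.linear scl (*) (g n)" and w: "\<And>n. length (w n) = n"
    "\<And>n. g n (word (w n)) = 1" and g0: "\<And>n p. p \<in> rel_ideal n \<Longrightarrow> g n p = 0"
    by metis
  define \<phi> where "\<phi> v = g (length v) (word v)" for v
  have "linear_extension \<phi> p = 0" if p: "p \<in> rel_ideal n" for n p
  proof -
    interpret gn: Vector_Spaces.linear scl "(*)" "g n" by (rule g)
    have "linear_extension \<phi> p = (\<Sum>v\<in>supp p. coef p v * g n (word v))"
      unfolding linear_extension_def \<phi>_def using p rel_ideal_homogeneous[of n]
      by (intro sum.cong) (auto simp: homogeneous_def)
    also have "\<dots> = g n (\<Sum>v\<in>supp p. scl (coef p v) (word v))"
      by (simp add: gn.sum gn.scale)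
    also have "\<dots> = 0" using g0[OF p] free_algebra_expansion_word[of p] by simp
    finally show ?thesis .
  qed
  moreover have "\<exists>v. length v = n \<and> \<phi> v = 1" for n
    using w by (intro exI[of _ "w n"]) (simp add: \<phi>_def)
  ultimately show ?thesis by blast
qed

end

section \<open>Powers of generic elements as relations\<close>

definition word_sequences :: "'x list set \<Rightarrow> nat \<Rightarrow> 'x list list set"
  where "word_sequences L k = {ws. set ws \<subseteq> L \<and> length ws = k}"

text \<open>
  The coefficient of the commutative monomial \<open>M\<close> in the \<open>k\<close>-th power of the generic linear combination
  \<open>\<Sum> c\<^sub>w w\<close> of the words in \<open>L\<close>, with the scalars \<open>c\<^sub>w\<close> as commuting variables.
\<close>

definition power_relation :: "'x list set \<Rightarrow> nat \<Rightarrow> 'x list multiset \<Rightarrow> ('x, 'f::field) free_algebra"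
  where "power_relation L k M = (\<Sum>ws | ws \<in> word_sequences L k \<and> mset ws = M. word (concat ws))"

lemma finite_word_sequences: "finite L \<Longrightarrow> finite (word_sequences L k)"
  unfolding word_sequences_def by (rule finite_lists_length_eq)

lemma power_expansion:
  fixes p :: "('x, 'f::field) free_algebra"
  assumes L: "finite L" "supp p \<subseteq> L"
  shows "p ^ k = (\<Sum>ws\<in>word_sequences L k. scl (\<Prod>w\<leftarrow>ws. coef p w) (word (concat ws)))"
proof (induction k)
  case 0
  have "word_sequences L 0 = {[]}" by (auto simp: word_sequences_def)
  then show ?case by (simp add: word_Nil)
next
  case (Suc k)
  have S: "word_sequences L (Suc k) = (\<lambda>(w, ws). w # ws) ` (L \<times> word_sequences L k)"
    by (auto simp: word_sequences_def length_Suc_conv image_iff)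
  have inj: "inj_on (\<lambda>(w, ws). w # ws) (L \<times> word_sequences L k)" by (auto intro: inj_onI)
  have p: "p = (\<Sum>w\<in>L. scl (coef p w) (word w))"
    using free_algebra_expansion[OF L] by (simp add: scl_single)
  have "p ^ Suc k = (\<Sum>w\<in>L. scl (coef p w) (word w)) * p ^ k"
    by (subst p[symmetric]) simp
  also have "\<dots> = (\<Sum>w\<in>L. \<Sum>ws\<in>word_sequences L k.
      scl (coef p w) (word w) * scl (\<Prod>w\<leftarrow>ws. coef p w) (word (concat ws)))"
    by (simp only: Suc sum_product)
  also have "\<dots> = (\<Sum>(w, ws)\<in>L \<times> word_sequences L k.
      scl (\<Prod>w\<leftarrow>w # ws. coef p w) (word (concat (w # ws))))"
    unfolding sum.cartesian_product
    by (intro sum.cong) (auto simp: scl_single single_mult_single)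
  also have "\<dots> = (\<Sum>ws\<in>word_sequences L (Suc k). scl (\<Prod>w\<leftarrow>ws. coef p w) (word (concat ws)))"
    unfolding S sum.reindex[OF inj] by (intro sum.cong) auto
  finally show ?case .
qed

text \<open>
  The coefficients of \<open>p\<close> enter only as scalars. So finitely many relations annihilate the \<open>k\<close>-th powers of
  all linear combinations of words in \<open>L\<close> at once, over a field of any cardinality. These relations are
  homogeneous even though \<open>p\<close> need not be.
\<close>

lemma power_in_span_power_relations:
  fixes p :: "('x, 'f::field) free_algebra"
  assumes L: "finite L" "supp p \<subseteq> L"
  shows "p ^ k \<in> free.span (power_relation L k ` mset ` word_sequences L k)"
proof -
  let ?S = "word_sequences L k"
  have "p ^ k = (\<Sum>M\<in>mset ` ?S. \<Sum>ws\<in>{ws \<in> ?S. mset ws = M}. scl (\<Prod>w\<leftarrow>ws. coef p w) (word (concat ws)))"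
    unfolding power_expansion[OF L] by (rule sum.image_gen[OF finite_word_sequences[OF L(1)]])
  also have "\<dots> = (\<Sum>M\<in>mset ` ?S. scl (\<Prod>w\<in>#M. coef p w) (power_relation L k M))"
  proof (rule sum.cong[OF refl])
    fix M
    have "(\<Sum>ws\<in>{ws \<in> ?S. mset ws = M}. scl (\<Prod>w\<leftarrow>ws. coef p w) (word (concat ws)))
        = (\<Sum>ws\<in>{ws \<in> ?S. mset ws = M}. scl (\<Prod>w\<in>#M. coef p w) (word (concat ws)))"
      by (intro sum.cong refl arg_cong2[of _ _ _ _ scl])
        (auto simp flip: prod_mset_prod_list mset_map)
    then show "(\<Sum>ws\<in>{ws \<in> ?S. mset ws = M}. scl (\<Prod>w\<leftarrow>ws. coef p w) (word (concat ws)))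
        = scl (\<Prod>w\<in>#M. coef p w) (power_relation L k M)"
      by (simp add: power_relation_def free.scale_sum_right)
  qed
  also have "\<dots> \<in> free.span (power_relation L k ` mset ` ?S)"
    by (intro free.span_sum free.span_scale free.span_base) auto
  finally show ?thesis .
qed

lemma power_relation_homogeneous:
  "power_relation L k M \<in> homogeneous (\<Sum>w\<in>#M. length w)"
  unfolding power_relation_def
proof (rule free.subspace_sum[OF subspace_homogeneous])
  fix ws assume "ws \<in> {ws. ws \<in> word_sequences L k \<and> mset ws = M}"
  then have "(\<Sum>w\<in>#M. length w) = length (concat ws)"
    by (auto simp: length_concat simp flip: sum_mset_sum_list mset_map)
  then show "word (concat ws) \<in> homogeneous (\<Sum>w\<in>#M. length w)"
    using word_homogeneous[of "concat ws"] by simp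
qed

lemma degree_ge_of_word_sequence:
  assumes "M \<in> mset ` word_sequences L k" "[] \<notin> L"
  shows "k \<le> (\<Sum>w\<in>#M. length w)"
proof -
  obtain ws where ws: "set ws \<subseteq> L" "length ws = k" "M = mset ws"
    using assms(1) by (auto simp: word_sequences_def)
  have "length ws \<le> sum_list (map length ws)" using ws(1) assms(2)
    by (induction ws) (auto simp: Suc_le_eq intro: add_strict_increasing)
  then show ?thesis using ws by (simp flip: sum_mset_sum_list mset_map)
qed

text \<open>
  The number of relations grows only polynomially with the exponent \<open>k\<close>, because a monomial of degree \<open>k\<close>
  is determined by its exponents, which are at most \<open>k\<close>.
\<close>

lemma card_msets_of_word_sequences:
  assumes "finite L"
  shows "card (mset ` word_sequences L k) \<le> (k + 1) ^ card L"
proof -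
  let ?F = "L \<rightarrow>\<^sub>E {0..k}"
  have fin: "finite ?F" using assms by (intro finite_PiE) auto
  have "card (mset ` word_sequences L k) \<le> card ?F"
  proof (rule card_inj_on_le[OF _ _ fin])
    show "inj_on (\<lambda>M. restrict (count M) L) (mset ` word_sequences L k)"
    proof (rule inj_onI)
      fix M N assume M: "M \<in> mset ` word_sequences L k" and N: "N \<in> mset ` word_sequences L k"
        and eq: "restrict (count M) L = restrict (count N) L"
      have "count M w = count N w" for w
      proof (cases "w \<in> L")
        case True
        then show ?thesis using fun_cong[OF eq, of w] by simp
      next
        case False
        then have "w \<notin># M" "w \<notin># N" using M N by (auto simp: word_sequences_def)
        then show ?thesis by (simp add: not_in_iff)
      qed
      then show "M = N" by (rule multiset_eqI)
    qed
    show "(\<lambda>M. restrict (count M) L) ` mset ` word_sequences L k \<subseteq> ?F"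
      by (auto simp: word_sequences_def count_mset count_le_length)
  qed
  also have "\<dots> = (k + 1) ^ card L" using assms by (simp add: card_PiE)
  finally show ?thesis .
qed

lemma exponential_beats_polynomial: "\<exists>k. (k + 1) ^ m * 2 ^ N \<le> (2 :: nat) ^ k"
proof -
  \<comment> \<open>The witness is k = 2 ^ j - 1, which makes both sides powers of 2.\<close>
  define A where "A = real (m + N + 2)"
  have "(\<lambda>j. real j / 2 ^ j) \<longlonglongrightarrow> 0" using lim_n_over_pown[of "2 :: real"] by simp
  then have "eventually (\<lambda>j. real j / 2 ^ j < 1 / A) sequentially"
    by (rule order_tendstoD) (simp add: A_def)
  moreover have "eventually (\<lambda>j. j \<ge> 1) sequentially" by (rule eventually_ge_at_top)
  ultimately have "eventually (\<lambda>j. real j / 2 ^ j < 1 / A \<and> j \<ge> 1) sequentially"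
    by (rule eventually_conj)
  then obtain j where j: "real j / 2 ^ j < 1 / A" "j \<ge> 1"
    by (auto simp: eventually_sequentially)
  have "A > 0" by (simp add: A_def)
  with j have "real j * A < 2 ^ j" by (simp add: field_simps)
  then have "real (j * (m + N + 2)) < real (2 ^ j)" by (simp add: A_def algebra_simps)
  then have "j * (m + N + 2) < 2 ^ j" by (simp only: of_nat_less_iff)
  moreover have "j * m + N + 2 \<le> j * (m + N + 2)"
  proof -
    have "1 * (N + 2) \<le> j * (N + 2)" using j(2) by (rule mult_le_mono1)
    then show ?thesis by (simp add: algebra_simps)
  qed
  ultimately have le: "j * m + N \<le> 2 ^ j - 1" by linarith
  have "((2 ^ j - 1) + 1) ^ m * 2 ^ N = (2 :: nat) ^ (j * m + N)"
    by (simp add: power_add power_mult)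
  also have "\<dots> \<le> 2 ^ (2 ^ j - 1)" by (rule power_increasing[OF le]) simp
  finally show ?thesis by blast
qed

text \<open>
  A nil algebra of infinite dimension, in the form of a functional. For each \<open>N\<close> the powers with a
  common exponent \<open>k N\<close> of all elements supported on nonempty words of length at most \<open>N\<close> are made to
  vanish. This takes polynomially many relations, all of degree at least \<open>k N\<close>. For large \<open>k N\<close> they
  contribute at most \<open>2 ^ -(N + 2)\<close> to the sum bounded in the theorem of Golod and Shafarevich, and
  these contributions add up to at most \<open>1 / 2\<close>. Restricting \<open>\<phi>\<close> to words of length \<open>n\<close> expresses that
  it vanishes on each homogeneous component of the ideal.
\<close>

theorem nil_functional:
  assumes "CARD('x::finite) \<ge> 3"
  shows "\<exists>\<phi> :: 'x list \<Rightarrow> 'f::field. (\<forall>n. \<exists>w. length w = n \<and> \<phi> w = 1) \<and>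
    (\<forall>p. coef p [] = 0 \<longrightarrow> (\<exists>k. \<forall>s t n.
      linear_extension (\<lambda>w. if length w = n then \<phi> w else 0) (word s * p ^ k * word t) = 0))"
proof -
  define L where "L N = {w :: 'x list. set w \<subseteq> UNIV \<and> length w \<le> N} - {[]}" for N
  have finL: "finite (L N)" for N
    unfolding L_def using finite_lists_length_le[of "UNIV :: 'x set" N] by auto
  have "\<forall>N. \<exists>k. (k + 1) ^ card (L N) * 2 ^ (N + 2) \<le> (2 :: nat) ^ k"
    by (intro allI exponential_beats_polynomial)
  then obtain k where k: "\<And>N. (k N + 1) ^ card (L N) * 2 ^ (N + 2) \<le> (2 :: nat) ^ k N"
    by (metis (no_types))
  have kN: "N + 2 \<le> k N" for N
  proof -
    have "(2 :: nat) ^ (N + 2) \<le> 1 * 2 ^ (N + 2)" by simp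
    also have "\<dots> \<le> (k N + 1) ^ card (L N) * 2 ^ (N + 2)" by (intro mult_right_mono) simp_all
    also have "\<dots> \<le> 2 ^ k N" by (rule k)
    finally show ?thesis by (simp only: power_increasing_iff one_less_numeral_iff semiring_norm)
  qed
  define Ms where "Ms N = mset ` word_sequences (L N) (k N)" for N
  define deg where "deg M = (\<Sum>w\<in>#M. length w)" for M :: "'x list multiset"
  have finMs: "finite (Ms N)" for N by (simp add: Ms_def finite_word_sequences finL)
  have degMs: "k N \<le> deg M" if "M \<in> Ms N" for N M
    using degree_ge_of_word_sequence[of M "L N" "k N"] that by (auto simp: Ms_def deg_def L_def)
  \<comment> \<open>Only N < i can contribute in degree i, because k N > N; this makes each Rel i finite.\<close>
  define Rel :: "nat \<Rightarrow> ('x, 'f) free_algebra set"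
    where "Rel i = (\<Union>N<i. power_relation (L N) (k N) ` {M \<in> Ms N. deg M = i})" for i
  have Rel: "Rel i \<subseteq> homogeneous i" "finite (Rel i)" "Rel 0 = {}" for i
    using power_relation_homogeneous finMs by (auto simp: Rel_def deg_def)
  have inRel: "power_relation (L N) (k N) M \<in> Rel (deg M)" if "M \<in> Ms N" for N M
  proof -
    have "N < deg M" using degMs[OF that] kN[of N] by simp
    then show ?thesis using that by (auto simp: Rel_def)
  qed
  have few: "(\<Sum>i=1..n. real (card (Rel i)) / 2 ^ i) \<le> 1 / 2" for n
  proof -
    have "(\<Sum>i=1..n. real (card (Rel i)) / 2 ^ i)
        \<le> (\<Sum>i=1..n. \<Sum>N<n. real (card {M \<in> Ms N. deg M = i}) / 2 ^ k N)"
    proof (rule sum_mono)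
      fix i assume i: "i \<in> {1..n}"
      have "card (Rel i) \<le> (\<Sum>N<i. card (power_relation (L N) (k N) ` {M \<in> Ms N. deg M = i} :: ('x, 'f) free_algebra set))"
        unfolding Rel_def by (rule card_UN_le) simp
      also have "\<dots> \<le> (\<Sum>N<i. card {M \<in> Ms N. deg M = i})"
        using finMs by (intro sum_mono card_image_le) auto
      also have "\<dots> \<le> (\<Sum>N<n. card {M \<in> Ms N. deg M = i})"
        using i by (intro sum_mono2) auto
      finally have "real (card (Rel i)) \<le> real (\<Sum>N<n. card {M \<in> Ms N. deg M = i})"
        by (rule of_nat_mono)
      then have "real (card (Rel i)) / 2 ^ i \<le> real (\<Sum>N<n. card {M \<in> Ms N. deg M = i}) / 2 ^ i"
        by (rule divide_right_mono) simp
      also have "\<dots> = (\<Sum>N<n. real (card {M \<in> Ms N. deg M = i}) / 2 ^ i)"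
        by (simp add: sum_divide_distrib)
      also have "\<dots> \<le> (\<Sum>N<n. real (card {M \<in> Ms N. deg M = i}) / 2 ^ k N)"
      proof (rule sum_mono)
        fix N
        show "real (card {M \<in> Ms N. deg M = i}) / 2 ^ i \<le> real (card {M \<in> Ms N. deg M = i}) / 2 ^ k N"
        proof (cases "{M \<in> Ms N. deg M = i} = {}")
          case False
          then have "k N \<le> i" using degMs[of _ N] by auto
          then have "(2 :: real) ^ k N \<le> 2 ^ i" by (intro power_increasing) auto
          then show ?thesis by (intro divide_left_mono) auto
        qed (simp only: card.empty)
      qed
      finally show "real (card (Rel i)) / 2 ^ i
          \<le> (\<Sum>N<n. real (card {M \<in> Ms N. deg M = i}) / 2 ^ k N)" .
    qed
    also have "\<dots> = (\<Sum>N<n. real (\<Sum>i=1..n. card {M \<in> Ms N. deg M = i}) / 2 ^ k N)"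
      by (subst sum.swap) (simp add: sum_divide_distrib)
    also have "\<dots> \<le> (\<Sum>N<n. (1 / 2) ^ (N + 2))"
    proof (rule sum_mono)
      fix N
      have "(\<Sum>i=1..n. card {M \<in> Ms N. deg M = i}) = card (\<Union>i\<in>{1..n}. {M \<in> Ms N. deg M = i})"
        using finMs by (intro card_UN_disjoint[symmetric]) auto
      also have "\<dots> \<le> card (Ms N)" using finMs by (intro card_mono) auto
      also have "\<dots> \<le> (k N + 1) ^ card (L N)"
        unfolding Ms_def by (rule card_msets_of_word_sequences[OF finL])
      finally have "(\<Sum>i=1..n. card {M \<in> Ms N. deg M = i}) * 2 ^ (N + 2) \<le> 2 ^ k N"
        using k[of N] by (meson mult_le_mono1 order_trans)
      then have "real ((\<Sum>i=1..n. card {M \<in> Ms N. deg M = i}) * 2 ^ (N + 2)) \<le> real (2 ^ k N)"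
        by (rule of_nat_mono)
      then show "real (\<Sum>i=1..n. card {M \<in> Ms N. deg M = i}) / 2 ^ k N \<le> (1 / 2) ^ (N + 2)"
        by (simp add: field_simps power_one_over)
    qed
    also have "\<dots> \<le> 1 / 2"
    proof -
      have "(\<Sum>N<n. (1 / 2 :: real) ^ (N + 2)) = 1 / 2 - (1 / 2) ^ (n + 1)"
        by (induction n) (simp_all add: field_simps)
      then show ?thesis by simp
    qed
    finally show ?thesis .
  qed
  obtain \<phi> :: "'x list \<Rightarrow> 'f" where \<phi>: "\<And>n. \<exists>w. length w = n \<and> \<phi> w = 1"
    and \<phi>0: "\<And>n p. p \<in> rel_ideal Rel n \<Longrightarrow> linear_extension \<phi> p = 0"
    using functional_vanishing_on_rel_ideal[of Rel, OF Rel assms few] by blast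
  let ?\<phi> = "\<lambda>n w. if length w = n then \<phi> w else 0"
  have \<phi>n: "linear_extension (?\<phi> n) p = 0" if "p \<in> rel_ideal Rel m" for p n m
  proof -
    have "supp p \<subseteq> {w. length w = m}"
      using that rel_ideal_homogeneous[of Rel, OF Rel] by (auto simp: homogeneous_def)
    then have "linear_extension (?\<phi> n) p = (if n = m then linear_extension \<phi> p else 0)"
      unfolding linear_extension_def by (auto intro!: sum.cong sum.neutral)
    then show ?thesis using \<phi>0[OF that] by simp
  qed
  have "\<exists>k. \<forall>s t n. linear_extension (?\<phi> n) (word s * p ^ k * word t) = 0" if p: "coef p [] = 0" for p :: "('x, 'f) free_algebra"
  proof -
    define N where "N = Max (insert 0 (length ` supp p))"
    have pL: "supp p \<subseteq> L N"
    proof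
      fix w assume w: "w \<in> supp p"
      then have "length w \<le> N" unfolding N_def by (intro Max_ge) auto
      moreover have "w \<noteq> []" using w p by (auto simp: in_keys_iff)
      ultimately show "w \<in> L N" by (simp add: L_def)
    qed
    have "linear_extension (?\<phi> n) (word s * p ^ k N * word t) = 0" for s t n
    proof (rule linear_extension_zero_on_span)
      show "word s * p ^ k N * word t \<in> free.span (\<Union>m. rel_ideal Rel m)"
      proof (rule span_mult[OF power_in_span_power_relations[OF finL pL]])
        fix r :: "('x, 'f) free_algebra" assume "r \<in> power_relation (L N) (k N) ` mset ` word_sequences (L N) (k N)"
        then obtain M where M: "M \<in> Ms N" "r = power_relation (L N) (k N) M"
          by (auto simp: Ms_def)
        have "word s * r * word t \<in> relators Rel (length s + deg M + length t)"
          unfolding relators_def[of Rel, OF Rel] using inRel[OF M(1)] M(2) by blast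
        then have "word s * r * word t \<in> rel_ideal Rel (length s + deg M + length t)"
          unfolding rel_ideal_def[of Rel, OF Rel] by (rule free.span_base)
        then show "word s * r * word t \<in> free.span (\<Union>m. rel_ideal Rel m)"
          by (intro free.span_base) blast
      qed
    qed (use \<phi>n in blast)
    then show ?thesis by blast
  qed
  with \<phi> show ?thesis by blast
qed

section \<open>A nil quotient with an infinite family of diagonal relations\<close>

definition two_sided_ideal :: "'r::ring_1 set \<Rightarrow> bool"
  where "two_sided_ideal I \<longleftrightarrow> 0 \<in> I \<and> (\<forall>a\<in>I. \<forall>b\<in>I. a + b \<in> I) \<and>
    (\<forall>a\<in>I. \<forall>r. r * a \<in> I \<and> a * r \<in> I)"

lemma two_sided_idealD:
  assumes "two_sided_ideal I"
  shows "0 \<in> I" "a \<in> I \<Longrightarrow> b \<in> I \<Longrightarrow> a + b \<in> I" "a \<in> I \<Longrightarrow> r * a \<in> I" "a \<in> I \<Longrightarrow> a * r \<in> I"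
    "a \<in> I \<Longrightarrow> - a \<in> I" "a \<in> I \<Longrightarrow> b \<in> I \<Longrightarrow> a - b \<in> I"
proof -
  show 1: "0 \<in> I" "a \<in> I \<Longrightarrow> b \<in> I \<Longrightarrow> a + b \<in> I" "a \<in> I \<Longrightarrow> r * a \<in> I" "a \<in> I \<Longrightarrow> a * r \<in> I" for a b r
    using assms by (auto simp: two_sided_ideal_def)
  show 2: "- a \<in> I" if "a \<in> I" for a using 1(3)[OF that, of "- 1"] by simp
  show "a \<in> I \<Longrightarrow> b \<in> I \<Longrightarrow> a - b \<in> I" using 1(2)[of a "- b"] 2[of b] by simp
qed

lemma two_sided_ideal_power_cong:
  fixes p q :: "'r::ring_1"
  assumes I: "two_sided_ideal I" and pq: "p - q \<in> I"
  shows "p ^ n - q ^ n \<in> I"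
proof (induction n)
  case 0
  then show ?case using two_sided_idealD(1)[OF I] by simp
next
  case (Suc n)
  have "p ^ Suc n - q ^ Suc n = (p - q) * p ^ n + q * (p ^ n - q ^ n)" by (simp add: algebra_simps)
  then show ?case using two_sided_idealD(2-4)[OF I] Suc pq by metis
qed

text \<open>
  The letter \<^const>\<open>None\<close> serves as a marker; the blocks are the unmarked words between the markers.
\<close>

fun blocks :: "'x option list \<Rightarrow> 'x list list"
  where
    "blocks [] = [[]]"
  | "blocks (None # z) = [] # blocks z"
  | "blocks (Some a # z) = (a # hd (blocks z)) # tl (blocks z)"

lemma blocks_nonempty [simp]: "blocks z \<noteq> []"
  by (induction z rule: blocks.induct) auto

lemma length_blocks: "length (blocks z) = Suc (count_list z None)"
  by (induction z rule: blocks.induct) auto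

lemma blocks_append:
  "blocks (s @ t) = butlast (blocks s) @ (last (blocks s) @ hd (blocks t)) # tl (blocks t)"
proof (induction s rule: blocks.induct)
  case (3 a z)
  then show ?case by (cases "blocks z") auto
qed auto

lemma blocks_map_Some: "blocks (map Some w) = [w]"
  by (induction w) auto

lemma blocks_insert:
  "blocks (s @ map Some w @ t)
    = butlast (blocks s) @ (last (blocks s) @ w @ hd (blocks t)) # tl (blocks t)"
  by (simp add: blocks_append[of s] blocks_append[of "map Some w"] blocks_map_Some)

definition sandwich :: "'x list \<Rightarrow> 'x list \<Rightarrow> 'x option list"
  where "sandwich x y = None # map Some x @ None # map Some y @ [None]"

lemma blocks_sandwich: "blocks (sandwich x y) = [[], x, y, []]"
proof -
  have 1: "blocks (map Some y @ [None]) = [y, []]"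
    using blocks_append[of "map Some y" "[None]"] by (simp add: blocks_map_Some)
  have "blocks (map Some x @ None # map Some y @ [None]) = [x, y, []]"
    using blocks_append[of "map Some x" "None # map Some y @ [None]"]
    by (simp add: blocks_map_Some 1)
  then show ?thesis by (simp add: sandwich_def)
qed

lemma linear_extension_word_mult:
  "linear_extension f (word s * p * word t) = (\<Sum>w\<in>supp p. coef p w * f (s @ w @ t))"
proof -
  have "word s * p * word t = (\<Sum>w\<in>supp p. scl (coef p w) (word (s @ w @ t)))"
    by (subst free_algebra_expansion_word[of p])
      (simp add: sum_distrib_left sum_distrib_right mult_scl_left mult_scl_right word_append mult.assoc)
  then show ?thesis by (simp add: linear_extension_sum linear_extension_scl)
qed

text \<open>
  A filtration by powers of the ideal generated by the marker.
\<close>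

definition markers_ge :: "nat \<Rightarrow> ('x option, 'f::field) free_algebra set"
  where "markers_ge j = {p. \<forall>w\<in>supp p. j \<le> count_list w None}"

lemma markers_ge_mult: "p \<in> markers_ge i \<Longrightarrow> q \<in> markers_ge j \<Longrightarrow> p * q \<in> markers_ge (i + j)"
  using keys_mult[of p q] by (fastforce simp: markers_ge_def plus_list_def intro: add_mono)

lemma markers_ge_power: "p \<in> markers_ge 1 \<Longrightarrow> p ^ n \<in> markers_ge n"
proof (induction n)
  case 0
  then show ?case by (simp add: markers_ge_def)
next
  case (Suc n)
  then show ?case using markers_ge_mult[of p 1 "p ^ n" n] by simp
qed

text \<open>
  The homomorphism of free algebras that sends the marker to zero.
\<close>

definition unmark :: "('x option, 'f::field) free_algebra \<Rightarrow> ('x, 'f) free_algebra"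
  where "unmark p = Poly_Mapping.map_key (map Some) p"

lemma coef_unmark: "coef (unmark p) w = coef p (map Some w)"
  unfolding unmark_def by (simp add: Poly_Mapping.map_key.rep_eq)

lemma unmark_add: "unmark (p + q) = unmark p + unmark q"
  by (rule poly_mapping_eqI) (simp add: coef_unmark lookup_add)

lemma unmark_single:
  "unmark (Poly_Mapping.single z c) = (if None \<in> set z then 0 else Poly_Mapping.single (map the z) c)"
proof (rule poly_mapping_eqI)
  fix w
  have "z = map Some w \<longleftrightarrow> None \<notin> set z \<and> map the z = w"
    by (auto simp: map_idI comp_def) (metis map_idI option.collapse)
  then show "coef (unmark (Poly_Mapping.single z c)) w
      = coef (if None \<in> set z then 0 else Poly_Mapping.single (map the z) c) w"
    by (auto simp: coef_unmark lookup_single when_def)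
qed

lemma unmark_mult: "unmark (p * q) = unmark p * unmark q"
proof (induction p rule: free_algebra_induct)
  case (single v c)
  show ?case
    by (induction q rule: free_algebra_induct)
      (simp_all add: single_mult_single unmark_single unmark_add distrib_left)
qed (simp add: distrib_right unmark_add)

lemma unmark_power: "unmark (p ^ k) = unmark p ^ k"
proof (induction k)
  case 0
  have "unmark (word []) = word []" by (simp add: unmark_single)
  then show ?case by (simp add: word_Nil)
qed (simp add: unmark_mult)

context
  fixes \<phi> :: "'x list \<Rightarrow> 'f::field"
begin

text \<open>
  With \<open>m\<close> for the marker, the word \<open>m x m y m\<close> has weight \<open>\<phi> x \<phi> y\<close> if \<open>x\<close> and \<open>y\<close> have equal length;
  all other words have weight zero.
\<close>

definition sandwich_weight :: "'x option list \<Rightarrow> 'f"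
  where "sandwich_weight z = (case blocks z of
      [u, x, y, v] \<Rightarrow> if u = [] \<and> v = [] \<and> length x = length y then \<phi> x * \<phi> y else 0
    | _ \<Rightarrow> 0)"

lemma sandwich_weight_eq_0: "length (blocks z) \<noteq> 4 \<Longrightarrow> sandwich_weight z = 0"
  by (auto simp: sandwich_weight_def split: list.split)

text \<open>
  The largest two-sided ideal on which the weight functional vanishes.
\<close>

definition sandwich_ideal :: "('x option, 'f) free_algebra set"
  where "sandwich_ideal = {p. \<forall>s t. linear_extension sandwich_weight (word s * p * word t) = 0}"

lemma two_sided_ideal_sandwich_ideal: "two_sided_ideal sandwich_ideal"
  unfolding two_sided_ideal_def
proof (intro conjI ballI allI)
  show "0 \<in> sandwich_ideal" by (simp add: sandwich_ideal_def)
  show "p + q \<in> sandwich_ideal" if "p \<in> sandwich_ideal" "q \<in> sandwich_ideal" for p q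
    using that by (simp add: sandwich_ideal_def distrib_left distrib_right linear_extension_add)
  fix p r :: "('x option, 'f) free_algebra" assume p: "p \<in> sandwich_ideal"
  show "r * p \<in> sandwich_ideal"
  proof (induction r rule: free_algebra_induct)
    case (single w c)
    have "word s * (scl c (word w) * p) * word t = scl c (word (s @ w) * p * word t)" for s t
      by (simp add: mult_scl_left mult_scl_right word_append mult.assoc)
    then have "scl c (word w) * p \<in> sandwich_ideal" using p by (simp add: sandwich_ideal_def linear_extension_scl)
    then show ?case by (simp add: scl_single)
  qed (simp add: sandwich_ideal_def distrib_left distrib_right linear_extension_add)
  show "p * r \<in> sandwich_ideal"
  proof (induction r rule: free_algebra_induct)
    case (single w c)
    have "word s * (p * scl c (word w)) * word t = scl c (word s * p * word (w @ t))" for s t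
      by (simp add: mult_scl_left mult_scl_right word_append mult.assoc)
    then have "p * scl c (word w) \<in> sandwich_ideal" using p by (simp add: sandwich_ideal_def linear_extension_scl)
    then show ?case by (simp add: scl_single)
  qed (simp add: sandwich_ideal_def distrib_left distrib_right linear_extension_add)
qed

lemma markers_ge_4_subset: "markers_ge 4 \<subseteq> sandwich_ideal"
proof
  fix p :: "('x option, 'f) free_algebra" assume p: "p \<in> markers_ge 4"
  have "sandwich_weight (s @ w @ t) = 0" if "w \<in> supp p" for s w t
  proof -
    have "length (blocks (s @ w @ t)) \<ge> 5"
      using p that by (auto simp: length_blocks markers_ge_def)
    then show ?thesis by (intro sandwich_weight_eq_0) simp
  qed
  then show "p \<in> sandwich_ideal" by (simp add: sandwich_ideal_def linear_extension_word_mult)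
qed

text \<open>
  Inserting unmarked words \<open>w\<close> between \<open>s\<close> and \<open>t\<close> changes a single block, from \<open>l h\<close> to \<open>l w h\<close>. A
  weight can be nonzero only if this block is one of the two inner ones, since the outer blocks of a
  weighted word are empty. Then the weight is a fixed multiple of the value of \<open>\<phi>\<close> on \<open>l w h\<close>,
  restricted to the length of the other inner block, and the sum over \<open>w\<close> vanishes by assumption.
\<close>

lemma unmarked_part_in_sandwich_ideal:
  fixes q :: "('x, 'f) free_algebra"
  assumes \<phi>0: "\<phi> [] = 1"
    and q: "\<And>s t n. linear_extension (\<lambda>w. if length w = n then \<phi> w else 0) (word s * q * word t) = 0"
  shows "(\<Sum>w\<in>supp q. Poly_Mapping.single (map Some w) (coef q w)) \<in> sandwich_ideal"
  unfolding sandwich_ideal_def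
proof (intro CollectI allI)
  fix s t :: "'x option list"
  have q': "(\<Sum>w\<in>supp q. coef q w * (if length (l @ w @ h) = n then \<phi> (l @ w @ h) else 0)) = 0"
    for l h n
    using q[of n l h] unfolding linear_extension_word_mult .
  \<comment> \<open>The case l = h = [], n = 0 of the assumption says that q has no constant term.\<close>
  have "coef q [] = (\<Sum>w\<in>supp q. if w = [] then coef q w else 0)"
    by (auto simp: in_keys_iff)
  also have "\<dots> = (\<Sum>w\<in>supp q. coef q w * (if length ([] @ w @ []) = 0 then \<phi> ([] @ w @ []) else 0))"
    by (intro sum.cong) (auto simp: \<phi>0)
  finally have nil: "w \<noteq> []" if "w \<in> supp q" for w
    using that q'[of "[]" "[]" 0] by (auto simp: in_keys_iff)
  let ?g = "\<lambda>w. sandwich_weight (s @ map Some w @ t)"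
  define a l h b where "a = butlast (blocks s)" and "l = last (blocks s)"
    and "h = hd (blocks t)" and "b = tl (blocks t)"
  have bl: "blocks (s @ map Some w @ t) = a @ (l @ w @ h) # b" for w
    by (simp add: blocks_insert a_def l_def h_def b_def)
  have "(\<Sum>w\<in>supp q. coef q w * ?g w) = 0"
  proof -
    consider "length a + length b \<noteq> 3" | "a = []" | "b = []" | u y v where "a = [u]" "b = [y, v]"
      | u x v where "a = [u, x]" "b = [v]"
    proof -
      assume *: "length a + length b \<noteq> 3 \<Longrightarrow> thesis" "a = [] \<Longrightarrow> thesis" "b = [] \<Longrightarrow> thesis"
        "\<And>u y v. a = [u] \<Longrightarrow> b = [y, v] \<Longrightarrow> thesis" "\<And>u x v. a = [u, x] \<Longrightarrow> b = [v] \<Longrightarrow> thesis"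
      show thesis
      proof (cases "length a + length b = 3 \<and> a \<noteq> [] \<and> b \<noteq> []")
        case True
        then have "length a + length b = 3" "length a \<noteq> 0" "length b \<noteq> 0" by auto
        then have "length a = 1 \<and> length b = 2 \<or> length a = 2 \<and> length b = 1" by arith
        then show thesis using *(4,5) by (auto simp: length_Suc_conv numeral_2_eq_2)
      qed (use *(1-3) in blast)
    qed
    then show ?thesis
    proof cases
      case 1
      then have "length (blocks (s @ map Some w @ t)) \<noteq> 4" for w by (simp add: bl)
      then have "?g w = 0" for w by (rule sandwich_weight_eq_0)
      then show ?thesis by simp
    next
      case 2
      have "?g w = 0" if "w \<in> supp q" for w
        using nil[OF that] unfolding sandwich_weight_def bl 2 by (auto split: list.split)
      then show ?thesis by simp
    next
      case 3
      have "?g w = 0" if "w \<in> supp q" for w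
      proof -
        have "blocks (s @ map Some w @ t) \<noteq> [u, x, y, []]" for u x y
        proof
          assume "blocks (s @ map Some w @ t) = [u, x, y, []]"
          then have "last (a @ [l @ w @ h]) = last [u, x, y, []]" by (simp add: bl 3)
          then show False using nil[OF that] by simp
        qed
        then show ?thesis unfolding sandwich_weight_def by (auto split: list.split)
      qed
      then show ?thesis by simp
    next
      case 4
      have "(\<Sum>w\<in>supp q. coef q w * ?g w) = (if u = [] \<and> v = [] then \<phi> y else 0) *
          (\<Sum>w\<in>supp q. coef q w * (if length (l @ w @ h) = length y then \<phi> (l @ w @ h) else 0))"
        unfolding sum_distrib_left sandwich_weight_def bl 4 by (intro sum.cong) auto
      then show ?thesis using q'[where n = "length y"] by simp
    next
      case 5
      have "(\<Sum>w\<in>supp q. coef q w * ?g w) = (if u = [] \<and> v = [] then \<phi> x else 0) *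
          (\<Sum>w\<in>supp q. coef q w * (if length (l @ w @ h) = length x then \<phi> (l @ w @ h) else 0))"
        unfolding sum_distrib_left sandwich_weight_def bl 5 by (intro sum.cong) auto
      then show ?thesis using q'[where n = "length x"] by simp
    qed
  qed
  moreover have "word s * (\<Sum>w\<in>supp q. Poly_Mapping.single (map Some w) (coef q w)) * word t
      = (\<Sum>w\<in>supp q. Poly_Mapping.single (s @ map Some w @ t) (coef q w))"
    by (simp add: sum_distrib_left sum_distrib_right single_mult_single)
  ultimately show "linear_extension sandwich_weight
      (word s * (\<Sum>w\<in>supp q. Poly_Mapping.single (map Some w) (coef q w)) * word t) = 0"
    by (simp add: linear_extension_sum)
qed

text \<open>
  For suitable \<open>k\<close>, the part \<open>q1\<close> of \<open>p ^ k\<close> without markers lies in the ideal, as it is the \<open>k\<close>-th power of the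
  unmarked part of \<open>p\<close>. Modulo the ideal, \<open>p ^ k\<close> is therefore a combination of words with a marker,
  and its fourth power is a combination of words with four markers, all of whose multiples have
  weight zero.
\<close>

lemma nil_modulo_sandwich_ideal:
  assumes \<phi>0: "\<phi> [] = 1"
    and nil: "\<And>p :: ('x, 'f) free_algebra. coef p [] = 0 \<Longrightarrow> \<exists>k. \<forall>s t n.
      linear_extension (\<lambda>w. if length w = n then \<phi> w else 0) (word s * p ^ k * word t) = 0"
    and p: "coef p [] = 0"
  shows "\<exists>n. p ^ n \<in> sandwich_ideal"
proof -
  have "coef (unmark p) [] = 0" using p by (simp add: coef_unmark)
  then obtain k where k: "\<And>s t n.
      linear_extension (\<lambda>w. if length w = n then \<phi> w else 0) (word s * unmark p ^ k * word t) = 0"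
    using nil[of "unmark p"] by blast
  define q where "q = unmark p ^ k"
  define q1 where "q1 = (\<Sum>w\<in>supp q. Poly_Mapping.single (map Some w) (coef q w))"
  have q1: "q1 \<in> sandwich_ideal"
    unfolding q1_def by (rule unmarked_part_in_sandwich_ideal[OF \<phi>0]) (simp add: q_def k)
  have coef_q1: "coef q1 (map Some w) = coef q w" for w
  proof -
    have "coef q1 (map Some w) = (\<Sum>v\<in>supp q. if v = w then coef q v else 0)"
      unfolding q1_def lookup_sum by (intro sum.cong) (auto simp: lookup_single when_def inj_map_eq_map)
    also have "\<dots> = coef q w" by (auto simp: in_keys_iff)
    finally show ?thesis .
  qed
  have "p ^ k - q1 \<in> markers_ge 1"
    unfolding markers_ge_def
  proof (intro CollectI ballI)
    fix z assume z: "z \<in> supp (p ^ k - q1)"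
    have "None \<in> set z"
    proof (rule ccontr)
      assume "None \<notin> set z"
      then have "z = map Some (map the z)" by (auto simp: map_idI comp_def) (metis map_idI option.collapse)
      then obtain w where w: "z = map Some w" by blast
      have "coef (p ^ k - q1) z = coef (unmark (p ^ k)) w - coef q w"
        by (simp add: w lookup_minus coef_q1 coef_unmark)
      then show False using z by (simp add: unmark_power q_def in_keys_iff)
    qed
    then show "1 \<le> count_list z None" by (simp add: Suc_le_eq count_list_0_iff flip: neq0_conv)
  qed
  then have "(p ^ k - q1) ^ 4 \<in> sandwich_ideal"
    using markers_ge_power[of "p ^ k - q1" 4] markers_ge_4_subset by blast
  moreover have "(p ^ k) ^ 4 - (p ^ k - q1) ^ 4 \<in> sandwich_ideal"
    by (rule two_sided_ideal_power_cong[OF two_sided_ideal_sandwich_ideal]) (simp add: q1)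
  ultimately have "((p ^ k) ^ 4 - (p ^ k - q1) ^ 4) + (p ^ k - q1) ^ 4 \<in> sandwich_ideal"
    by (intro two_sided_idealD(2)[OF two_sided_ideal_sandwich_ideal])
  then have "p ^ (k * 4) \<in> sandwich_ideal" by (simp add: power_mult)
  then show ?thesis by blast
qed

lemma sandwich_weight_around_sandwich:
  "sandwich_weight (s @ sandwich x y @ t)
    = (if s = [] \<and> t = [] \<and> length x = length y then \<phi> x * \<phi> y else 0)"
proof (cases "s = [] \<and> t = []")
  case True
  then show ?thesis by (simp add: sandwich_weight_def blocks_sandwich)
next
  case False
  have b: "blocks (s @ sandwich x y @ t)
      = butlast (blocks s) @ last (blocks s) # x # y # hd (blocks t) # tl (blocks t)"
    by (simp add: blocks_append[of s] blocks_append[of "sandwich x y"] blocks_sandwich)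
  have e: "z = []" if "blocks z = [[]]" for z :: "'x option list"
    using that by (cases z rule: blocks.cases) auto
  have "sandwich_weight (s @ sandwich x y @ t) = 0"
  proof (cases "butlast (blocks s) = [] \<and> tl (blocks t) = []")
    case True
    then have "blocks s = [last (blocks s)]" "blocks t = [hd (blocks t)]"
      by (metis append_butlast_last_id append_Nil blocks_nonempty) (metis True list.collapse blocks_nonempty)
    then have "last (blocks s) \<noteq> [] \<or> hd (blocks t) \<noteq> []" using False e by metis
    then show ?thesis unfolding sandwich_weight_def b using True by auto
  next
    case F: False
    have "length (blocks (s @ sandwich x y @ t))
        = length (butlast (blocks s)) + length (tl (blocks t)) + 4"
      using arg_cong[OF list.collapse[OF blocks_nonempty[of t]], of length]
      by (simp add: b del: length_butlast length_tl list.collapse)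
    with F have "length (blocks (s @ sandwich x y @ t)) \<noteq> 4"
      by (auto simp del: length_butlast length_tl)
    then show ?thesis by (rule sandwich_weight_eq_0)
  qed
  with False show ?thesis by auto
qed

text \<open>
  Any multiplication of a word \<open>m x m y m\<close> with nonempty words destroys its shape. So modulo the ideal such
  a word only depends on its own weight.
\<close>

lemma sandwiches_modulo_sandwich_ideal:
  assumes w: "\<And>n. length (w n) = n" "\<And>n. \<phi> (w n) = 1"
  shows "i \<noteq> j \<Longrightarrow> word (sandwich (w i) (w j)) \<in> sandwich_ideal"
    and "word (sandwich (w i) (w i)) - word (sandwich (w j) (w j)) \<in> sandwich_ideal"
    and "word (sandwich (w i) (w i)) \<notin> sandwich_ideal"
proof -
  have *: "linear_extension sandwich_weight (word s * word (sandwich (w i) (w j)) * word t)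
      = (if s = [] \<and> t = [] \<and> i = j then 1 else 0)" for s t i j
    by (simp add: single_mult_single sandwich_weight_around_sandwich w)
  show "i \<noteq> j \<Longrightarrow> word (sandwich (w i) (w j)) \<in> sandwich_ideal"
    unfolding sandwich_ideal_def mem_Collect_eq * by simp
  show "word (sandwich (w i) (w i)) - word (sandwich (w j) (w j)) \<in> sandwich_ideal"
    unfolding sandwich_ideal_def mem_Collect_eq right_diff_distrib left_diff_distrib linear_extension_diff * by simp
  show "word (sandwich (w i) (w i)) \<notin> sandwich_ideal"
    unfolding sandwich_ideal_def mem_Collect_eq * by auto
qed

end

text \<open>
  With the marker \<open>m\<close> and words \<open>w\<^sub>i\<close> of length \<open>i\<close> such that \<open>\<phi> w\<^sub>i = 1\<close>, take \<open>x\<^sub>i = m w\<^sub>i\<close>, \<open>b = m\<close> and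
  \<open>y\<^sub>j = w\<^sub>j m\<close>. Words of different lengths give products of weight zero.
\<close>

theorem nil_quotient_with_diagonal_relations:
  assumes "CARD('x::finite) \<ge> 3"
  shows "\<exists>(I :: ('x option, 'f::field) free_algebra set) x y b a.
    two_sided_ideal I \<and> (\<forall>p. coef p [] = 0 \<longrightarrow> (\<exists>n. p ^ n \<in> I)) \<and>
    (\<forall>i. coef (x i) [] = 0 \<and> coef (y i) [] = 0) \<and> coef b [] = 0 \<and> coef a [] = 0 \<and> a \<notin> I \<and>
    (\<forall>i j :: nat. x i * (b * y j) - (if i = j then a else 0) \<in> I)"
proof -
  obtain \<phi> :: "'x list \<Rightarrow> 'f" where \<phi>1: "\<And>n. \<exists>w. length w = n \<and> \<phi> w = 1"
    and nil: "\<And>p :: ('x, 'f) free_algebra. coef p [] = 0 \<Longrightarrow> \<exists>k. \<forall>s t n.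
      linear_extension (\<lambda>w. if length w = n then \<phi> w else 0) (word s * p ^ k * word t) = 0"
    using nil_functional[OF assms, where 'f = 'f] by blast
  obtain w where w: "\<And>n. length (w n) = n" "\<And>n. \<phi> (w n) = 1" using \<phi>1 by metis
  have \<phi>0: "\<phi> [] = 1" using w[of 0] by simp
  define x :: "nat \<Rightarrow> ('x option, 'f) free_algebra" where "x i = word (None # map Some (w i))" for i
  define y :: "nat \<Rightarrow> ('x option, 'f) free_algebra" where "y i = word (map Some (w i) @ [None])" for i
  define b :: "('x option, 'f) free_algebra" where "b = word [None]"
  define a :: "('x option, 'f) free_algebra" where "a = word (sandwich (w 0) (w 0))"
  have xby: "x i * (b * y j) = word (sandwich (w i) (w j))" for i j
    by (simp add: x_def y_def b_def sandwich_def single_mult_single)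
  have rel: "x i * (b * y j) - (if i = j then a else 0) \<in> sandwich_ideal \<phi>" for i j
    unfolding xby a_def using sandwiches_modulo_sandwich_ideal[of w \<phi>, OF w] by simp
  have "a \<notin> sandwich_ideal \<phi>"
    unfolding a_def by (rule sandwiches_modulo_sandwich_ideal[of w \<phi>, OF w])
  moreover have "\<exists>n. p ^ n \<in> sandwich_ideal \<phi>" if "coef p [] = 0" for p
    by (rule nil_modulo_sandwich_ideal[where \<phi> = \<phi>]) (fact \<phi>0 nil that)+
  moreover have "coef (x i) [] = 0" "coef (y i) [] = 0" "coef b [] = 0" "coef a [] = 0" for i
    by (simp_all add: x_def y_def b_def a_def sandwich_def lookup_single)
  ultimately show ?thesis using rel two_sided_ideal_sandwich_ideal[of \<phi>] by blast
qed

section \<open>Quotients of the augmentation ideal as algebras\<close>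

lemma coef_mult_Nil: "coef (p * q) [] = coef p [] * (coef q [] :: 'f::field)"
proof (induction p rule: free_algebra_induct)
  case (single v c)
  show ?case
    by (induction q rule: free_algebra_induct)
      (auto simp: single_mult_single lookup_single when_def distrib_left lookup_add)
qed (simp add: distrib_right lookup_add)

text \<open>
  The geometric series: if \<open>p ^ Suc n\<close> vanishes, then \<open>- (p + \<dots> + p ^ n)\<close> is a quasi-inverse of \<open>p\<close>.
\<close>

lemma sum_powers_quasi_inverse:
  fixes p :: "'r::ring_1"
  shows "p * (\<Sum>i<n. p ^ Suc i) = (\<Sum>i<n. p ^ Suc i) * p"
    and "p * (\<Sum>i<n. p ^ Suc i) - (\<Sum>i<n. p ^ Suc i) = p ^ Suc n - p"
proof -
  show "p * (\<Sum>i<n. p ^ Suc i) = (\<Sum>i<n. p ^ Suc i) * p"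
    by (simp only: sum_distrib_left sum_distrib_right power_commutes flip: power_Suc2)
  show "p * (\<Sum>i<n. p ^ Suc i) - (\<Sum>i<n. p ^ Suc i) = p ^ Suc n - p"
    by (induction n) (simp_all add: algebra_simps)
qed

context
  fixes I :: "('y::finite, 'f::field) free_algebra set" and dec :: "nat \<Rightarrow> 'y"
  assumes I: "two_sided_ideal I" and dec: "surj dec"
begin

text \<open>
  The residue class \<open>p + I\<close>, with its elements written as functions on words over \<^typ>\<open>nat\<close>. Precomposition
  with \<open>map dec\<close> is injective because \<open>dec\<close> is surjective, so no information about the class is lost.
\<close>

definition residue_class :: "('y, 'f) free_algebra \<Rightarrow> (nat list \<Rightarrow> 'f) set"
  where "residue_class p = (\<lambda>q v. coef q (map dec v)) ` {q. q - p \<in> I}"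

lemma residue_class_eq_iff: "residue_class p = residue_class q \<longleftrightarrow> p - q \<in> I"
proof -
  have inj: "inj (\<lambda>(q :: ('y, 'f) free_algebra) v. coef q (map dec v))"
  proof (rule injI, rule poly_mapping_eqI)
    fix q r :: "('y, 'f) free_algebra" and w
    assume eq: "(\<lambda>v. coef q (map dec v)) = (\<lambda>v. coef r (map dec v))"
    obtain v where "map dec v = w" using dec by (metis surj_def ex_map_conv)
    then show "coef q w = coef r w" using fun_cong[OF eq, of v] by simp
  qed
  have "residue_class p = residue_class q \<longleftrightarrow> {r. r - p \<in> I} = {r. r - q \<in> I}"
    unfolding residue_class_def by (rule inj_image_eq_iff[OF inj])
  also have "\<dots> \<longleftrightarrow> p - q \<in> I"
  proof
    assume "{r. r - p \<in> I} = {r. r - q \<in> I}"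
    then have "p - p \<in> I \<longleftrightarrow> p - q \<in> I" by blast
    then show "p - q \<in> I" using two_sided_idealD(1)[OF I] by simp
  next
    assume pq: "p - q \<in> I"
    have "r - p \<in> I \<longleftrightarrow> r - q \<in> I" for r
    proof
      show "r - q \<in> I" if "r - p \<in> I" using two_sided_idealD(2)[OF I that pq] by simp
      show "r - p \<in> I" if "r - q \<in> I" using two_sided_idealD(6)[OF I that pq] by simp
    qed
    then show "{r. r - p \<in> I} = {r. r - q \<in> I}" by simp
  qed
  finally show ?thesis .
qed

definition representative :: "(nat list \<Rightarrow> 'f) set \<Rightarrow> ('y, 'f) free_algebra"
  where "representative X = (SOME p. coef p [] = 0 \<and> residue_class p = X)"

text \<open>
  The quotient of the augmentation ideal, the elements without constant term, by its intersection with \<open>I\<close>.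
\<close>

definition augmentation_quotient :: "('f, (nat list \<Rightarrow> 'f) set) module"
  where "augmentation_quotient = \<lparr>
    carrier = residue_class ` {p. coef p [] = 0},
    mult = (\<lambda>X Y. residue_class (representative X * representative Y)),
    one = residue_class 0,
    zero = residue_class 0,
    add = (\<lambda>X Y. residue_class (representative X + representative Y)),
    smult = (\<lambda>c X. residue_class (scl c (representative X)))\<rparr>"

lemma representative_residue_class: "coef p [] = 0 \<Longrightarrow> representative (residue_class p) - p \<in> I"
  using someI[of "\<lambda>q. coef q [] = 0 \<and> residue_class q = residue_class p" p] by (simp add: representative_def residue_class_eq_iff)

lemma scl_in_I: "p \<in> I \<Longrightarrow> scl c p \<in> I"
  unfolding scl_def by (rule two_sided_idealD(3)[OF I])

lemma scl_diff: "scl c p - scl c q = scl c (p - q :: ('y, 'f) free_algebra)"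
  by (simp add: scl_def right_diff_distrib)

lemma augmentation_quotient_simps:
  "carrier augmentation_quotient = residue_class ` {p. coef p [] = 0}"
  "\<zero>\<^bsub>augmentation_quotient\<^esub> = residue_class 0"
  "coef p [] = 0 \<Longrightarrow> coef q [] = 0 \<Longrightarrow> residue_class p \<otimes>\<^bsub>augmentation_quotient\<^esub> residue_class q = residue_class (p * q)"
  "coef p [] = 0 \<Longrightarrow> coef q [] = 0 \<Longrightarrow> residue_class p \<oplus>\<^bsub>augmentation_quotient\<^esub> residue_class q = residue_class (p + q)"
  "coef p [] = 0 \<Longrightarrow> c \<odot>\<^bsub>augmentation_quotient\<^esub> residue_class p = residue_class (scl c p)"
proof -
  assume p: "coef p [] = 0"
  note rp = representative_residue_class[OF p]
  have "scl c (representative (residue_class p)) - scl c p \<in> I" unfolding scl_diff by (rule scl_in_I[OF rp])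
  then show "c \<odot>\<^bsub>augmentation_quotient\<^esub> residue_class p = residue_class (scl c p)" by (simp add: augmentation_quotient_def residue_class_eq_iff)
  assume q: "coef q [] = 0"
  note rq = representative_residue_class[OF q]
  have "representative (residue_class p) * representative (residue_class q) - p * q = (representative (residue_class p) - p) * representative (residue_class q) + p * (representative (residue_class q) - q)"
    by (simp add: algebra_simps)
  also have "\<dots> \<in> I" by (intro two_sided_idealD(2,3,4)[OF I] rp rq)
  finally show "residue_class p \<otimes>\<^bsub>augmentation_quotient\<^esub> residue_class q = residue_class (p * q)" by (simp add: augmentation_quotient_def residue_class_eq_iff)
  have "representative (residue_class p) + representative (residue_class q) - (p + q) = (representative (residue_class p) - p) + (representative (residue_class q) - q)"
    by (simp add: algebra_simps)
  also have "\<dots> \<in> I" by (intro two_sided_idealD(2)[OF I] rp rq)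
  finally show "residue_class p \<oplus>\<^bsub>augmentation_quotient\<^esub> residue_class q = residue_class (p + q)" by (simp add: augmentation_quotient_def residue_class_eq_iff)
qed (simp_all add: augmentation_quotient_def)

lemma in_augmentation_quotientE:
  assumes "X \<in> carrier augmentation_quotient"
  obtains p where "X = residue_class p" "coef p [] = 0"
  using assms by (auto simp: augmentation_quotient_simps(1))

lemma residue_class_in_quotient: "coef p [] = 0 \<Longrightarrow> residue_class p \<in> carrier augmentation_quotient"
  by (auto simp: augmentation_quotient_simps(1))

lemma nonunital_algebra_augmentation_quotient: "nonunital_algebra class_ring augmentation_quotient"
proof (intro nonunital_algebra.intro Module.moduleI nonunital_algebra_axioms.intro
    class_cring.cring_axioms)
  show "abelian_group augmentation_quotient"
  proof (rule abelian_groupI)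
    fix X assume "X \<in> carrier augmentation_quotient"
    then obtain p where p: "X = residue_class p" "coef p [] = 0" by (rule in_augmentation_quotientE)
    then have "residue_class (- p) \<oplus>\<^bsub>augmentation_quotient\<^esub> X = \<zero>\<^bsub>augmentation_quotient\<^esub>" by (simp add: augmentation_quotient_simps)
    then show "\<exists>Y\<in>carrier augmentation_quotient. Y \<oplus>\<^bsub>augmentation_quotient\<^esub> X = \<zero>\<^bsub>augmentation_quotient\<^esub>"
      using p residue_class_in_quotient[of "- p"] by auto
  qed (auto elim!: in_augmentation_quotientE simp: augmentation_quotient_simps(2-) residue_class_in_quotient lookup_add add_ac)
qed (auto elim!: in_augmentation_quotientE simp: augmentation_quotient_simps(2-) residue_class_in_quotient lookup_add coef_mult_Nil mult.assoc
    distrib_left distrib_right mult_scl_left mult_scl_right free.scale_left_distrib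
    free.scale_right_distrib)

text \<open>
  Nonempty words are products of letters, and elements without constant term are combinations of
  nonempty words.
\<close>

lemma finitely_generated_augmentation_quotient: "finitely_generated_algebra class_ring augmentation_quotient"
proof -
  interpret Q: nonunital_algebra class_ring augmentation_quotient by (rule nonunital_algebra_augmentation_quotient)
  let ?S = "range (\<lambda>x. residue_class (word [x]))"
  have S: "?S \<subseteq> carrier augmentation_quotient" by (auto intro!: residue_class_in_quotient simp: lookup_single)
  have "subalgebra (carrier augmentation_quotient) class_ring augmentation_quotient"
    unfolding subalgebra_def using Q.carrier_is_submodule Q.mult_closed by simp
  then have "algebra_generated class_ring augmentation_quotient ?S \<subseteq> carrier augmentation_quotient"
    unfolding algebra_generated_def using S by blast
  moreover have "X \<in> B" if B: "subalgebra B class_ring augmentation_quotient" "?S \<subseteq> B" and X: "X \<in> carrier augmentation_quotient" for B X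
  proof -
    have sub: "Module.submodule B class_ring augmentation_quotient" using B by (simp add: subalgebra_def)
    have mult: "x \<otimes>\<^bsub>augmentation_quotient\<^esub> y \<in> B" if "x \<in> B" "y \<in> B" for x y
      using B that by (simp add: subalgebra_def)
    have add: "x \<oplus>\<^bsub>augmentation_quotient\<^esub> y \<in> B" if "x \<in> B" "y \<in> B" for x y
      using Q.submoduleE(5)[OF sub that] .
    have smult: "c \<odot>\<^bsub>augmentation_quotient\<^esub> x \<in> B" if "x \<in> B" for c x
      using Q.submoduleE(4)[OF sub _ that, of c] by simp
    have words: "residue_class (word w) \<in> B" if "w \<noteq> []" for w
      using that
    proof (induction w)
      case (Cons x w)
      have x: "residue_class (word [x]) \<in> B" using B by blast
      show ?case
      proof (cases "w = []")
        case False
        then have "residue_class (word [x]) \<otimes>\<^bsub>augmentation_quotient\<^esub> residue_class (word w) \<in> B" using Cons mult x by simp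
        then show ?thesis using False by (simp add: augmentation_quotient_simps(3) lookup_single single_mult_single)
      qed (use x in simp)
    qed simp
    obtain p where p: "X = residue_class p" "coef p [] = 0" using X by (rule in_augmentation_quotientE)
    have zero: "residue_class 0 \<in> B"
    proof -
      have "0 \<odot>\<^bsub>augmentation_quotient\<^esub> residue_class (word [undefined]) \<in> B" using words by (intro smult) simp
      then show ?thesis by (simp add: augmentation_quotient_simps(5) lookup_single)
    qed
    have "residue_class (\<Sum>w\<in>A. scl (c w) (word w)) \<in> B" if "finite A" "[] \<notin> A" for A c
      using that
    proof (induction A rule: finite_induct)
      case (insert w A)
      have "residue_class (scl (c w) (word w)) \<in> B"
        using smult[OF words[of w], of "c w"] insert.prems by (auto simp: augmentation_quotient_simps(5) lookup_single)
      moreover have "residue_class (\<Sum>w\<in>A. scl (c w) (word w)) \<in> B" using insert by simp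
      moreover have "coef (\<Sum>w\<in>A. scl (c w) (word w)) [] = 0"
        using insert.prems by (auto simp: lookup_sum lookup_single when_def intro!: sum.neutral)
      ultimately show ?case
        using insert.hyps insert.prems add[of "residue_class (scl (c w) (word w))" "residue_class (\<Sum>w\<in>A. scl (c w) (word w))"]
        by (auto simp: augmentation_quotient_simps(4) lookup_single when_def)
    qed (simp add: zero)
    then have "residue_class (\<Sum>w\<in>supp p. scl (coef p w) (word w)) \<in> B"
      using p(2) by (auto simp: in_keys_iff)
    then show ?thesis using p free_algebra_expansion_word[of p] by simp
  qed
  then have "carrier augmentation_quotient \<subseteq> algebra_generated class_ring augmentation_quotient ?S"
    unfolding algebra_generated_def by blast
  ultimately show ?thesis
    unfolding finitely_generated_algebra_def using S by (intro exI[of _ ?S]) auto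
qed

lemma jacobson_radical_augmentation_quotient:
  assumes nil: "\<And>p. coef p [] = 0 \<Longrightarrow> \<exists>n. p ^ n \<in> I"
  shows "jacobson_radical_algebra class_ring augmentation_quotient"
proof -
  interpret Q: nonunital_algebra class_ring augmentation_quotient by (rule nonunital_algebra_augmentation_quotient)
  show ?thesis
    unfolding Q.jacobson_radical_algebra_iff
  proof
    fix X assume "X \<in> carrier augmentation_quotient"
    then obtain p where p: "X = residue_class p" "coef p [] = 0" by (rule in_augmentation_quotientE)
    obtain n where n: "p ^ n \<in> I" using nil[OF p(2)] by blast
    define g where "g = (\<Sum>i<n. p ^ Suc i)"
    have g0: "coef g [] = 0" by (simp add: g_def lookup_sum coef_mult_Nil p(2))
    have "p ^ Suc n \<in> I" using two_sided_idealD(3)[OF I n, of p] by simp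
    then have "- (p ^ Suc n) \<in> I" by (rule two_sided_idealD(5)[OF I])
    moreover have "p * (- g) - (p + (- g)) = - (p ^ Suc n)"
      using sum_powers_quasi_inverse(2)[of p n] by (simp add: g_def algebra_simps)
    moreover have "(- g) * p - (p + (- g)) = - (p ^ Suc n)"
      using sum_powers_quasi_inverse[of p n] by (simp add: g_def algebra_simps)
    ultimately have "residue_class (p * (- g)) = residue_class (p + (- g))" "residue_class ((- g) * p) = residue_class (p + (- g))"
      unfolding residue_class_eq_iff by simp_all
    then show "quasi_invertible augmentation_quotient X"
      unfolding quasi_invertible_def p(1) using p(2) g0 residue_class_in_quotient[of "- g"]
      by (intro bexI[of _ "residue_class (- g)"]) (simp_all add: augmentation_quotient_simps(3,4))
  qed
qed

end

theorem theorem1p3: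
  shows "\<exists>T :: ('f::field, (nat list \<Rightarrow> 'f) set) module.
    nonunital_algebra class_ring T \<and>
    finitely_generated_algebra class_ring T \<and>
    \<not> linear_sofic T \<and>
    jacobson_radical_algebra class_ring T \<and>
    stably_finite (unital_hull T) \<and>
    \<not> linear_sofic (unital_hull T)"
proof -
  have "CARD(bool option) \<ge> 3" by simp
  then obtain I :: "(bool option option, 'f) free_algebra set" and x y b a where
    I: "two_sided_ideal I" and nil: "\<And>p. coef p [] = 0 \<Longrightarrow> \<exists>n. p ^ n \<in> I"
    and c: "\<And>i. coef (x i) [] = 0" "\<And>i. coef (y i) [] = 0" "coef b [] = 0" "coef a [] = 0"
    and a: "a \<notin> I" and xby: "\<And>i j :: nat. x i * (b * y j) - (if i = j then a else 0) \<in> I"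
    using nil_quotient_with_diagonal_relations[where 'f = 'f] by blast
  obtain dec :: "nat \<Rightarrow> bool option option"
    where "bij_betw dec {0..<card (UNIV :: bool option option set)} UNIV"
    using ex_bij_betw_nat_finite[OF finite] by blast
  then have dec: "surj dec" by (auto simp: bij_betw_def)
  let ?T = "augmentation_quotient I dec" and ?residue_class = "residue_class I dec"
  note simps = augmentation_quotient_simps[OF I dec]
  note T = nonunital_algebra_augmentation_quotient[OF I dec]
  note car = residue_class_in_quotient[OF I dec]
  have J: "jacobson_radical_algebra class_ring ?T" by (rule jacobson_radical_augmentation_quotient[OF I dec nil])
  have xby': "?residue_class (x i) \<otimes>\<^bsub>?T\<^esub> (?residue_class b \<otimes>\<^bsub>?T\<^esub> ?residue_class (y j)) = (if i = j then ?residue_class a else \<zero>\<^bsub>?T\<^esub>)" for i j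
  proof -
    have "?residue_class (x i * (b * y j)) = ?residue_class (if i = j then a else 0)"
      using xby unfolding residue_class_eq_iff[OF I dec] .
    then show ?thesis using c by (simp add: simps coef_mult_Nil split: if_splits)
  qed
  have a': "?residue_class a \<noteq> \<zero>\<^bsub>?T\<^esub>" using a by (simp add: simps residue_class_eq_iff[OF I dec])
  have "\<not> linear_sofic ?T"
    by (rule not_linear_sofic_if_diagonal_relations[OF T _ _ _ xby' a']) (simp_all add: car c)
  moreover have "\<not> linear_sofic (unital_hull ?T)"
  proof (rule not_linear_sofic_if_diagonal_relations[OF nonunital_algebra_unital_hull[OF T],
        of "\<lambda>i. (0, ?residue_class (x i))" "\<lambda>i. (0, ?residue_class (y i))" "(0, ?residue_class b)" "(0, ?residue_class a)"])
    have zero: "0 \<odot>\<^bsub>?T\<^esub> ?residue_class p \<oplus>\<^bsub>?T\<^esub> 0 \<odot>\<^bsub>?T\<^esub> ?residue_class q \<oplus>\<^bsub>?T\<^esub> ?residue_class r = ?residue_class r"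
      if "coef p [] = 0" "coef q [] = 0" "coef r [] = 0" for p q r
      using that by (simp add: simps)
    show "(0, ?residue_class (x i)) \<otimes>\<^bsub>unital_hull ?T\<^esub> ((0, ?residue_class b) \<otimes>\<^bsub>unital_hull ?T\<^esub> (0, ?residue_class (y j)))
      = (if i = j then (0, ?residue_class a) else \<zero>\<^bsub>unital_hull ?T\<^esub>)" for i j
      using xby'[of i j] c by (simp add: simps(2,3) zero coef_mult_Nil)
  qed (use a' in \<open>simp_all add: car c\<close>)
  ultimately show ?thesis
    using T J finitely_generated_augmentation_quotient[OF I dec] stably_finite_unital_hull[OF T J] by blast
qed

end
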